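(* Fix a total order on finite nonempty sets of positive integers. For every partition $\mu=(\mu_1,\ldots,\mu_\ell)$, \[ e_\mu=\sum_T\tilde s_{\overline{shape(T)}}, \] where the sum is over all tableaux $T$ (French notation) of skew shape $\lambda/(\lambda_2)$ for some partition $\lambda$ (the leftmost $\lambda_2$ cells of the first row blank, all other cells filled) whose filled cells contain non-empty sets of positive integers (no repeated entries inside a set), which are weakly increasing along rows and up columns, whose total content (multiset union of the entries) is $\{\!\!\{1^{\mu_1},\ldots,\ell^{\mu_\ell}\}\!\!\}$, and such that a given set may appear more than once in the same column if and only if it has an odd number of elements, and may appear more than once in the same row if and only if it has an even number of elements. Here $\overline{\lambda}=(\lambda_2,\lambda_3,\ldots)$ for $\lambda=shape(T)$ the outer shape.
   Context: $Sym=\mathbb{Q}[p_1,p_2,\ldots]$ with elementary functions $e_\lambda$, complete functions $h_\lambda$, Schur functions $s_\lambda$. A multiset partition of a multiset $S$ is a multiset of nonempty multisets with multiset union $S$; $\tilde m(\pi)$ is the partition of multiplicities of the distinct multisets in $\pi$. The basis $\{\tilde h_\lambda\}$ is determined recursively by $h_\lambda=\sum_\pi\tilde h_{\tilde m(\pi)}$, summed over multiset partitions $\pi$ of $\{\!\!\{1^{\lambda_1},\ldots,\ell(\lambda)^{\lambda_{\ell(\lambda)}}\}\!\!\}$. The irreducible character basis is $\tilde s_\lambda=\sum_{|\mu|\le|\lambda|}K^{-1}_{(n-|\lambda|,\lambda),(n-|\mu|,\mu)}\tilde h_\mu$ for any $n\ge 2|\lambda|$, with $K^{-1}$ the inverse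 Kostka matrix ($s_\alpha=\sum_\beta K^{-1}_{\alpha\beta}h_\beta$). *)

theory Defs
  imports Complex_Main "HOL-Library.Multiset"
begin

text \<open>Symmetric functions over Q are modelled by their evaluations: an element of Sym
is a function of the number N of variables and of a point x (only x 0, ..., x (N-1) are used).
Two symmetric functions are equal iff their evaluations agree for all N and x.\<close>

type_synonym sf = "nat \<Rightarrow> (nat \<Rightarrow> rat) \<Rightarrow> rat"

definition is_partition :: "nat list \<Rightarrow> bool" where
  "is_partition l \<longleftrightarrow> sorted_wrt (\<ge>) l \<and> (\<forall>k\<in>set l. 0 < k)"

definition partitions_of :: "nat \<Rightarrow> nat list set" where
  "partitions_of n = {l. is_partition l \<and> sum_list l = n}"

definition h_k :: "nat \<Rightarrow> sf" where
  "h_k k N x = (\<Sum>M\<in>{M. set_mset M \<subseteq> {..<N} \<and> size M = k}. prod_mset (image_mset x M))"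

definition e_k :: "nat \<Rightarrow> sf" where
  "e_k k N x = (\<Sum>S\<in>{S. S \<subseteq> {..<N} \<and> card S = k}. \<Prod>i\<in>S. x i)"

definition h_part :: "nat list \<Rightarrow> sf" where
  "h_part l N x = prod_list (map (\<lambda>k. h_k k N x) l)"

definition e_part :: "nat list \<Rightarrow> sf" where
  "e_part l N x = prod_list (map (\<lambda>k. e_k k N x) l)"

definition cells :: "nat list \<Rightarrow> (nat \<times> nat) set" where
  "cells l = {(r, c). r < length l \<and> c < l ! r}"

definition ssyt :: "nat \<Rightarrow> nat list \<Rightarrow> (nat \<times> nat \<Rightarrow> nat) \<Rightarrow> bool" where
  "ssyt N l T \<longleftrightarrow> (\<forall>p. p \<notin> cells l \<longrightarrow> T p = 0) \<and> (\<forall>p\<in>cells l. T p < N) \<and>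
     (\<forall>r c. (r, Suc c) \<in> cells l \<longrightarrow> T (r, c) \<le> T (r, Suc c)) \<and>
     (\<forall>r c. (Suc r, c) \<in> cells l \<longrightarrow> T (r, c) < T (Suc r, c))"

definition schur :: "nat list \<Rightarrow> sf" where
  "schur l N x = (\<Sum>T\<in>{T. ssyt N l T}. \<Prod>p\<in>cells l. x (T p))"

definition kostka_inv :: "nat list \<Rightarrow> nat list \<Rightarrow> rat" where
  "kostka_inv \<alpha> = (THE c. (\<forall>\<gamma>. \<gamma> \<notin> partitions_of (sum_list \<alpha>) \<longrightarrow> c \<gamma> = 0) \<and>
      (\<forall>N x. schur \<alpha> N x = (\<Sum>\<gamma>\<in>partitions_of (sum_list \<alpha>). c \<gamma> * h_part \<gamma> N x)))"

definition mset_partitions :: "nat multiset \<Rightarrow> nat multiset multiset set" where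
  "mset_partitions S = {\<pi>. sum_mset \<pi> = S \<and> {#} \<notin># \<pi>}"

definition mtilde :: "nat multiset multiset \<Rightarrow> nat list" where
  "mtilde \<pi> = rev (sorted_list_of_multiset (image_mset (count \<pi>) (mset_set (set_mset \<pi>))))"

definition part_content :: "nat list \<Rightarrow> nat multiset" where
  "part_content l = (\<Sum>i<length l. replicate_mset (l ! i) (Suc i))"

definition htilde :: "nat list \<Rightarrow> sf" where
  "htilde = (THE H. (\<forall>l. \<not> is_partition l \<longrightarrow> H l = (\<lambda>N x. 0)) \<and>
      (\<forall>l. is_partition l \<longrightarrow> (\<forall>N x. h_part l N x =
          (\<Sum>\<pi>\<in>mset_partitions (part_content l). H (mtilde \<pi>) N x))))"

definition pad :: "nat \<Rightarrow> nat list \<Rightarrow> nat list" where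
  "pad k l = (if k = 0 then l else k # l)"

definition stilde :: "nat list \<Rightarrow> sf" where
  "stilde l N x = (let n = 2 * sum_list l in
     (\<Sum>\<mu>\<in>{\<mu>. is_partition \<mu> \<and> sum_list \<mu> \<le> sum_list l}.
        kostka_inv (pad (n - sum_list l) l) (pad (n - sum_list \<mu>) \<mu>) * htilde \<mu> N x))"

text \<open>Filled cells of the skew shape lambda/(lambda_2) (French notation: row 0 at the bottom).\<close>
definition skew_cells :: "nat list \<Rightarrow> (nat \<times> nat) set" where
  "skew_cells l = cells l - {(0, c) | c. c < (if 1 < length l then l ! 1 else 0)}"

definition set_tableau ::
  "(nat set \<times> nat set) set \<Rightarrow> nat multiset \<Rightarrow> nat list \<Rightarrow> (nat \<times> nat \<Rightarrow> nat set) \<Rightarrow> bool" where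
  "set_tableau ord C l T \<longleftrightarrow> is_partition l \<and>
     (\<forall>p. p \<notin> skew_cells l \<longrightarrow> T p = {}) \<and>
     (\<forall>p\<in>skew_cells l. finite (T p) \<and> T p \<noteq> {} \<and> 0 \<notin> T p) \<and>
     (\<forall>r c. (r, c) \<in> skew_cells l \<and> (r, Suc c) \<in> skew_cells l \<longrightarrow> (T (r, c), T (r, Suc c)) \<in> ord) \<and>
     (\<forall>r c. (r, c) \<in> skew_cells l \<and> (Suc r, c) \<in> skew_cells l \<longrightarrow> (T (r, c), T (Suc r, c)) \<in> ord) \<and>
     (\<Sum>p\<in>skew_cells l. mset_set (T p)) = C \<and>
     (\<forall>r c c'. (r, c) \<in> skew_cells l \<and> (r, c') \<in> skew_cells l \<and> c \<noteq> c' \<and> T (r, c) = T (r, c')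
         \<longrightarrow> even (card (T (r, c)))) \<and>
     (\<forall>r r' c. (r, c) \<in> skew_cells l \<and> (r', c) \<in> skew_cells l \<and> r \<noteq> r' \<and> T (r, c) = T (r', c)
         \<longrightarrow> odd (card (T (r, c))))"

end

theory Submission
  imports Defs "HOL-Library.Function_Algebras" 
    "HOL-Computational_Algebra.Polynomial" "HOL-Computational_Algebra.Formal_Power_Series"
begin

text \<open>Let \<open>Theta\<close> be the linear map with \<open>Theta h_\<gamma> = htilde_\<gamma>\<close>. The defining relation of
  \<open>htilde\<close> says that a product of complete functions is the sum over multiset partitions \<open>\<pi>\<close>
  of \<open>Theta\<close> applied to the product of the \<open>h_m\<close>, \<open>m\<close> running through the multiplicities of
  \<open>\<pi>\<close>. Using \<open>\<Sum> (-1)^i e_i h_(k-i) = 0\<close> one may turn letters from even to odd one at a time; the blocks are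
  then sets in the odd letters, and a block with an odd number of odd letters contributes
  \<open>e_m\<close> instead of \<open>h_m\<close>. With all letters odd, \<open>e_\<mu>\<close> is the sum of
  \<open>Theta (\<Prod> h_m \<Prod> e_m)\<close> over multisets of sets with content \<open>\<mu>\<close>.

  Let \<open>Lambda\<close> be the linear map with \<open>Lambda s_\<lambda> = stilde_\<lambda>\<close>, and let \<open>add_one\<close> be the ring
  homomorphism that adjoins a variable with value 1, so that \<open>add_one s_\<lambda>\<close> is the sum of the
  \<open>s_\<nu>\<close> with \<open>\<lambda>/\<nu>\<close> a horizontal strip. Multiplying by a large \<open>h_k\<close> and applying the Pieri rule
  gives \<open>Theta = Lambda \<circ> add_one\<close>. Applied to a product of \<open>h_m\<close> and \<open>e_m\<close>, \<open>add_one\<close> splits off a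
  one-row tableau, and the Pieri rules expand the remaining product into Schur functions
  indexed by tableaux of straight shape. A skew shape \<open>\<lambda>/(\<lambda>_2)\<close> is the disjoint
  union of its first row and the straight shape \<open>(\<lambda>_2, \<lambda>_3, \<dots>)\<close>.\<close>

section \<open>Partitions as functions and tableaux with even and odd letters\<close>

text \<open>The obstacle is that \<open>stilde\<close> is defined through padded shapes at the
  single size n = 2|l|, while \<open>Theta\<close> knows nothing of padding. The auxiliary map
  \<open>Psi\<close>, sending \<open>h_part \<gamma>\<close> to \<open>htilde\<close> of \<gamma>
  without its first part, connects them: stilde_l = Psi(s_(k,l)) for k = |l|, and Theta(s_f) =
  Psi(h_k s_f) once k >= |f|. Since Theta(s_f) does not involve k, Psi(s_(k,l)) is stable for k >=
  |l|, and the Pieri rule for h_k yields the sum over horizontal strips.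

  The rules on equal entries come from the two Pieri rules: a set occurring m times contributes h_m
  or e_m according to its parity, so its cells form a horizontal or a vertical strip.
  \<open>tab\<close> therefore allows any parity of letters; semistandard tableaux are the case of
  even letters only, and one bijection, removal of the greatest letter, serves both for branching in
  the last variable and for the tableau expansions.

  Because an element of Sym is just a function of N and x, independence of Schur functions and of
  products of complete functions must be proved before linear maps can be prescribed on them and
  before the inverse Kostka numbers are determined.\<close>

definition pfun :: "(nat \<Rightarrow> nat) \<Rightarrow> bool" where
  "pfun f \<longleftrightarrow> antimono f \<and> (\<exists>n. f n = 0)"

definition fcells :: "(nat \<Rightarrow> nat) \<Rightarrow> (nat \<times> nat) set" where
  "fcells f = {(r, c). c < f r}"

definition fsize :: "(nat \<Rightarrow> nat) \<Rightarrow> nat" where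
  "fsize f = card (fcells f)"

lemma mem_fcells [simp]: "(r, c) \<in> fcells f \<longleftrightarrow> c < f r"
  by (simp add: fcells_def)

lemma pfun_antimono: "pfun f \<Longrightarrow> i \<le> j \<Longrightarrow> f j \<le> f i"
  by (auto simp: pfun_def antimono_def)

lemma pfunI: "(\<And>i. f (Suc i) \<le> f i) \<Longrightarrow> f n = 0 \<Longrightarrow> pfun f"
  unfolding pfun_def antimono_def by (metis lift_Suc_antimono_le)

lemma pfun_eventually_0:
  assumes "pfun f" obtains n where "\<And>i. n \<le> i \<Longrightarrow> f i = 0"
  using assms unfolding pfun_def antimono_def by (metis le_zero_eq)

lemma fcells_Sigma:
  assumes "\<And>i. n \<le> i \<Longrightarrow> f i = 0"
  shows "fcells f = Sigma {..<n} (\<lambda>r. {..<f r})"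
  using assms by (auto simp: fcells_def) (metis not_less less_nat_zero_code)

lemma finite_fcells [simp]: "pfun f \<Longrightarrow> finite (fcells f)"
  by (erule pfun_eventually_0) (subst fcells_Sigma, auto)

lemma fsize_eq_sum:
  assumes "\<And>i. n \<le> i \<Longrightarrow> f i = 0"
  shows "fsize f = (\<Sum>i<n. f i)"
  unfolding fsize_def by (subst fcells_Sigma) (use assms in auto)

lemma fcells_inject: "fcells f = fcells g \<Longrightarrow> f = g"
proof
  fix i assume "fcells f = fcells g"
  then have "\<forall>c. c < f i \<longleftrightarrow> c < g i" by (metis mem_fcells)
  then show "f i = g i" by (metis linorder_neqE_nat less_irrefl)
qed

lemma fcells_mono: "(\<And>i. f i \<le> g i) \<Longrightarrow> fcells f \<subseteq> fcells g"
  by (force simp: fcells_def intro: less_le_trans)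

lemma fsize_diff:
  assumes "pfun g" "\<And>i. f i \<le> g i"
  shows "card (fcells g - fcells f) = fsize g - fsize f" "fsize f \<le> fsize g"
proof -
  have "fcells f \<subseteq> fcells g" using assms(2) by (rule fcells_mono)
  moreover from this have "finite (fcells f)" using assms(1) by (meson finite_fcells finite_subset)
  ultimately show "card (fcells g - fcells f) = fsize g - fsize f" "fsize f \<le> fsize g"
    using assms by (auto simp: fsize_def card_Diff_subset intro: card_mono)
qed

lemma fsize_eq_imp_eq:
  assumes "pfun g" "\<And>i. f i \<le> g i" "fsize f = fsize g"
  shows "f = g"
proof -
  have "fcells f \<subseteq> fcells g" using assms(2) by (rule fcells_mono)
  with assms have "fcells f = fcells g"
    by (metis card_subset_eq finite_fcells fsize_def)
  then show ?thesis by (rule fcells_inject)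
qed

lemma pfun_zero [simp]: "pfun (\<lambda>_. 0)"
  by (simp add: pfun_def antimono_def)

lemma fsize_zero [simp]: "fsize (\<lambda>_. 0) = 0"
  by (simp add: fsize_def fcells_def)

lemma fsize_eq_0_iff: "pfun f \<Longrightarrow> fsize f = 0 \<longleftrightarrow> f = (\<lambda>_. 0)"
  using fsize_eq_imp_eq[of f "\<lambda>_. 0"] by (metis fsize_eq_imp_eq fsize_zero le0)

lemma pfun_shift: "pfun f \<Longrightarrow> pfun (f \<circ> Suc)"
  by (auto simp: pfun_def antimono_def) (metis le_zero_eq lessI less_imp_le)

lemma pfun_case_nat:
  assumes "pfun f" "f 0 \<le> k" shows "pfun (case_nat k f)"
proof -
  obtain n where n: "\<And>i. n \<le> i \<Longrightarrow> f i = 0" using pfun_eventually_0[OF assms(1)] by blast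
  show ?thesis
    by (rule pfunI[of _ "Suc n"])
      (use assms n in \<open>auto simp: split: nat.split intro: pfun_antimono\<close>)
qed

lemma fsize_shift:
  assumes "pfun f" shows "fsize f = f 0 + fsize (f \<circ> Suc)"
proof -
  obtain n where n: "\<And>i. n \<le> i \<Longrightarrow> f i = 0" using pfun_eventually_0[OF assms(1)] by blast
  have "fsize f = (\<Sum>i<Suc n. f i)" by (rule fsize_eq_sum) (simp add: n)
  moreover have "fsize (f \<circ> Suc) = (\<Sum>i<n. (f \<circ> Suc) i)" by (rule fsize_eq_sum) (simp add: n)
  ultimately show ?thesis by (simp add: sum.lessThan_Suc_shift del: sum.lessThan_Suc)
qed

lemma fsize_ge: "pfun f \<Longrightarrow> f i \<le> fsize f"
proof -
  assume f: "pfun f"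
  have "f i \<le> f 0" using f by (simp add: pfun_antimono)
  then show ?thesis using fsize_shift[OF f] by simp
qed

text \<open>If row \<open>i\<close> is nonempty, so are all earlier rows, and column 0 alone has
  more than \<open>i\<close> cells. With \<open>fsize_ge\<close> this confines the partitions of
  size at most n to an n by n box, hence \<open>finite_pfun_le\<close>.\<close>

lemma fsize_support:
  assumes f: "pfun f" and i: "fsize f \<le> i" shows "f i = 0"
proof (rule ccontr)
  assume "f i \<noteq> 0"
  then have "\<forall>j\<le>i. 0 < f j" using pfun_antimono[OF f] by (metis bot_nat_0.not_eq_extremum le_zero_eq)
  then have "(\<lambda>j. (j, 0)) ` {..i} \<subseteq> fcells f" by auto
  then have "card ((\<lambda>j. (j, 0::nat)) ` {..i}) \<le> fsize f" unfolding fsize_def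
    by (intro card_mono) (use f in auto)
  moreover have "card ((\<lambda>j. (j, 0::nat)) ` {..i}) = Suc i" by (subst card_image) (auto simp: inj_on_def)
  ultimately show False using i by simp
qed

lemma finite_pfun_le: "finite {f. pfun f \<and> fsize f \<le> n}"
proof (rule finite_subset)
  show "{f. pfun f \<and> fsize f \<le> n} \<subseteq> {f. \<forall>i. (i \<in> {..<n} \<longrightarrow> f i \<in> {..n}) \<and> (i \<notin> {..<n} \<longrightarrow> f i = 0)}"
    using fsize_ge fsize_support by (auto simp: not_less) (meson le_trans)+
  show "finite {f. \<forall>i. (i \<in> {..<n} \<longrightarrow> f i \<in> {..n}) \<and> (i \<notin> {..<n} \<longrightarrow> f i = (0::nat))}"
    by (rule finite_set_of_finite_funs) auto
qed

lemma finite_pfun_eq: "finite {f. pfun f \<and> fsize f = n}"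
  by (rule finite_subset[OF _ finite_pfun_le[of n]]) auto

section \<open>Horizontal and vertical strips\<close>

definition hstrip :: "(nat \<Rightarrow> nat) \<Rightarrow> (nat \<Rightarrow> nat) \<Rightarrow> bool" where
  "hstrip g f \<longleftrightarrow> pfun g \<and> pfun f \<and> (\<forall>i. g i \<le> f i \<and> f (Suc i) \<le> g i)"

text \<open>\<open>hstrip\<close> is interlacing, at most one new cell per column; here the bound is
  one new cell per row. Both are inequalities between row lengths, which is the gain from letting a
  partition be a function defined on every row.\<close>

definition vstrip :: "(nat \<Rightarrow> nat) \<Rightarrow> (nat \<Rightarrow> nat) \<Rightarrow> bool" where
  "vstrip g f \<longleftrightarrow> pfun g \<and> pfun f \<and> (\<forall>i. g i \<le> f i \<and> f i \<le> Suc (g i))"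

text \<open>The flag is the parity of the letter that fills the strip: copies of an even letter lie
  in distinct columns, copies of an odd letter in distinct rows.\<close>

definition strip :: "bool \<Rightarrow> (nat \<Rightarrow> nat) \<Rightarrow> (nat \<Rightarrow> nat) \<Rightarrow> bool" where
  "strip b = (if b then hstrip else vstrip)"

lemma strip_pfun: "strip b g f \<Longrightarrow> pfun g" "strip b g f \<Longrightarrow> pfun f"
  and strip_le: "strip b g f \<Longrightarrow> g i \<le> f i"
  by (auto simp: strip_def hstrip_def vstrip_def split: if_splits)

lemma strip_fsize: "strip b g f \<Longrightarrow> fsize g \<le> fsize f"
  by (meson fsize_diff(2) strip_le strip_pfun(2))

lemma finite_strip_below: "finite {g. strip b g f}"
  by (rule finite_subset[OF _ finite_pfun_le[of "fsize f"]]) (auto dest: strip_pfun strip_fsize)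

lemma finite_strip_above: "finite {f. strip b g f \<and> fsize f = n}"
  by (rule finite_subset[OF _ finite_pfun_eq[of n]]) (auto dest: strip_pfun)

section \<open>Tableaux with even and odd letters, and removal of the greatest letter\<close>

lemma downset_eq_lessThan_card:
  assumes "finite (S::nat set)" "\<And>i j. j \<in> S \<Longrightarrow> i < j \<Longrightarrow> i \<in> S"
  shows "S = {..<card S}"
proof -
  define m where "m = (LEAST m. m \<notin> S)"
  have "\<exists>m. m \<notin> S" using assms(1) by (metis UNIV_eq_I infinite_UNIV_nat)
  then have m: "m \<notin> S" "\<And>i. i < m \<Longrightarrow> i \<in> S"
    unfolding m_def by (metis LeastI_ex, metis not_less_Least)
  have "S = {..<m}"
    using m assms(2) by auto (metis linorder_neqE_nat)
  then show ?thesis by (metis card_lessThan)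
qed

text \<open>Order and repetition conditions are demanded of all pairs of cells in a line, not only
  of neighbours, so that no property of \<open>R\<close> is built in. The fixed value
  \<open>d\<close> outside the diagram makes a filling determined by its cells, so that fillings can
  be counted as functions. With \<open>ev\<close> constantly true and \<open>R\<close> the order of
  the numbers these are semistandard tableaux.\<close>

definition tab :: "'a \<Rightarrow> ('a \<times> 'a) set \<Rightarrow> ('a \<Rightarrow> bool) \<Rightarrow> 'a set \<Rightarrow> (nat \<Rightarrow> nat) \<Rightarrow> (nat \<times> nat \<Rightarrow> 'a) \<Rightarrow> bool" where
  "tab d R ev A f T \<longleftrightarrow> (\<forall>p. p \<notin> fcells f \<longrightarrow> T p = d) \<and> (\<forall>p\<in>fcells f. T p \<in> A) \<and>
     (\<forall>r c c'. c < c' \<longrightarrow> c' < f r \<longrightarrow> (T (r, c), T (r, c')) \<in> R \<and> (T (r, c) = T (r, c') \<longrightarrow> ev (T (r, c)))) \<and>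
     (\<forall>r r' c. r < r' \<longrightarrow> c < f r' \<longrightarrow> (T (r, c), T (r', c)) \<in> R \<and> (T (r, c) = T (r', c) \<longrightarrow> \<not> ev (T (r, c))))"

definition tmult :: "(nat \<Rightarrow> nat) \<Rightarrow> (nat \<times> nat \<Rightarrow> 'a) \<Rightarrow> 'a multiset" where
  "tmult f T = image_mset T (mset_set (fcells f))"

definition tjoin :: "'a \<Rightarrow> (nat \<Rightarrow> nat) \<Rightarrow> (nat \<Rightarrow> nat) \<Rightarrow> (nat \<times> nat \<Rightarrow> 'a) \<Rightarrow> nat \<times> nat \<Rightarrow> 'a" where
  "tjoin a f g T p = (if p \<in> fcells f - fcells g then a else T p)"

lemma tab_outside: "tab d R ev A f T \<Longrightarrow> p \<notin> fcells f \<Longrightarrow> T p = d"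
  and tab_letter: "tab d R ev A f T \<Longrightarrow> p \<in> fcells f \<Longrightarrow> T p \<in> A"
  and tab_row: "tab d R ev A f T \<Longrightarrow> c < c' \<Longrightarrow> c' < f r \<Longrightarrow>
     (T (r, c), T (r, c')) \<in> R \<and> (T (r, c) = T (r, c') \<longrightarrow> ev (T (r, c)))"
  and tab_col: "tab d R ev A f T \<Longrightarrow> r < r' \<Longrightarrow> c < f r' \<Longrightarrow>
     (T (r, c), T (r', c)) \<in> R \<and> (T (r, c) = T (r', c) \<longrightarrow> \<not> ev (T (r, c)))"
  unfolding tab_def by blast+

text \<open>Two copies of the greatest letter \<open>a\<close> in one row require
  \<open>ev a\<close>, and a vertical strip has no two cells in a row; dually for columns and
  horizontal strips. Every other pair of cells either lies in \<open>g\<close> or leads from a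
  smaller letter to \<open>a\<close>.\<close>

lemma tab_join:
  assumes s: "strip (ev a) g f" and T: "tab d R ev B g T"
    and a: "a \<notin> B" "(a, a) \<in> R" "\<And>b. b \<in> B \<Longrightarrow> (b, a) \<in> R"
  shows "tab d R ev (insert a B) f (tjoin a f g T)"
proof -
  note le = strip_le[OF s]
  have anti: "\<And>i j. i \<le> j \<Longrightarrow> f j \<le> f i" "\<And>i j. i \<le> j \<Longrightarrow> g j \<le> g i"
    using strip_pfun[OF s] by (auto intro: pfun_antimono)
  have le': "c < f r" if "c < g r" for c r using that le[of r] by simp
  show ?thesis
    unfolding tab_def
  proof (intro conjI allI impI ballI)
    fix p assume "p \<notin> fcells f"
    then show "tjoin a f g T p = d"
      using tab_outside[OF T, of p] le by (cases p) (auto simp: tjoin_def not_less intro: order_trans)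
  next
    fix p assume "p \<in> fcells f"
    then show "tjoin a f g T p \<in> insert a B"
      using tab_letter[OF T, of p] by (auto simp: tjoin_def)
  next
    fix r c c' assume c: "c < c'" "c' < f r"
    have l: "T (r, c) \<in> B" if "c < g r" using tab_letter[OF T] that by simp
    have e: "ev a" if "\<not> c < g r"
    proof (rule ccontr)
      assume "\<not> ev a"
      then have "f r \<le> Suc (g r)" using s by (simp add: strip_def vstrip_def)
      then show False using c that by simp
    qed
    show "(tjoin a f g T (r, c), tjoin a f g T (r, c')) \<in> R"
      using c tab_row[OF T c(1), of r] l a by (auto simp: tjoin_def)
    show "ev (tjoin a f g T (r, c))" if "tjoin a f g T (r, c) = tjoin a f g T (r, c')"
      using c tab_row[OF T c(1), of r] l a that e by (auto simp: tjoin_def split: if_splits)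
  next
    fix r r' c assume c: "r < r'" "c < f r'"
    have f: "c < f r" using anti(1)[of r r'] c by simp
    have g: "c < g r" if "c < g r'" using anti(2)[of r r'] c that by simp
    have l: "T (r, c) \<in> B" if "c < g r" using tab_letter[OF T] that by simp
    have e: "\<not> ev a" if "\<not> c < g r"
    proof
      assume "ev a"
      then have "f (Suc r) \<le> g r" using s by (simp add: strip_def hstrip_def)
      then show False using c that anti(1)[of "Suc r" r'] by simp
    qed
    show "(tjoin a f g T (r, c), tjoin a f g T (r', c)) \<in> R"
      using c tab_col[OF T c(1), of c] l a f g by (auto simp: tjoin_def)
    show "\<not> ev (tjoin a f g T (r, c))" if "tjoin a f g T (r, c) = tjoin a f g T (r', c)"
      using c tab_col[OF T c(1), of c] l a that e f g by (auto simp: tjoin_def split: if_splits)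
  qed
qed

text \<open>Nothing but \<open>a\<close> can stand to the right of or above an \<open>a\<close>, so
  the cells with other letters form a smaller diagram; the repetition rule for \<open>a\<close> says
  that the remaining cells form a strip of the right kind.\<close>

lemma tab_split:
  assumes f: "pfun f" and T: "tab d R ev (insert a B) f T"
    and a: "a \<notin> B" "\<And>b. b \<in> B \<Longrightarrow> (a, b) \<notin> R"
  obtains g T' where "strip (ev a) g f" "tab d R ev B g T'" "T = tjoin a f g T'"
proof -
  have anti: "\<And>i j. i \<le> j \<Longrightarrow> f j \<le> f i" using f by (auto intro: pfun_antimono)
  have max: "y = a" if "(a, y) \<in> R" "y \<in> insert a B" for y using that a by auto
  \<comment> \<open>Counting the entries other than \<open>a\<close> gives the row length because
    they form an initial segment of the row.\<close>
  define g where "g r = card {c. c < f r \<and> T (r, c) \<noteq> a}" for r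
  have g_eq: "{c. c < f r \<and> T (r, c) \<noteq> a} = {..<g r}" for r
    unfolding g_def
  proof (rule downset_eq_lessThan_card)
    fix i j assume j: "j \<in> {c. c < f r \<and> T (r, c) \<noteq> a}" and "i < j"
    then show "i \<in> {c. c < f r \<and> T (r, c) \<noteq> a}"
      using tab_row[OF T \<open>i < j\<close>, of r] max[of "T (r, j)"] tab_letter[OF T, of "(r, j)"] by auto
  qed simp
  have g: "c < g r \<longleftrightarrow> c < f r \<and> T (r, c) \<noteq> a" for r c using g_eq[of r] by blast
  have le: "g r \<le> f r" for r using g by (metis not_less_iff_gr_or_eq order.asym not_le_imp_less le_refl)
  have g_anti: "g (Suc r) \<le> g r" for r
  proof (rule ccontr)
    assume "\<not> g (Suc r) \<le> g r"
    then have *: "g r < f (Suc r)" "T (Suc r, g r) \<noteq> a" using g[of "g r" "Suc r"] by auto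
    then have "T (r, g r) = a" using g[of "g r" r] anti[of r "Suc r"] by auto
    then show False
      using tab_col[OF T, of r "Suc r" "g r"] max[of "T (Suc r, g r)"] tab_letter[OF T, of "(Suc r, g r)"] * by auto
  qed
  obtain n where n: "f n = 0" using f by (auto simp: pfun_def)
  have pg: "pfun g" by (rule pfunI[of _ n]) (use g_anti le[of n] n in auto)
  have s: "strip (ev a) g f"
  proof (cases "ev a")
    case True
    have "f (Suc i) \<le> g i" for i
    proof (rule ccontr)
      assume "\<not> f (Suc i) \<le> g i"
      then have *: "g i < f (Suc i)" by simp
      then have "T (i, g i) = a" using g[of "g i" i] anti[of i "Suc i"] by auto
      then show False
        using tab_col[OF T, of i "Suc i" "g i"] max[of "T (Suc i, g i)"] tab_letter[OF T, of "(Suc i, g i)"] * True by auto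
    qed
    then show ?thesis using True pg f le by (simp add: strip_def hstrip_def)
  next
    case False
    have "f i \<le> Suc (g i)" for i
    proof (rule ccontr)
      assume "\<not> f i \<le> Suc (g i)"
      then have *: "Suc (g i) < f i" by simp
      then have "T (i, g i) = a" "T (i, Suc (g i)) = a" using g[of "g i" i] g[of "Suc (g i)" i] by auto
      then show False
        using tab_row[OF T, of "g i" "Suc (g i)" i] * False by auto
    qed
    then show ?thesis using False pg f le by (simp add: strip_def vstrip_def)
  qed
  define T' where "T' p = (if p \<in> fcells g then T p else d)" for p
  have T': "tab d R ev B g T'"
    unfolding tab_def
  proof (intro conjI allI impI ballI)
    fix p assume "p \<in> fcells g"
    then show "T' p \<in> B" using tab_letter[OF T, of p] g by (cases p) (auto simp: T'_def)
  next
    fix r c c' assume c: "c < c'" "c' < g r"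
    then show "(T' (r, c), T' (r, c')) \<in> R" and "T' (r, c) = T' (r, c') \<Longrightarrow> ev (T' (r, c))"
      using tab_row[OF T c(1), of r] g[of c' r] by (auto simp: T'_def)
  next
    fix r r' c assume c: "r < r'" "c < g r'"
    then have "c < g r" using pfun_antimono[OF pg, of r r'] by simp
    then show "(T' (r, c), T' (r', c)) \<in> R" and "T' (r, c) = T' (r', c) \<Longrightarrow> \<not> ev (T' (r, c))"
      using tab_col[OF T c(1), of c] c g[of c r'] by (auto simp: T'_def)
  qed (auto simp: T'_def)
  have "T = tjoin a f g T'"
  proof
    fix p show "T p = tjoin a f g T' p"
      using g tab_outside[OF T, of p] by (cases p) (auto simp: tjoin_def T'_def)
  qed
  with s T' show ?thesis by (rule that)
qed

text \<open>The inner shape is recovered as the set of cells of \<open>f\<close> whose entry differs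
  from \<open>a\<close>.\<close>

lemma tjoin_inject:
  assumes T: "strip b g f" "tab d R ev B g T" "strip b g' f" "tab d R ev B g' T'"
    and a: "a \<notin> B" and eq: "tjoin a f g T = tjoin a f g' T'"
  shows "g = g' \<and> T = T'"
proof -
  have *: "fcells g = {p \<in> fcells f. tjoin a f g T p \<noteq> a}" if "strip b g f" "tab d R ev B g T" for g T
  proof -
    have "fcells g \<subseteq> fcells f" using strip_le[OF that(1)] by (rule fcells_mono)
    then show ?thesis using tab_letter[OF that(2)] a unfolding tjoin_def by auto
  qed
  have "fcells g = fcells g'" using *[OF T(1,2)] *[OF T(3,4)] eq by simp
  then have g: "g = g'" by (rule fcells_inject)
  have "T p = T' p" for p
    using fun_cong[OF eq, of p] tab_outside[OF T(2), of p] tab_outside[OF T(4), of p] g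
    by (auto simp: tjoin_def split: if_splits)
  with g show ?thesis by auto
qed

lemma bij_betw_tjoin:
  assumes "pfun f" "a \<notin> B" "(a, a) \<in> R" "\<And>b. b \<in> B \<Longrightarrow> (b, a) \<in> R" "\<And>b. b \<in> B \<Longrightarrow> (a, b) \<notin> R"
  shows "bij_betw (\<lambda>(g, T). tjoin a f g T) {(g, T). strip (ev a) g f \<and> tab d R ev B g T}
           {T. tab d R ev (insert a B) f T}"
  unfolding bij_betw_def
proof
  show "inj_on (\<lambda>(g, T). tjoin a f g T) {(g, T). strip (ev a) g f \<and> tab d R ev B g T}"
    using tjoin_inject[OF _ _ _ _ assms(2)] unfolding inj_on_def by clarsimp
  show "(\<lambda>(g, T). tjoin a f g T) ` {(g, T). strip (ev a) g f \<and> tab d R ev B g T} =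
          {T. tab d R ev (insert a B) f T}"
  proof (intro subset_antisym subsetI)
    fix T assume "T \<in> (\<lambda>(g, T). tjoin a f g T) ` {(g, T). strip (ev a) g f \<and> tab d R ev B g T}"
    then show "T \<in> {T. tab d R ev (insert a B) f T}"
      using tab_join[OF _ _ assms(2-4)] by auto
  next
    fix T assume "T \<in> {T. tab d R ev (insert a B) f T}"
    then have T: "tab d R ev (insert a B) f T" by simp
    obtain g T' where "strip (ev a) g f" "tab d R ev B g T'" "T = tjoin a f g T'"
      using tab_split[OF assms(1) T assms(2,5)] by blast
    then show "T \<in> (\<lambda>(g, T). tjoin a f g T) ` {(g, T). strip (ev a) g f \<and> tab d R ev B g T}"
      by (intro image_eqI[of _ _ "(g, T')"]) auto
  qed
qed

lemma tmult_tjoin: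
  assumes "strip b g f"
  shows "tmult f (tjoin a f g T) = tmult g T + replicate_mset (fsize f - fsize g) a"
proof -
  have sub: "fcells g \<subseteq> fcells f" using strip_le[OF assms] by (rule fcells_mono)
  have fin: "finite (fcells f)" "finite (fcells g)" using strip_pfun[OF assms] by auto
  have "fcells f = fcells g \<union> (fcells f - fcells g)" using sub by auto
  then have "mset_set (fcells f) = mset_set (fcells g) + mset_set (fcells f - fcells g)"
    using fin by (metis Diff_disjoint finite_Diff mset_set_Union)
  moreover have "image_mset (tjoin a f g T) (mset_set (fcells g)) = image_mset T (mset_set (fcells g))"
    by (rule image_mset_cong) (use fin in \<open>auto simp: tjoin_def\<close>)
  moreover have "image_mset (tjoin a f g T) (mset_set (fcells f - fcells g)) =
      image_mset (\<lambda>_. a) (mset_set (fcells f - fcells g))"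
    by (rule image_mset_cong) (use fin in \<open>auto simp: tjoin_def\<close>)
  moreover have "card (fcells f - fcells g) = fsize f - fsize g"
    using assms strip_pfun(2) strip_le by (metis fsize_diff(1))
  ultimately show ?thesis by (simp add: tmult_def image_mset_const_eq)
qed

section \<open>Partitions as lists and as functions\<close>

definition pf :: "nat list \<Rightarrow> nat \<Rightarrow> nat" where
  "pf l i = (if i < length l then l ! i else 0)"

definition lof :: "(nat \<Rightarrow> nat) \<Rightarrow> nat list" where
  "lof f = map f [0..<(LEAST n. f n = 0)]"

lemma pfun_pf: assumes "is_partition l" shows "pfun (pf l)"
proof (rule pfunI[of _ "length l"])
  fix i show "pf l (Suc i) \<le> pf l i"
    using assms by (auto simp: pf_def is_partition_def sorted_wrt_iff_nth_less)
qed (simp add: pf_def)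

lemma pf_pos: "is_partition l \<Longrightarrow> i < length l \<Longrightarrow> 0 < pf l i"
  by (simp add: is_partition_def pf_def)

lemma length_partition: "is_partition l \<Longrightarrow> (LEAST n. pf l n = 0) = length l"
  by (rule Least_equality) (auto simp: pf_def, metis pf_def pf_pos less_irrefl not_less)

lemma lof_pf: "is_partition l \<Longrightarrow> lof (pf l) = l"
  by (simp add: lof_def length_partition) (auto simp: pf_def intro: nth_equalityI)

lemma pfun_least:
  assumes "pfun f" shows "i < (LEAST n. f n = 0) \<longleftrightarrow> 0 < f i"
proof -
  obtain n where "f n = 0" using assms by (auto simp: pfun_def)
  then have L: "f (LEAST n. f n = 0) = 0" by (rule LeastI)
  show ?thesis
  proof
    show "i < (LEAST n. f n = 0) \<Longrightarrow> 0 < f i" using not_less_Least by blast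
    assume "0 < f i"
    show "i < (LEAST n. f n = 0)"
    proof (rule ccontr)
      assume "\<not> i < (LEAST n. f n = 0)"
      then have "f i \<le> f (LEAST n. f n = 0)" using assms by (simp add: pfun_antimono)
      then show False using L \<open>0 < f i\<close> by simp
    qed
  qed
qed

lemma pf_lof: assumes "pfun f" shows "pf (lof f) = f"
proof
  fix i show "pf (lof f) i = f i"
    using pfun_least[OF assms, of i] by (auto simp: pf_def lof_def)
qed

lemma is_partition_lof: assumes "pfun f" shows "is_partition (lof f)"
  unfolding is_partition_def sorted_wrt_iff_nth_less
proof (intro conjI allI impI ballI)
  fix i j assume "i < j" "j < length (lof f)"
  then show "lof f ! j \<le> lof f ! i"
    using pfun_antimono[OF assms, of i j] by (simp add: lof_def)
next
  fix k assume "k \<in> set (lof f)"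
  then obtain i where "i < (LEAST n. f n = 0)" "k = f i" by (auto simp: lof_def)
  then show "0 < k" using pfun_least[OF assms] by simp
qed

lemma cells_eq: "cells l = fcells (pf l)"
  by (auto simp: cells_def fcells_def pf_def split: if_splits)

lemma sum_list_eq_fsize: "sum_list l = fsize (pf l)"
proof -
  have "fsize (pf l) = (\<Sum>i<length l. pf l i)" by (rule fsize_eq_sum) (simp add: pf_def)
  also have "\<dots> = sum_list l" by (simp add: sum_list_sum_nth pf_def atLeast0LessThan)
  finally show ?thesis by simp
qed

lemma bij_betw_pf: "bij_betw pf {l. is_partition l \<and> P (pf l)} {f. pfun f \<and> P f}"
  by (rule bij_betw_byWitness[where f' = lof])
    (auto simp: lof_pf pf_lof pfun_pf is_partition_lof)

lemma pf_Cons: "pf (k # l) = case_nat k (pf l)"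
  by (auto simp: pf_def fun_eq_iff split: nat.split)

lemma pf_tl: "pf (tl l) = pf l \<circ> Suc"
  by (cases l) (auto simp: pf_def fun_eq_iff)

lemma is_partition_tl: "is_partition l \<Longrightarrow> is_partition (tl l)"
  by (cases l) (auto simp: is_partition_def)

lemma finite_tab:
  assumes "pfun f" "finite A" shows "finite {T. tab d R ev A f T}"
proof (rule finite_subset)
  show "{T. tab d R ev A f T} \<subseteq> {T. \<forall>p. (p \<in> fcells f \<longrightarrow> T p \<in> A) \<and> (p \<notin> fcells f \<longrightarrow> T p = d)}"
    by (auto simp: tab_def)
  show "finite {T. \<forall>p. (p \<in> fcells f \<longrightarrow> T p \<in> A) \<and> (p \<notin> fcells f \<longrightarrow> T p = d)}"
    using assms by (intro finite_set_of_finite_funs) auto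
qed

section \<open>Schur, complete and elementary functions, one variable at a time\<close>

abbreviation (input) sstab :: "nat \<Rightarrow> (nat \<Rightarrow> nat) \<Rightarrow> (nat \<times> nat \<Rightarrow> nat) \<Rightarrow> bool" where
  "sstab N f T \<equiv> tab 0 {(a, b). a \<le> b} (\<lambda>_. True) {..<N} f T"

definition schurf :: "(nat \<Rightarrow> nat) \<Rightarrow> sf" where
  "schurf f N x = (\<Sum>T\<in>{T. sstab N f T}. prod_mset (image_mset x (tmult f T)))"

text \<open>Comparisons of neighbours chain to comparisons of all pairs; along a column this uses
  that \<open>l\<close> is a partition, so that the intermediate cells exist.\<close>

lemma ssyt_iff_tab: 
  assumes l: "is_partition l" shows "ssyt N l T \<longleftrightarrow> sstab N (pf l) T"
proof
  assume T: "sstab N (pf l) T"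
  show "ssyt N l T"
    unfolding ssyt_def cells_eq
  proof (intro conjI allI impI ballI)
    fix r c assume "(r, Suc c) \<in> fcells (pf l)"
    then show "T (r, c) \<le> T (r, Suc c)" using tab_row[OF T, of c "Suc c" r] by simp
  next
    fix r c assume "(Suc r, c) \<in> fcells (pf l)"
    then show "T (r, c) < T (Suc r, c)" using tab_col[OF T, of r "Suc r" c] by auto
  qed (use tab_outside[OF T] tab_letter[OF T] in auto)
next
  assume T: "ssyt N l T"
  have row: "T (r, c) \<le> T (r, c')" if "c < c'" "c' < pf l r" for r c c'
    using that
  proof (induction c')
    case (Suc c')
    have "T (r, c') \<le> T (r, Suc c')" using T Suc.prems by (simp add: ssyt_def cells_eq)
    then show ?case using Suc by (cases "c = c'") auto
  qed simp
  have col: "T (r, c) < T (r', c)" if "r < r'" "c < pf l r'" for r r' c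
    using that
  proof (induction r')
    case (Suc r')
    have "T (r', c) < T (Suc r', c)" using T Suc.prems by (simp add: ssyt_def cells_eq)
    moreover have "c < pf l r'" using Suc.prems pfun_antimono[OF pfun_pf[OF l], of r' "Suc r'"] by simp
    ultimately show ?case using Suc by (cases "r = r'") auto
  qed simp
  show "sstab N (pf l) T"
    unfolding tab_def
  proof (intro conjI allI impI ballI)
    fix r r' c assume "r < r'" "c < pf l r'"
    then show "(T (r, c), T (r', c)) \<in> {(a, b). a \<le> b}" "T (r, c) = T (r', c) \<Longrightarrow> \<not> True"
      using col[of r r' c] by auto
  qed (use T row in \<open>auto simp: ssyt_def cells_eq\<close>)
qed

lemma schur_eq_schurf: "is_partition l \<Longrightarrow> schur l = schurf (pf l)"
  by (auto simp: schur_def schurf_def ssyt_iff_tab cells_eq tmult_def fun_eq_iff image_mset.compositionality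
      comp_def prod_unfold_prod_mset)

text \<open>Branching rule: the cells holding the last letter \<open>N\<close> form a horizontal
  strip, and each of them contributes a factor \<open>x N\<close>.\<close>

lemma schurf_Suc:
  assumes f: "pfun f"
  shows "schurf f (Suc N) x = (\<Sum>g | hstrip g f. schurf g N x * x N ^ (fsize f - fsize g))"
proof -
  let ?T = "\<lambda>A f. {T. tab 0 {(a, b). a \<le> b} (\<lambda>_. True) A f T}"
  let ?W = "\<lambda>f T. prod_mset (image_mset x (tmult f T))"
  have "schurf f (Suc N) x = (\<Sum>T\<in>?T (insert N {..<N}) f. ?W f T)"
    by (simp add: schurf_def lessThan_Suc)
  also have "\<dots> = (\<Sum>(g, T)\<in>{(g, T). strip True g f \<and> tab 0 {(a, b). a \<le> b} (\<lambda>_. True) {..<N} g T}.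
      ?W f (tjoin N f g T))"
    by (subst sum.reindex_bij_betw[OF bij_betw_tjoin, symmetric]) (use f in \<open>auto simp: case_prod_unfold\<close>)
  also have "\<dots> = (\<Sum>(g, T)\<in>(SIGMA g:{g. hstrip g f}. ?T {..<N} g). ?W g T * x N ^ (fsize f - fsize g))"
    by (rule sum.cong) (auto simp: strip_def tmult_tjoin[where b = True])
  also have "\<dots> = (\<Sum>g | hstrip g f. \<Sum>T\<in>?T {..<N} g. ?W g T * x N ^ (fsize f - fsize g))"
    by (rule sum.Sigma[symmetric])
      (use finite_strip_below[of True f] in \<open>auto simp: strip_def hstrip_def intro: finite_tab\<close>)
  also have "\<dots> = (\<Sum>g | hstrip g f. schurf g N x * x N ^ (fsize f - fsize g))"
    by (simp add: schurf_def sum_distrib_right)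
  finally show ?thesis .
qed

lemma schurf_zero [simp]: "schurf (\<lambda>_. 0) N x = 1"
proof -
  have "{T. sstab N (\<lambda>_. 0) T} = {\<lambda>_. 0}" by (auto simp: tab_def fcells_def)
  then show ?thesis by (simp add: schurf_def tmult_def fcells_def)
qed

lemma schurf_0: "pfun f \<Longrightarrow> schurf f 0 x = (if f = (\<lambda>_. 0) then 1 else 0)"
proof (cases "f = (\<lambda>_. 0)")
  case False
  then obtain r where "0 < f r" by (metis ext gr0I)
  then have "{T. sstab 0 f T} = {}" by (force simp: tab_def)
  then show ?thesis using False by (simp add: schurf_def)
qed simp

lemma schurf_cong:
  assumes "pfun f" "\<And>i. i < N \<Longrightarrow> x i = y i" shows "schurf f N x = schurf f N y"
  unfolding schurf_def
proof (rule sum.cong[OF refl])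
  fix T assume "T \<in> {T. sstab N f T}"
  then have "image_mset x (tmult f T) = image_mset y (tmult f T)"
    using assms by (intro image_mset_cong) (auto simp: tmult_def tab_def)
  then show "prod_mset (image_mset x (tmult f T)) = prod_mset (image_mset y (tmult f T))" by simp
qed

lemma h_k_Suc: "h_k k (Suc N) x = (\<Sum>j\<le>k. h_k (k - j) N x * x N ^ j)"
proof -
  let ?S = "\<lambda>A k. {M. set_mset M \<subseteq> A \<and> size M = k}"
  have fin: "finite (?S {..<N} k)" for k
    using finite_multisets_of_size[of "{..<N}" k] by (simp add: multisets_of_size_def)
  have "h_k k (Suc N) x = (\<Sum>M\<in>?S (insert N {..<N}) k. prod_mset (image_mset x M))"
    by (simp add: h_k_def lessThan_Suc)
  also have "\<dots> = (\<Sum>(j, M)\<in>(SIGMA j:{..k}. ?S {..<N} (k - j)). prod_mset (image_mset x M) * x N ^ j)"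
    by (subst sum.reindex_bij_betw[OF bij_betw_multisets_of_size_insert[unfolded multisets_of_size_def], symmetric])
      (auto simp: case_prod_unfold atLeast0AtMost)
  also have "\<dots> = (\<Sum>j\<le>k. \<Sum>M\<in>?S {..<N} (k - j). prod_mset (image_mset x M) * x N ^ j)"
    by (rule sum.Sigma[symmetric]) (use fin in auto)
  finally show ?thesis by (simp add: h_k_def sum_distrib_right)
qed

lemma h_k_0: "h_k k 0 x = (if k = 0 then 1 else 0)"
proof -
  have "{M. set_mset M \<subseteq> {..<0::nat} \<and> size M = k} = (if k = 0 then {{#}} else {})" by auto
  then show ?thesis by (simp add: h_k_def)
qed

lemma h_k_cong: "(\<And>i. i < N \<Longrightarrow> x i = y i) \<Longrightarrow> h_k k N x = h_k k N y"
  unfolding h_k_def by (intro sum.cong refl arg_cong[where f = prod_mset] image_mset_cong) auto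

lemma e_k_Suc: "e_k (Suc k) (Suc N) x = e_k (Suc k) N x + e_k k N x * x N"
proof -
  let ?S = "\<lambda>A k. {S. S \<subseteq> A \<and> card S = k}"
  have fin: "finite S" if "S \<subseteq> {..<N}" for S using that finite_subset by blast
  have "?S {..<Suc N} (Suc k) = ?S {..<N} (Suc k) \<union> insert N ` ?S {..<N} k" (is "?L = ?R")
  proof (intro subset_antisym subsetI)
    fix S assume S: "S \<in> ?L"
    show "S \<in> ?R"
    proof (cases "N \<in> S")
      case True
      then have "S = insert N (S - {N})" "S - {N} \<in> ?S {..<N} k"
        using S finite_subset[of S "{..<Suc N}"] by (auto simp: less_Suc_eq)
      then show ?thesis by blast
    qed (use S in \<open>auto simp: less_Suc_eq\<close>)
  next
    fix S assume "S \<in> ?R"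
    then consider "S \<in> ?S {..<N} (Suc k)" | S' where "S = insert N S'" "S' \<in> ?S {..<N} k" by blast
    then show "S \<in> ?L"
    proof cases
      case 1
      then show ?thesis by auto
    next
      case 2
      then have "finite S'" "N \<notin> S'" "card S' = k" "S' \<subseteq> {..<Suc N}" using fin by auto
      then show ?thesis using 2(1) by simp
    qed
  qed
  then have "e_k (Suc k) (Suc N) x = (\<Sum>S\<in>?S {..<N} (Suc k). \<Prod>i\<in>S. x i) + (\<Sum>S\<in>insert N ` ?S {..<N} k. \<Prod>i\<in>S. x i)"
    unfolding e_k_def by simp (rule sum.union_disjoint, auto)
  also have "(\<Sum>S\<in>insert N ` ?S {..<N} k. \<Prod>i\<in>S. x i) = (\<Sum>S\<in>?S {..<N} k. (\<Prod>i\<in>insert N S. x i))"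
    by (subst sum.reindex) (auto simp: inj_on_def)
  also have "\<dots> = (\<Sum>S\<in>?S {..<N} k. (\<Prod>i\<in>S. x i) * x N)"
    by (intro sum.cong refl, subst prod.insert) (use fin in \<open>auto simp: mult.commute\<close>)
  finally show ?thesis by (simp add: e_k_def sum_distrib_right)
qed

lemma e_k_zero [simp]: "e_k 0 N x = 1"
proof -
  have "{S. S \<subseteq> {..<N} \<and> card S = 0} = {{}}" using finite_subset[of _ "{..<N}"] by auto
  then show ?thesis by (simp add: e_k_def)
qed

lemma h_k_zero [simp]: "h_k 0 N x = 1"
  by (induction N) (simp_all add: h_k_0 h_k_Suc)

lemma e_k_0: "e_k k 0 x = (if k = 0 then 1 else 0)"
proof (cases "k = 0")
  case False
  then have "{S. S \<subseteq> {..<0::nat} \<and> card S = k} = {}" by auto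
  then show ?thesis using False by (simp add: e_k_def)
qed simp

lemma e_k_cong: "(\<And>i. i < N \<Longrightarrow> x i = y i) \<Longrightarrow> e_k k N x = e_k k N y"
  unfolding e_k_def by (intro sum.cong prod.cong refl) auto

text \<open>In generating functions E(-t) H(t) = 1: a further variable x multiplies the first series
  by 1 - x t and the second by the inverse of that factor.\<close>

lemma e_h_relation:
  assumes "0 < k" shows "(\<Sum>i\<le>k. (- 1) ^ i * e_k i N x * h_k (k - i) N x) = 0"
proof -
  define E where "E N = Abs_fps (\<lambda>i. (- 1) ^ i * e_k i N x)" for N
  define H where "H N = Abs_fps (\<lambda>i. h_k i N x)" for N
  have E: "E (Suc N) = E N * (1 - fps_const (x N) * fps_X)" for N
  proof (rule fps_ext)
    fix i show "fps_nth (E (Suc N)) i = fps_nth (E N * (1 - fps_const (x N) * fps_X)) i"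
      by (cases i) (simp_all add: E_def algebra_simps e_k_Suc)
  qed
  have H: "H (Suc N) * (1 - fps_const (x N) * fps_X) = H N" for N
  proof (rule fps_ext)
    fix i show "fps_nth (H (Suc N) * (1 - fps_const (x N) * fps_X)) i = fps_nth (H N) i"
    proof (cases i)
      case (Suc k)
      have "h_k (Suc k) (Suc N) x = h_k (Suc k) N x + x N * h_k k (Suc N) x"
        by (simp add: h_k_Suc[of "Suc k"] sum.atMost_Suc_shift del: sum.atMost_Suc)
          (simp add: h_k_Suc sum_distrib_left mult_ac)
      then show ?thesis using Suc by (simp add: H_def algebra_simps)
    qed (simp add: H_def)
  qed
  have "E N * H N = 1"
  proof (induction N)
    case 0 
    have "E 0 = 1" "H 0 = 1" by (auto simp: E_def H_def fps_eq_iff e_k_0 h_k_0)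
    then show ?case by simp
  next
    case (Suc N)
    have "E (Suc N) * H (Suc N) = E N * (H (Suc N) * (1 - fps_const (x N) * fps_X))"
      by (simp add: E mult_ac)
    then show ?case using Suc H by simp
  qed
  then have "fps_nth (E N * H N) k = 0" using assms by simp
  then show ?thesis by (simp add: fps_mult_nth E_def H_def atLeast0AtMost mult.assoc)
qed

section \<open>Pieri rules\<close>

text \<open>Interlacing with a partition forces \<open>g\<close> to be one:
  \<open>g (Suc i) \<le> f (Suc i) \<le> g i\<close>.\<close>

lemma hstripI: "pfun f \<Longrightarrow> (\<And>i. g i \<le> f i) \<Longrightarrow> (\<And>i. f (Suc i) \<le> g i) \<Longrightarrow> hstrip g f"
  unfolding hstrip_def
  by (metis le_zero_eq order_trans pfunI pfun_def)

lemma hstrip_both_below_iff: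
  assumes "pfun \<mu>" "pfun \<nu>"
  shows "hstrip \<rho> \<mu> \<and> hstrip \<rho> \<nu> \<longleftrightarrow>
    (\<forall>j. max (\<mu> (Suc j)) (\<nu> (Suc j)) \<le> \<rho> j \<and> \<rho> j \<le> min (\<mu> j) (\<nu> j))"
proof
  assume "\<forall>j. max (\<mu> (Suc j)) (\<nu> (Suc j)) \<le> \<rho> j \<and> \<rho> j \<le> min (\<mu> j) (\<nu> j)"
  then show "hstrip \<rho> \<mu> \<and> hstrip \<rho> \<nu>" using assms by (auto intro!: hstripI)
qed (auto simp: hstrip_def)

lemma hstrip_both_above_iff:
  assumes "pfun \<mu>" "pfun \<nu>"
  shows "hstrip \<mu> l \<and> hstrip \<nu> l \<longleftrightarrow> max (\<mu> 0) (\<nu> 0) \<le> l 0 \<and>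
    (\<forall>j. max (\<mu> (Suc j)) (\<nu> (Suc j)) \<le> l (Suc j) \<and> l (Suc j) \<le> min (\<mu> j) (\<nu> j))" (is "_ \<longleftrightarrow> ?R")
proof
  assume R: ?R
  have le: "\<mu> i \<le> l i" "\<nu> i \<le> l i" for i using R by (cases i, auto)+
  obtain n where n: "\<mu> n = 0" using assms by (auto simp: pfun_def)
  have "pfun l"
  proof (rule pfunI[of _ "Suc n"])
    fix i have "l (Suc i) \<le> \<mu> i" using R by simp
    then show "l (Suc i) \<le> l i" using le(1)[of i] by simp
  qed (use R n in \<open>metis le_zero_eq min.bounded_iff\<close>)
  then show "hstrip \<mu> l \<and> hstrip \<nu> l" using assms R le by (auto simp: hstrip_def)
qed (auto simp: hstrip_def)

text \<open>For fixed \<open>\<mu>\<close> and \<open>\<nu>\<close> the row lengths \<open>l (Suc j)\<close> of a common extension and \<open>\<rho> j\<close> of a common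
  restriction range over the same interval, which is reflected; \<open>l 0\<close> is free above.\<close>

definition growth_up :: "(nat \<Rightarrow> nat) \<Rightarrow> (nat \<Rightarrow> nat) \<Rightarrow> nat \<Rightarrow> (nat \<Rightarrow> nat) \<Rightarrow> nat \<Rightarrow> nat" where
  "growth_up \<mu> \<nu> i \<rho> = case_nat (max (\<mu> 0) (\<nu> 0) + i)
     (\<lambda>j. min (\<mu> j) (\<nu> j) + max (\<mu> (Suc j)) (\<nu> (Suc j)) - \<rho> j)"

definition growth_down :: "(nat \<Rightarrow> nat) \<Rightarrow> (nat \<Rightarrow> nat) \<Rightarrow> (nat \<Rightarrow> nat) \<Rightarrow> nat \<Rightarrow> nat" where
  "growth_down \<mu> \<nu> l j = min (\<mu> j) (\<nu> j) + max (\<mu> (Suc j)) (\<nu> (Suc j)) - l (Suc j)"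

lemma growth_up:
  assumes "hstrip \<rho> \<mu>" "hstrip \<rho> \<nu>"
  shows "hstrip \<mu> (growth_up \<mu> \<nu> i \<rho>)" "hstrip \<nu> (growth_up \<mu> \<nu> i \<rho>)"
    "growth_down \<mu> \<nu> (growth_up \<mu> \<nu> i \<rho>) = \<rho>"
    "growth_up \<mu> \<nu> i \<rho> 0 - max (\<mu> 0) (\<nu> 0) = i"
proof -
  have p: "pfun \<mu>" "pfun \<nu>" using assms by (auto simp: hstrip_def)
  have b: "max (\<mu> (Suc j)) (\<nu> (Suc j)) \<le> \<rho> j" "\<rho> j \<le> min (\<mu> j) (\<nu> j)" for j
    using hstrip_both_below_iff[OF p] assms by blast+
  have "hstrip \<mu> (growth_up \<mu> \<nu> i \<rho>) \<and> hstrip \<nu> (growth_up \<mu> \<nu> i \<rho>)"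
    unfolding hstrip_both_above_iff[OF p]
  proof (intro conjI allI)
    fix j
    show "max (\<mu> (Suc j)) (\<nu> (Suc j)) \<le> growth_up \<mu> \<nu> i \<rho> (Suc j)"
      "growth_up \<mu> \<nu> i \<rho> (Suc j) \<le> min (\<mu> j) (\<nu> j)"
      using b[of j] by (auto simp only: growth_up_def nat.case)
  qed (simp add: growth_up_def)
  then show "hstrip \<mu> (growth_up \<mu> \<nu> i \<rho>)" "hstrip \<nu> (growth_up \<mu> \<nu> i \<rho>)" by auto
  show "growth_down \<mu> \<nu> (growth_up \<mu> \<nu> i \<rho>) = \<rho>"
  proof
    fix j show "growth_down \<mu> \<nu> (growth_up \<mu> \<nu> i \<rho>) j = \<rho> j"
      using b[of j] by (simp only: growth_up_def growth_down_def nat.case)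
  qed
qed (simp add: growth_up_def)

lemma growth_down:
  assumes "hstrip \<mu> l" "hstrip \<nu> l"
  shows "hstrip (growth_down \<mu> \<nu> l) \<mu>" "hstrip (growth_down \<mu> \<nu> l) \<nu>"
    "growth_up \<mu> \<nu> (l 0 - max (\<mu> 0) (\<nu> 0)) (growth_down \<mu> \<nu> l) = l"
proof -
  have p: "pfun \<mu>" "pfun \<nu>" using assms by (auto simp: hstrip_def)
  have a: "max (\<mu> 0) (\<nu> 0) \<le> l 0" and
    b: "max (\<mu> (Suc j)) (\<nu> (Suc j)) \<le> l (Suc j)" "l (Suc j) \<le> min (\<mu> j) (\<nu> j)" for j
    using hstrip_both_above_iff[OF p] assms by blast+
  have "hstrip (growth_down \<mu> \<nu> l) \<mu> \<and> hstrip (growth_down \<mu> \<nu> l) \<nu>"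
    unfolding hstrip_both_below_iff[OF p]
  proof (intro conjI allI)
    fix j
    show "max (\<mu> (Suc j)) (\<nu> (Suc j)) \<le> growth_down \<mu> \<nu> l j"
      "growth_down \<mu> \<nu> l j \<le> min (\<mu> j) (\<nu> j)"
      using b[of j] by (auto simp only: growth_down_def)
  qed
  then show "hstrip (growth_down \<mu> \<nu> l) \<mu>" "hstrip (growth_down \<mu> \<nu> l) \<nu>" by auto
  show "growth_up \<mu> \<nu> (l 0 - max (\<mu> 0) (\<nu> 0)) (growth_down \<mu> \<nu> l) = l"
  proof
    fix j show "growth_up \<mu> \<nu> (l 0 - max (\<mu> 0) (\<nu> 0)) (growth_down \<mu> \<nu> l) j = l j"
      using a b[of "j - 1"] by (cases j) (simp_all only: growth_up_def growth_down_def nat.case, auto)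
  qed
qed

text \<open>The reflection makes row j + 1 of the larger shape plus row j of \<rho> equal to
  min(\<mu>_j, \<nu>_j) + max(\<mu>_(j+1), \<nu>_(j+1)). Row 0 supplies the missing maximum at index
  0 together with \<open>i\<close>, and minimum plus maximum is \<mu>_j + \<nu>_j.\<close>

lemma fsize_growth_up:
  assumes "hstrip \<rho> \<mu>" "hstrip \<rho> \<nu>"
  shows "fsize (growth_up \<mu> \<nu> i \<rho>) + fsize \<rho> = fsize \<mu> + fsize \<nu> + i"
proof -
  have p: "pfun \<mu>" "pfun \<nu>" using assms by (auto simp: hstrip_def)
  have b: "max (\<mu> (Suc j)) (\<nu> (Suc j)) \<le> \<rho> j" "\<rho> j \<le> min (\<mu> j) (\<nu> j)" for j
    using hstrip_both_below_iff[OF p] assms by blast+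
  obtain m m' where m: "\<And>i. m \<le> i \<Longrightarrow> \<mu> i = 0" "\<And>i. m' \<le> i \<Longrightarrow> \<nu> i = 0"
    using p by (meson pfun_eventually_0)
  define n where "n = max m m'"
  have n: "\<mu> i = 0" "\<nu> i = 0" if "n \<le> i" for i using m that by (auto simp: n_def)
  have n\<rho>: "\<rho> i = 0" if "n \<le> i" for i using b(2)[of i] n[OF that] by simp
  let ?l = "growth_up \<mu> \<nu> i \<rho>"
  have "fsize ?l = (\<Sum>j<Suc n. ?l j)"
    by (rule fsize_eq_sum) (use n in \<open>auto simp: growth_up_def split: nat.split\<close>)
  also have "\<dots> = max (\<mu> 0) (\<nu> 0) + i + (\<Sum>j<n. ?l (Suc j))"
    by (simp add: sum.lessThan_Suc_shift growth_up_def del: sum.lessThan_Suc)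
  finally have 1: "fsize ?l = \<dots>" .
  have 2: "fsize \<rho> = (\<Sum>j<n. \<rho> j)" by (rule fsize_eq_sum) (use n\<rho> in auto)
  have 3: "fsize \<mu> = (\<Sum>j<n. \<mu> j)" "fsize \<nu> = (\<Sum>j<n. \<nu> j)" by (rule fsize_eq_sum; use n in auto)+
  have "(\<Sum>j<n. ?l (Suc j)) + (\<Sum>j<n. \<rho> j) = (\<Sum>j<n. min (\<mu> j) (\<nu> j) + max (\<mu> (Suc j)) (\<nu> (Suc j)))"
    unfolding sum.distrib[symmetric]
  proof (rule sum.cong[OF refl])
    fix j show "?l (Suc j) + \<rho> j = min (\<mu> j) (\<nu> j) + max (\<mu> (Suc j)) (\<nu> (Suc j))"
      using b[of j] by (auto simp only: growth_up_def nat.case)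
  qed
  also have "max (\<mu> 0) (\<nu> 0) + \<dots> = (\<Sum>j<n. min (\<mu> j) (\<nu> j)) + (\<Sum>j<Suc n. max (\<mu> j) (\<nu> j))"
    by (simp add: sum.lessThan_Suc_shift sum.distrib del: sum.lessThan_Suc)
  also have "\<dots> = (\<Sum>j<n. min (\<mu> j) (\<nu> j) + max (\<mu> j) (\<nu> j))"
    using n by (simp add: sum.distrib)
  also have "\<dots> = (\<Sum>j<n. \<mu> j + \<nu> j)" by (rule sum.cong) auto
  also have "\<dots> = fsize \<mu> + fsize \<nu>" by (simp add: 3 sum.distrib)
  finally show ?thesis using 1 2 by simp
qed

lemma hstrip_fsize: "hstrip g f \<Longrightarrow> fsize g \<le> fsize f"
  using strip_fsize[of True] by (simp add: strip_def)

lemma finite_hstrip_below [simp]: "finite {g. hstrip g f}"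
  using finite_strip_below[of True] by (simp add: strip_def)

lemma finite_hstrip_above [simp]: "finite {f. hstrip g f \<and> fsize f = n}"
  using finite_strip_above[of True] by (simp add: strip_def)

lemma finite_vstrip_above [simp]: "finite {f. vstrip g f \<and> fsize f = n}"
  using finite_strip_above[of False] by (simp add: strip_def)

text \<open>Adding a horizontal strip and then removing one, against removing first. The two orders
  differ by \<open>i\<close>, the excess of row 0 of \<open>l\<close> over the rows 0 of \<mu> and
  \<nu>, which accounts for the geometric series in the commutation relation of the two operators.
  The second argument of \<open>F\<close> is the number of cells removed from \<open>l\<close>; it
  becomes the exponent of the last variable.\<close>

lemma hstrip_commutation:
  fixes F :: "(nat \<Rightarrow> nat) \<Rightarrow> nat \<Rightarrow> 'a::comm_monoid_add"
  shows "(\<Sum>l | hstrip \<mu> l \<and> fsize l = fsize \<mu> + k. \<Sum>\<nu> | hstrip \<nu> l. F \<nu> (fsize l - fsize \<nu>)) =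
    (\<Sum>\<rho> | hstrip \<rho> \<mu>. \<Sum>i\<le>k. \<Sum>\<nu> | hstrip \<rho> \<nu> \<and> fsize \<nu> = fsize \<rho> + (k - i). F \<nu> (fsize \<mu> - fsize \<rho> + i))"
proof -
  have "(\<Sum>l | hstrip \<mu> l \<and> fsize l = fsize \<mu> + k. \<Sum>\<nu> | hstrip \<nu> l. F \<nu> (fsize l - fsize \<nu>)) =
     (\<Sum>(l, \<nu>)\<in>(SIGMA l:{l. hstrip \<mu> l \<and> fsize l = fsize \<mu> + k}. {\<nu>. hstrip \<nu> l}). F \<nu> (fsize l - fsize \<nu>))"
    by (rule sum.Sigma) auto
  also have "\<dots> = (\<Sum>(\<rho>, i, \<nu>)\<in>(SIGMA \<rho>:{\<rho>. hstrip \<rho> \<mu>}. SIGMA i:{..k}. {\<nu>. hstrip \<rho> \<nu> \<and> fsize \<nu> = fsize \<rho> + (k - i)}).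
       F \<nu> (fsize \<mu> - fsize \<rho> + i))"
  proof (rule sum.reindex_bij_witness[where i = "\<lambda>(\<rho>, i, \<nu>). (growth_up \<mu> \<nu> i \<rho>, \<nu>)"
        and j = "\<lambda>(l, \<nu>). (growth_down \<mu> \<nu> l, l 0 - max (\<mu> 0) (\<nu> 0), \<nu>)"], goal_cases)
    case (1 a) then show ?case by (auto simp: growth_down)
  next
    case (2 a)
    then obtain l \<nu> where a: "a = (l, \<nu>)" "hstrip \<mu> l" "hstrip \<nu> l" "fsize l = fsize \<mu> + k" by auto
    note d = growth_down[OF a(2,3)]
    show ?case
      using d(1,2) fsize_growth_up[OF d(1,2), of "l 0 - max (\<mu> 0) (\<nu> 0)"] hstrip_fsize[OF d(1)] hstrip_fsize[OF d(2)]
      unfolding d(3) by (auto simp: a)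
  next
    case (3 b) then show ?case using growth_up by auto
  next
    case (4 b)
    then obtain \<rho> i \<nu> where b: "b = (\<rho>, i, \<nu>)" "hstrip \<rho> \<mu>" "hstrip \<rho> \<nu>" "i \<le> k" "fsize \<nu> = fsize \<rho> + (k - i)" by auto
    then show ?case
      using growth_up(1,2)[OF b(2,3), of i] fsize_growth_up[OF b(2,3), of i] by auto
  next
    case (5 a)
    then obtain l \<nu> where a: "a = (l, \<nu>)" "hstrip \<mu> l" "hstrip \<nu> l" "fsize l = fsize \<mu> + k" by auto
    note d = growth_down[OF a(2,3)]
    have "fsize \<mu> - fsize (growth_down \<mu> \<nu> l) + (l 0 - max (\<mu> 0) (\<nu> 0)) = fsize l - fsize \<nu>"
      using fsize_growth_up[OF d(1,2), of "l 0 - max (\<mu> 0) (\<nu> 0)"] hstrip_fsize[OF d(1)] hstrip_fsize[OF d(2)]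
      unfolding d(3) by linarith
    then show ?case by (simp add: a)
  qed
  also have "\<dots> = (\<Sum>\<rho> | hstrip \<rho> \<mu>. \<Sum>(i, \<nu>)\<in>(SIGMA i:{..k}. {\<nu>. hstrip \<rho> \<nu> \<and> fsize \<nu> = fsize \<rho> + (k - i)}).
       F \<nu> (fsize \<mu> - fsize \<rho> + i))"
    by (rule sum.Sigma[symmetric]) auto
  also have "\<dots> = (\<Sum>\<rho> | hstrip \<rho> \<mu>. \<Sum>i\<le>k. \<Sum>\<nu> | hstrip \<rho> \<nu> \<and> fsize \<nu> = fsize \<rho> + (k - i). F \<nu> (fsize \<mu> - fsize \<rho> + i))"
    by (rule sum.cong[OF refl], rule sum.Sigma[symmetric]) auto
  finally show ?thesis .
qed

text \<open>Induction on the number of variables: branching the right side adds a strip and then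
  removes one, \<open>hstrip_commutation\<close> exchanges the order, and the sum over
  \<open>i\<close> becomes the expansion of h_k in powers of the last variable.\<close>

theorem pieri_h:
  "pfun \<mu> \<Longrightarrow> h_k k N x * schurf \<mu> N x = (\<Sum>l | hstrip \<mu> l \<and> fsize l = fsize \<mu> + k. schurf l N x)"
proof (induction N arbitrary: k \<mu>)
  case 0
  have "(\<Sum>l | hstrip \<mu> l \<and> fsize l = fsize \<mu> + k. schurf l 0 x) =
      (\<Sum>l | hstrip \<mu> l \<and> fsize l = fsize \<mu> + k. if l = (\<lambda>_. 0) then 1 else 0)"
    by (rule sum.cong) (auto simp: schurf_0 hstrip_def)
  also have "\<dots> = (if hstrip \<mu> (\<lambda>_. 0) \<and> fsize \<mu> + k = 0 then 1 else 0)"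
    by (subst sum.delta) auto
  also have "hstrip \<mu> (\<lambda>_. 0) \<and> fsize \<mu> + k = 0 \<longleftrightarrow> \<mu> = (\<lambda>_. 0) \<and> k = 0"
    using 0 by (auto simp: hstrip_def fsize_eq_0_iff)
  finally show ?case using 0 by (auto simp: h_k_0 schurf_0)
next
  case (Suc N)
  let ?y = "x N"
  have "(\<Sum>l | hstrip \<mu> l \<and> fsize l = fsize \<mu> + k. schurf l (Suc N) x) =
      (\<Sum>l | hstrip \<mu> l \<and> fsize l = fsize \<mu> + k. \<Sum>\<nu> | hstrip \<nu> l. schurf \<nu> N x * ?y ^ (fsize l - fsize \<nu>))"
    by (rule sum.cong) (auto simp: schurf_Suc hstrip_def)
  also have "\<dots> = (\<Sum>\<rho> | hstrip \<rho> \<mu>. \<Sum>i\<le>k. \<Sum>\<nu> | hstrip \<rho> \<nu> \<and> fsize \<nu> = fsize \<rho> + (k - i).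
      schurf \<nu> N x * ?y ^ (fsize \<mu> - fsize \<rho> + i))"
    by (rule hstrip_commutation)
  also have "\<dots> = (\<Sum>\<rho> | hstrip \<rho> \<mu>. \<Sum>i\<le>k. h_k (k - i) N x * schurf \<rho> N x * ?y ^ (fsize \<mu> - fsize \<rho> + i))"
    by (intro sum.cong refl) (simp add: Suc.IH hstrip_def sum_distrib_right)
  also have "\<dots> = (\<Sum>i\<le>k. h_k (k - i) N x * ?y ^ i) * (\<Sum>\<rho> | hstrip \<rho> \<mu>. schurf \<rho> N x * ?y ^ (fsize \<mu> - fsize \<rho>))"
    by (simp add: sum_product power_add mult_ac) (rule sum.swap)
  also have "\<dots> = h_k k (Suc N) x * schurf \<mu> (Suc N) x"
    using Suc.prems by (simp add: h_k_Suc schurf_Suc)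
  finally show ?case by simp
qed

lemma fsize_upd_Suc:
  assumes "pfun f" shows "fsize (f(m := Suc (f m))) = Suc (fsize f)"
proof -
  have "fcells (f(m := Suc (f m))) = insert (m, f m) (fcells f)"
    by (auto simp: fcells_def split: if_splits)
  then show ?thesis using assms by (simp add: fsize_def)
qed

lemma vstrip_fsize: "vstrip g f \<Longrightarrow> fsize g \<le> fsize f"
  using strip_fsize[of False] by (simp add: strip_def)

text \<open>The intermediate shapes are chosen row by row independently, and the last row where the
  two shapes differ always has exactly two choices.\<close>

lemma alternating_strip_sum:
  assumes p: "pfun \<mu>" "pfun l" and ne: "fsize l \<noteq> fsize \<mu>"
  shows "(\<Sum>\<nu> | vstrip \<mu> \<nu> \<and> hstrip \<nu> l. (- 1) ^ (fsize \<nu> - fsize \<mu>) :: rat) = 0"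
proof (cases "\<forall>i. \<mu> i \<le> l i")
  case False
  then have "{\<nu>. vstrip \<mu> \<nu> \<and> hstrip \<nu> l} = {}" by (auto simp: vstrip_def hstrip_def) (meson order_trans)
  then show ?thesis by (simp only: sum.empty)
next
  case True
  define m where "m = (GREATEST i. \<mu> i < l i)"
  obtain n where n: "\<And>i. n \<le> i \<Longrightarrow> l i = 0" using p pfun_eventually_0 by blast
  have ex: "\<exists>i. \<mu> i < l i" using True ne by (metis ext le_neq_implies_less)
  have bd: "\<And>i. \<mu> i < l i \<Longrightarrow> i \<le> n" using n by (metis less_nat_zero_code nle_le)
  have m: "\<mu> m < l m" unfolding m_def using ex bd by (metis (mono_tags, lifting) GreatestI_nat)
  have "l (Suc m) \<le> \<mu> (Suc m)"
    using bd unfolding m_def by (metis (mono_tags, lifting) Greatest_le_nat Suc_n_not_le_n not_less)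
  \<comment> \<open>Hence row \<open>m\<close> of the intermediate shape may have length \<mu>_m or
    \<mu>_m + 1 without violating the strip condition against row m + 1 of \<open>l\<close>.\<close>
  then have lm: "l (Suc m) \<le> \<mu> m" using pfun_antimono[OF p(1), of m "Suc m"] by simp
  let ?S = "{\<nu>. vstrip \<mu> \<nu> \<and> hstrip \<nu> l}"
  \<comment> \<open>Toggling row \<open>m\<close> between these two lengths changes the size by one,
    so the involution reverses the sign.\<close>
  define t where "t \<nu> = \<nu>(m := if \<nu> m = \<mu> m then Suc (\<mu> m) else \<mu> m)" for \<nu> :: "nat \<Rightarrow> nat"
  have S: "\<nu> m = \<mu> m \<or> \<nu> m = Suc (\<mu> m)" if "\<nu> \<in> ?S" for \<nu>
  proof -
    have "\<mu> m \<le> \<nu> m" "\<nu> m \<le> Suc (\<mu> m)" using that by (auto simp: vstrip_def)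
    then show ?thesis by linarith
  qed
  have tS: "t \<nu> \<in> ?S" if \<nu>: "\<nu> \<in> ?S" for \<nu>
  proof -
    have h: "hstrip (t \<nu>) l"
    proof (rule hstripI[OF p(2)])
      fix i show "t \<nu> i \<le> l i" "l (Suc i) \<le> t \<nu> i"
        using \<nu> m lm by (auto simp: t_def hstrip_def)
    qed
    then show ?thesis using \<nu> p by (auto simp: vstrip_def hstrip_def t_def)
  qed
  have tt: "t (t \<nu>) = \<nu>" if "\<nu> \<in> ?S" for \<nu>
    using S[OF that] by (auto simp: t_def)
  have sign: "(- 1) ^ (fsize (t \<nu>) - fsize \<mu>) = - ((- 1) ^ (fsize \<nu> - fsize \<mu>) :: rat)" if \<nu>: "\<nu> \<in> ?S" for \<nu>
  proof (cases "\<nu> m = \<mu> m")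
    case True
    then have "t \<nu> = \<nu>(m := Suc (\<nu> m))" by (simp add: t_def)
    then have "fsize (t \<nu>) = Suc (fsize \<nu>)" using \<nu> fsize_upd_Suc by (simp add: hstrip_def)
    then show ?thesis using \<nu> vstrip_fsize[of \<mu> \<nu>] by (simp add: Suc_diff_le)
  next
    case False
    then have "\<nu> = (t \<nu>)(m := Suc ((t \<nu>) m))" using S[OF \<nu>] by (auto simp: t_def)
    then have "fsize \<nu> = Suc (fsize (t \<nu>))" using tS[OF \<nu>] fsize_upd_Suc by (metis (no_types, lifting) hstrip_def mem_Collect_eq)
    then show ?thesis using tS[OF \<nu>] vstrip_fsize[of \<mu> "t \<nu>"] by (simp add: Suc_diff_le)
  qed
  have "(\<Sum>\<nu>\<in>?S. (- 1) ^ (fsize \<nu> - fsize \<mu>) :: rat) = (\<Sum>\<nu>\<in>?S. - ((- 1) ^ (fsize \<nu> - fsize \<mu>)))"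
    by (rule sum.reindex_bij_witness[where i = t and j = t]) (use tS tt sign in auto)
  then show ?thesis by (simp add: sum_negf)
qed

text \<open>With a_k either e_k s_\<mu> or the claimed sum \<open>V k\<close>, the alternating sum
  of h_(k-i) a_i over i \<le> k vanishes for k > 0: in the first case by
  \<open>e_h_relation\<close>, in the second by the rule for h and the cancellation in
  \<open>alternating_strip_sum\<close>. Both start with s_\<mu>, and the recursion determines its
  last term.\<close>

theorem pieri_e:
  assumes \<mu>: "pfun \<mu>"
  shows "e_k k N x * schurf \<mu> N x = (\<Sum>l | vstrip \<mu> l \<and> fsize l = fsize \<mu> + k. schurf l N x)"
proof -
  define V where "V k = (\<Sum>l | vstrip \<mu> l \<and> fsize l = fsize \<mu> + k. schurf l N x)" for k
  have "e_k k N x * schurf \<mu> N x = V k"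
  proof (induction k rule: less_induct)
    case (less k)
    show ?case
    proof (cases "k = 0")
      case True
      have "{l. vstrip \<mu> l \<and> fsize l = fsize \<mu>} = {\<mu>}"
        using \<mu> fsize_eq_imp_eq[of _ \<mu>] by (auto simp: vstrip_def) metis
      then show ?thesis using True by (simp add: V_def)
    next
      case False
      let ?P = "{l. pfun l \<and> fsize l = fsize \<mu> + k}"
      have "(\<Sum>i\<le>k. (- 1) ^ i * (h_k (k - i) N x * V i)) =
          (\<Sum>i\<le>k. \<Sum>\<nu> | vstrip \<mu> \<nu> \<and> fsize \<nu> = fsize \<mu> + i. (- 1) ^ i * (h_k (k - i) N x * schurf \<nu> N x))"
        by (simp add: V_def sum_distrib_left)
      also have "\<dots> = (\<Sum>i\<le>k. \<Sum>\<nu> | vstrip \<mu> \<nu> \<and> fsize \<nu> = fsize \<mu> + i.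
          \<Sum>l | hstrip \<nu> l \<and> fsize l = fsize \<mu> + k. (- 1) ^ (fsize \<nu> - fsize \<mu>) * schurf l N x)"
        by (intro sum.cong refl) (auto simp: pieri_h vstrip_def sum_distrib_left)
      also have "\<dots> = (\<Sum>(i, \<nu>)\<in>(SIGMA i:{..k}. {\<nu>. vstrip \<mu> \<nu> \<and> fsize \<nu> = fsize \<mu> + i}).
          \<Sum>l | hstrip \<nu> l \<and> fsize l = fsize \<mu> + k. (- 1) ^ (fsize \<nu> - fsize \<mu>) * schurf l N x)"
        by (rule sum.Sigma) auto
      also have "\<dots> = (\<Sum>((i, \<nu>), l)\<in>(SIGMA (i, \<nu>):(SIGMA i:{..k}. {\<nu>. vstrip \<mu> \<nu> \<and> fsize \<nu> = fsize \<mu> + i}).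
          {l. hstrip \<nu> l \<and> fsize l = fsize \<mu> + k}). (- 1) ^ (fsize \<nu> - fsize \<mu>) * schurf l N x)"
        by (subst sum.Sigma[symmetric]) (auto simp: case_prod_unfold)
      \<comment> \<open>The index \<open>i\<close> is determined by the size of \<nu>, so the sum
        may be regrouped by the outer shape \<open>l\<close>.\<close>
      also have "\<dots> = (\<Sum>(l, \<nu>)\<in>(SIGMA l:?P. {\<nu>. vstrip \<mu> \<nu> \<and> hstrip \<nu> l}). (- 1) ^ (fsize \<nu> - fsize \<mu>) * schurf l N x)"
        by (rule sum.reindex_bij_witness[where i = "\<lambda>(l, \<nu>). ((fsize \<nu> - fsize \<mu>, \<nu>), l)" and j = "\<lambda>((i, \<nu>), l). (l, \<nu>)"])
          (auto simp: hstrip_def dest: vstrip_fsize hstrip_fsize, metis add.commute hstrip_def hstrip_fsize le_diff_conv)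
      also have "\<dots> = (\<Sum>l\<in>?P. \<Sum>\<nu> | vstrip \<mu> \<nu> \<and> hstrip \<nu> l. (- 1) ^ (fsize \<nu> - fsize \<mu>) * schurf l N x)"
        by (rule sum.Sigma[symmetric]) (auto simp: finite_pfun_eq intro: rev_finite_subset[OF finite_hstrip_below])
      also have "\<dots> = (\<Sum>l\<in>?P. (\<Sum>\<nu> | vstrip \<mu> \<nu> \<and> hstrip \<nu> l. (- 1) ^ (fsize \<nu> - fsize \<mu>)) * schurf l N x)"
        by (simp add: sum_distrib_right)
      also have "\<dots> = 0" using False by (intro sum.neutral) (auto simp: alternating_strip_sum \<mu>)
      finally have A: "(\<Sum>i<k. (- 1) ^ i * (h_k (k - i) N x * V i)) + (- 1) ^ k * V k = 0"
        by (simp add: lessThan_Suc_atMost[symmetric])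
      have "0 = (\<Sum>i\<le>k. (- 1) ^ i * e_k i N x * h_k (k - i) N x) * schurf \<mu> N x"
        using e_h_relation[of k N x] False by simp
      also have "\<dots> = (\<Sum>i\<le>k. (- 1) ^ i * (h_k (k - i) N x * (e_k i N x * schurf \<mu> N x)))"
        by (simp add: sum_distrib_right) (simp add: mult_ac)
      also have "\<dots> = (\<Sum>i<k. (- 1) ^ i * (h_k (k - i) N x * (e_k i N x * schurf \<mu> N x))) + (- 1) ^ k * (e_k k N x * schurf \<mu> N x)"
        by (simp add: lessThan_Suc_atMost[symmetric])
      also have "(\<Sum>i<k. (- 1) ^ i * (h_k (k - i) N x * (e_k i N x * schurf \<mu> N x))) = (\<Sum>i<k. (- 1) ^ i * (h_k (k - i) N x * V i))"
        by (rule sum.cong) (use less.IH in auto)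
      finally have "(- 1) ^ k * (e_k k N x * schurf \<mu> N x) = (- 1) ^ k * V k" using A by linarith
      then show ?thesis by simp
    qed
  qed
  then show ?thesis by (simp add: V_def)
qed

section \<open>Linear independence and the inverse Kostka matrix\<close>

definition sf_scale :: "rat \<Rightarrow> sf \<Rightarrow> sf" where
  "sf_scale c f = (\<lambda>N x. c * f N x)"

interpretation sf: vector_space sf_scale
  by unfold_locales (auto simp: sf_scale_def fun_eq_iff algebra_simps)

interpretation sfp: vector_space_pair sf_scale sf_scale ..

abbreviation sf_linear :: "(sf \<Rightarrow> sf) \<Rightarrow> bool" where
  "sf_linear \<equiv> Vector_Spaces.linear sf_scale sf_scale"

lemma sf_sum_apply: "(\<Sum>i\<in>I. F i :: sf) N x = (\<Sum>i\<in>I. F i N x)"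
  by (induction I rule: infinite_finite_induct) auto

lemma sf_prod_apply: "(\<Prod>i\<in>I. F i :: sf) N x = (\<Prod>i\<in>I. F i N x)"
  by (induction I rule: infinite_finite_induct) auto

lemma sf_scale_apply [simp]: "sf_scale c f N x = c * f N x"
  by (simp add: sf_scale_def)

lemma sf_scale_mult: "sf_scale c f * g = sf_scale c (f * g)" "f * sf_scale c g = sf_scale c (f * g)"
  by (auto simp: sf_scale_def fun_eq_iff)

lemma sf_linearI:
  assumes "\<And>f g. L (f + g) = L f + L g" "\<And>c f. L (sf_scale c f) = sf_scale c (L f)"
  shows "sf_linear L"
  by (simp add: Vector_Spaces.linear_def module_hom_def module_hom_axioms_def sf.vector_space_axioms
      sf.module_axioms assms)

lemma sf_linear_mult: "sf_linear (\<lambda>f. g * f)"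
  by (rule sf_linearI) (auto simp: algebra_simps sf_scale_mult)

lemma sf_linear_eq_on_span:
  "sf_linear L \<Longrightarrow> sf_linear M \<Longrightarrow> (\<And>b. b \<in> B \<Longrightarrow> L b = M b) \<Longrightarrow> f \<in> sf.span B \<Longrightarrow> L f = M f"
  using sfp.linear_eq_on by blast

text \<open>Independence of an indexed family, which includes injectivity of \<open>F\<close>;
  independence of the image set alone would not notice repeated members.\<close>

definition indep_family :: "('i \<Rightarrow> sf) \<Rightarrow> 'i set \<Rightarrow> bool" where
  "indep_family F P \<longleftrightarrow> (\<forall>I c. finite I \<longrightarrow> I \<subseteq> P \<longrightarrow> (\<Sum>i\<in>I. sf_scale (c i) (F i)) = 0 \<longrightarrow> (\<forall>i\<in>I. c i = 0))"

lemma indep_familyD: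
  "indep_family F P \<Longrightarrow> finite I \<Longrightarrow> I \<subseteq> P \<Longrightarrow> (\<Sum>i\<in>I. sf_scale (c i) (F i)) = 0 \<Longrightarrow> i \<in> I \<Longrightarrow> c i = 0"
  by (simp add: indep_family_def)

lemma indep_family_iff: "indep_family F P \<longleftrightarrow> inj_on F P \<and> sf.independent (F ` P)"
proof (intro iffI conjI)
  assume F: "indep_family F P"
  show inj: "inj_on F P"
  proof (rule inj_onI, rule ccontr)
    fix i j assume ij: "i \<in> P" "j \<in> P" "F i = F j" "i \<noteq> j"
    define c where "c k = (if k = i then 1 else - 1 :: rat)" for k
    have c: "c i = 1" "c j = - 1" using ij(4) by (auto simp: c_def)
    have "(\<Sum>k\<in>{i, j}. sf_scale (c k) (F k)) = sf_scale (c i) (F i) + sf_scale (c j) (F j)"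
      using ij(4) by simp
    also have "\<dots> = 0" by (simp only: c ij(3) sf.scale_minus_left sf.scale_one add.right_inverse)
    finally have "c i = 0" by (rule indep_familyD[OF F, rotated 2]) (use ij(1,2) in auto)
    then show False using c by simp
  qed
  show "sf.independent (F ` P)"
  proof
    assume "sf.dependent (F ` P)"
    then obtain S u v where S: "finite S" "S \<subseteq> F ` P" "(\<Sum>v\<in>S. sf_scale (u v) v) = 0" "v \<in> S" "u v \<noteq> 0"
      unfolding sf.dependent_explicit by blast
    obtain I where I: "I \<subseteq> P" "finite I" "S = F ` I" using finite_subset_image[OF S(1,2)] by blast
    have "inj_on F I" using inj_on_subset[OF inj I(1)] .
    then have z: "(\<Sum>i\<in>I. sf_scale (u (F i)) (F i)) = 0" using S(3) I(3) by (simp add: sum.reindex)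
    obtain i where i: "i \<in> I" "v = F i" using S(4) I(3) by blast
    then show False using indep_familyD[OF F I(2,1) z i(1)] S(5) by simp
  qed
next
  assume F: "inj_on F P \<and> sf.independent (F ` P)"
  show "indep_family F P"
    unfolding indep_family_def
  proof (intro allI impI ballI)
    fix I c i assume I: "finite I" "I \<subseteq> P" "(\<Sum>i\<in>I. sf_scale (c i) (F i)) = 0" "i \<in> I"
    have inj: "inj_on F I" using inj_on_subset[OF conjunct1[OF F] I(2)] .
    have "(\<Sum>v\<in>F ` I. sf_scale (c (inv_into I F v)) v) =
        (\<Sum>i\<in>I. sf_scale (c (inv_into I F (F i))) (F i))"
      by (rule sum.reindex[OF inj, unfolded comp_def])
    also have "\<dots> = (\<Sum>i\<in>I. sf_scale (c i) (F i))"
      by (rule sum.cong) (simp_all add: inj)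
    finally have z: "(\<Sum>v\<in>F ` I. sf_scale (c (inv_into I F v)) v) = 0" using I(3) by simp
    have ind: "sf.independent (F ` I)" using sf.independent_mono[OF conjunct2[OF F] image_mono[OF I(2)]] .
    have "c (inv_into I F (F i)) = 0"
      using sf.independent_explicit_finite_subsets[THEN iffD1, OF ind, rule_format, OF order_refl _ z, of "F i"] I(1,4)
      by simp
    then show "c i = 0" using inj I(4) by simp
  qed
qed

text \<open>The map is defined on all of \<open>sf\<close>, which contains far more than symmetric
  functions; its values are controlled only on the span of the family.\<close>

lemma indep_family_extend:
  assumes "indep_family F P"
  obtains L where "sf_linear L" "\<And>i. i \<in> P \<Longrightarrow> L (F i) = G i"
proof -
  have F: "inj_on F P" "sf.independent (F ` P)" using assms by (auto simp: indep_family_iff)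
  obtain L where "sf_linear L" "\<forall>v\<in>F ` P. L v = (G \<circ> inv_into P F) v"
    using sfp.linear_independent_extend[OF F(2)] by blast
  then show ?thesis using F(1) by (intro that) auto
qed

text \<open>Extract the top power of the last variable. If \<open>a\<close> > 0 is the largest first
  row that occurs, the coefficient of x_N^a in s_f is the Schur function of \<open>f\<close> without
  its first row when f_0 = a, and 0 otherwise. A relation among the given shapes thus yields one
  among shapes with \<open>a\<close> cells fewer.\<close>

lemma schurf_indep_aux:
  assumes "finite I" "\<And>f. f \<in> I \<Longrightarrow> pfun f \<and> fsize f < n"
    "\<And>N x. (\<Sum>f\<in>I. c f * schurf f N x) = 0" "f \<in> I"
  shows "c f = 0"
  using assms
proof (induction n arbitrary: I c f rule: less_induct)
  case (less n)
  show ?case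
  proof (rule ccontr)
    assume cf: "c f \<noteq> 0"
    define I' where "I' = {f \<in> I. c f \<noteq> 0}"
    have I': "finite I'" "f \<in> I'" using less.prems cf by (auto simp: I'_def)
    have pI': "pfun g" "fsize g < n" if "g \<in> I'" for g using that less.prems by (auto simp: I'_def)
    have sum0: "(\<Sum>f\<in>I'. c f * schurf f N x) = 0" for N x
      using less.prems(1,3) by (subst sum.mono_neutral_left[of I I']) (auto simp: I'_def)
    define a where "a = Max ((\<lambda>f. f 0) ` I')"
    have le_a: "g 0 \<le> a" if "g \<in> I'" for g using that I' by (simp add: a_def)
    obtain f0 where f0: "f0 \<in> I'" "f0 0 = a"
      using Max_in[of "(\<lambda>f. f 0) ` I'"] I' unfolding a_def by fastforce
    show False
    proof (cases "a = 0")
      \<comment> \<open>Only the empty partition is left, and its Schur function is 1.\<close>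
      case True
      have "g = (\<lambda>_. 0)" if "g \<in> I'" for g
      proof
        fix i show "g i = 0" using pfun_antimono[OF pI'(1)[OF that], of 0 i] le_a[OF that] True by simp
      qed
      then have "I' = {\<lambda>_. 0}" using I' by auto
      then show False using sum0[of 0 "\<lambda>_. 0"] by (auto simp: I'_def)
    next
      case False
      define J where "J = {f \<in> I'. f 0 = a}"
      have J: "finite J" "f0 \<in> J" using I' f0 by (auto simp: J_def)
      have pJ: "pfun g" if "g \<in> J" for g using that pI' by (auto simp: J_def)
      have caseJ: "case_nat a (g \<circ> Suc) = g" if "g \<in> J" for g
        using that by (auto simp: J_def fun_eq_iff split: nat.split)
      \<comment> \<open>A horizontal strip has at most one cell in each of the f_0 columns of
        \<open>f\<close>, and it has f_0 cells only if what remains is \<open>f\<close> with its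
        first row deleted.\<close>
      have inner: "(\<Sum>g | hstrip g f. if fsize f - fsize g = a then schurf g N x else 0) =
          (if f 0 = a then schurf (f \<circ> Suc) N x else 0)" if f: "f \<in> I'" for f N x
      proof -
        have *: "fsize f - fsize g = a \<longleftrightarrow> f 0 = a \<and> g = f \<circ> Suc" if g: "hstrip g f" for g
        proof -
          have le: "(f \<circ> Suc) i \<le> g i" for i using g by (simp add: hstrip_def)
          have pg: "pfun g" using g by (simp add: hstrip_def)
          have "fsize (f \<circ> Suc) \<le> fsize g" using fsize_diff(2)[OF pg, of "f \<circ> Suc"] le by blast
          moreover have "fsize (f \<circ> Suc) = fsize g \<longleftrightarrow> g = f \<circ> Suc"
            using fsize_eq_imp_eq[OF pg, of "f \<circ> Suc"] le by auto
          ultimately show ?thesis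
            using fsize_shift[OF pI'(1)[OF f]] hstrip_fsize[OF g] le_a[OF f] False by linarith
        qed
        have "hstrip (f \<circ> Suc) f"
          using pI'(1)[OF f] by (auto simp: hstrip_def pfun_shift intro: pfun_antimono)
        then have "(if f 0 = a then schurf (f \<circ> Suc) N x else 0) =
            (\<Sum>g | hstrip g f. if g = f \<circ> Suc then (if f 0 = a then schurf g N x else 0) else 0)"
          by (subst sum.delta) auto
        also have "\<dots> = (\<Sum>g | hstrip g f. if fsize f - fsize g = a then schurf g N x else 0)"
          by (rule sum.cong) (auto simp: *)
        finally show ?thesis by simp
      qed
      have top: "(\<Sum>f\<in>J. c f * schurf (f \<circ> Suc) N x) = 0" for N x
      proof -
        \<comment> \<open>The relation read as a polynomial in the last variable; it vanishes at
          every rational value and is therefore zero.\<close>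
        define p where "p = (\<Sum>f\<in>I'. smult (c f) (\<Sum>g | hstrip g f. monom (schurf g N x) (fsize f - fsize g)))"
        have "poly p t = 0" for t
        proof -
          let ?y = "x(N := t)"
          have "schurf g N ?y = schurf g N x" if "pfun g" for g using that by (intro schurf_cong) auto
          then have "poly p t = (\<Sum>f\<in>I'. c f * schurf f (Suc N) ?y)"
            unfolding p_def poly_sum poly_smult poly_monom
            using pI'(1) by (intro sum.cong refl) (simp add: schurf_Suc hstrip_def)
          then show ?thesis using sum0 by simp
        qed
        then have "p = 0" using poly_all_0_iff_0 by blast
        then have "0 = coeff p a" by simp
        also have "\<dots> = (\<Sum>f\<in>I'. c f * (\<Sum>g | hstrip g f. if fsize f - fsize g = a then schurf g N x else 0))"
          unfolding p_def coeff_sum coeff_smult by (simp add: coeff_sum)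
        also have "\<dots> = (\<Sum>f\<in>I'. c f * (if f 0 = a then schurf (f \<circ> Suc) N x else 0))"
          by (intro sum.cong refl) (simp add: inner)
        also have "\<dots> = (\<Sum>f\<in>I'. if f 0 = a then c f * schurf (f \<circ> Suc) N x else 0)"
          by (intro sum.cong refl) simp
        also have "\<dots> = (\<Sum>f\<in>J. c f * schurf (f \<circ> Suc) N x)"
          using I' by (simp add: J_def sum.inter_filter)
        finally show ?thesis by simp
      qed
      have injJ: "inj_on (\<lambda>f. f \<circ> Suc) J" by (rule inj_onI) (metis caseJ)
      \<comment> \<open>All shapes in \<open>J\<close> have first row \<open>a\<close>, so
        prepending \<open>a\<close> inverts the deletion of that row.\<close>
      define c' where "c' g = c (case_nat a g)" for g
      have "c' (f0 \<circ> Suc) = 0"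
      proof (rule less.IH[of "n - a" "(\<lambda>f. f \<circ> Suc) ` J" c'])
        show "n - a < n" using False pI'(2)[OF f0(1)] by simp
        fix g assume "g \<in> (\<lambda>f. f \<circ> Suc) ` J"
        then obtain f where f: "f \<in> J" "g = f \<circ> Suc" by blast
        then have "fsize f < n" "f 0 = a" using pI' by (auto simp: J_def)
        then show "pfun g \<and> fsize g < n - a"
          using f pJ[OF f(1)] fsize_shift[OF pJ[OF f(1)]] by (auto simp: pfun_shift)
      next
        fix N x
        show "(\<Sum>g\<in>(\<lambda>f. f \<circ> Suc) ` J. c' g * schurf g N x) = 0"
          using top[of N x] caseJ by (simp add: sum.reindex[OF injJ] c'_def)
      next
        show "f0 \<circ> Suc \<in> (\<lambda>f. f \<circ> Suc) ` J" using J(2) by (rule imageI)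
      qed (use J(1) in simp)
      then show False using caseJ[OF J(2)] f0 by (simp add: c'_def I'_def)
    qed
  qed
qed

theorem schurf_indep: "indep_family schurf {f. pfun f}"
  unfolding indep_family_def
proof (intro allI impI ballI)
  fix I c f assume I: "finite I" "I \<subseteq> {f. pfun f}" "(\<Sum>f\<in>I. sf_scale (c f) (schurf f)) = 0" "f \<in> I"
  have "(\<Sum>f\<in>I. c f * schurf f N x) = 0" for N x
    using fun_cong[OF fun_cong[OF I(3), of N], of x] by (simp add: sf_sum_apply)
  moreover have "fsize g < Suc (Max (fsize ` I))" if "g \<in> I" for g
    using that I(1) by (simp add: less_Suc_eq_le)
  ultimately show "c f = 0" using schurf_indep_aux[of I "Suc (Max (fsize ` I))" c f] I by blast
qed

section \<open>Schur functions in terms of products of complete functions\<close>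

lemma h_part_mset: "h_part l N x = prod_mset (image_mset (\<lambda>k. h_k k N x) (mset l))"
  by (simp add: h_part_def flip: mset_map prod_mset_prod_list)

lemma h_part_Cons: "h_part (k # l) = h_k k * h_part l"
  by (simp add: h_part_def fun_eq_iff)

lemma h_k_zero_fun: "h_k 0 = 1"
  by (simp add: fun_eq_iff)

lemma partition_insert:
  assumes "is_partition \<gamma>" "0 < k"
  obtains \<gamma>' where "is_partition \<gamma>'" "sum_list \<gamma>' = k + sum_list \<gamma>" "k \<le> pf \<gamma>' 0"
    "h_part \<gamma>' = h_k k * h_part \<gamma>"
proof -
  define \<gamma>' where "\<gamma>' = rev (sort (k # \<gamma>))"
  have m: "mset \<gamma>' = mset (k # \<gamma>)" by (simp add: \<gamma>'_def)
  have s: "sorted_wrt (\<ge>) \<gamma>'" by (simp add: \<gamma>'_def sorted_wrt_rev del: sort_key_simps)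
  have set: "set \<gamma>' = insert k (set \<gamma>)" using m by (metis list.simps(15) set_mset_mset)
  have p: "is_partition \<gamma>'" using s set assms by (auto simp: is_partition_def)
  obtain i where i: "i < length \<gamma>'" "\<gamma>' ! i = k" using set by (metis in_set_conv_nth insertI1)
  have "k \<le> pf \<gamma>' 0" using pfun_antimono[OF pfun_pf[OF p], of 0 i] i by (simp add: pf_def)
  moreover have "sum_list \<gamma>' = k + sum_list \<gamma>" using m by (metis sum_list.Cons sum_mset_sum_list)
  moreover have "h_part \<gamma>' = h_k k * h_part \<gamma>"
    using m by (simp add: h_part_Cons[symmetric] fun_eq_iff h_part_mset)
  ultimately show ?thesis using p that by blast
qed

text \<open>Triangularity in dominance order is kept only in its consequence for the first part:
  s_\<alpha> involves only h_\<gamma> with \<gamma>_1 >= \<alpha>_1. This is what restricts the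
  inverse Kostka sum in \<open>stilde\<close> to |\<mu>| \<le> |\<lambda>|.\<close>

definition h_above :: "nat \<Rightarrow> nat \<Rightarrow> nat list set" where
  "h_above n a = {\<gamma>. is_partition \<gamma> \<and> sum_list \<gamma> = n \<and> a \<le> pf \<gamma> 0}"

lemma pieri_h_sf:
  "pfun \<mu> \<Longrightarrow> h_k k * schurf \<mu> = (\<Sum>l | hstrip \<mu> l \<and> fsize l = fsize \<mu> + k. schurf l)"
  by (simp add: fun_eq_iff sf_sum_apply pieri_h)

text \<open>Multiply the Schur function of \<open>f\<close> without its first row by h_(f_0). The
  Pieri rule gives s_f and Schur functions of shapes of the same size with a longer first row, hence
  with fewer cells outside it. Induction on the size plus the number of cells outside the first row
  lets one solve for s_f.\<close>

theorem schurf_in_span_h: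
  "pfun f \<Longrightarrow> schurf f \<in> sf.span (h_part ` h_above (fsize f) (f 0))"
proof (induction "fsize f + fsize (f \<circ> Suc)" arbitrary: f rule: less_induct)
  case less
  note f = less.prems
  show ?case
  proof (cases "f 0 = 0")
    case True
    then have f0: "f = (\<lambda>_. 0)"
      using pfun_antimono[OF f, of 0] by (intro ext) (metis le_zero_eq le0)
    have "schurf f = h_part []" by (simp add: f0 fun_eq_iff h_part_def)
    moreover have "[] \<in> h_above (fsize f) (f 0)" by (simp add: h_above_def f0 is_partition_def)
    ultimately show ?thesis by (metis imageI sf.span_base)
  next
    case False
    let ?g = "f \<circ> Suc"
    let ?S = "sf.span (h_part ` h_above (fsize f) (f 0))"
    let ?L = "{l. hstrip ?g l \<and> fsize l = fsize ?g + f 0}"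
    have g: "pfun ?g" using f by (rule pfun_shift)
    have size: "fsize f = f 0 + fsize ?g" using f by (rule fsize_shift)
    have "schurf ?g \<in> sf.span (h_part ` h_above (fsize ?g) (?g 0))"
      by (rule less.hyps[OF _ g]) (use size False fsize_shift[OF g] in auto)
    then have "h_k (f 0) * schurf ?g \<in> (\<lambda>v. h_k (f 0) * v) ` sf.span (h_part ` h_above (fsize ?g) (?g 0))"
      by blast
    also have "\<dots> = sf.span ((\<lambda>v. h_k (f 0) * v) ` h_part ` h_above (fsize ?g) (?g 0))"
      using sfp.linear_span_image[OF sf_linear_mult] by metis
    also have "\<dots> \<subseteq> ?S"
    proof (rule sf.span_mono, rule subsetI)
      fix v assume "v \<in> (\<lambda>v. h_k (f 0) * v) ` h_part ` h_above (fsize ?g) (?g 0)"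
      then obtain \<gamma> where \<gamma>: "is_partition \<gamma>" "sum_list \<gamma> = fsize ?g" "v = h_k (f 0) * h_part \<gamma>"
        by (auto simp: h_above_def)
      obtain \<gamma>' where "is_partition \<gamma>'" "sum_list \<gamma>' = f 0 + sum_list \<gamma>" "f 0 \<le> pf \<gamma>' 0"
        "h_part \<gamma>' = h_k (f 0) * h_part \<gamma>"
        using partition_insert[OF \<gamma>(1), of "f 0"] False by auto
      then show "v \<in> h_part ` h_above (fsize f) (f 0)"
        using \<gamma> size by (intro image_eqI[of _ _ \<gamma>']) (auto simp: h_above_def)
    qed
    finally have prod: "h_k (f 0) * schurf ?g \<in> ?S" .
    have fL: "f \<in> ?L" using f g size by (auto simp: hstrip_def intro: pfun_antimono)
    have others: "schurf l \<in> ?S" if l: "l \<in> ?L - {f}" for l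
    proof -
      have pl: "pfun l" and lg: "l (Suc i) \<le> f (Suc i)" for i using l by (auto simp: hstrip_def)
      have sl: "fsize l = l 0 + fsize (l \<circ> Suc)" using pl by (rule fsize_shift)
      have le: "fsize (l \<circ> Suc) \<le> fsize ?g" using fsize_diff(2)[OF g, of "l \<circ> Suc"] lg by simp
      moreover have "fsize (l \<circ> Suc) \<noteq> fsize ?g"
      proof
        assume eq: "fsize (l \<circ> Suc) = fsize ?g"
        then have "l \<circ> Suc = ?g" using fsize_eq_imp_eq[OF g, of "l \<circ> Suc"] lg by simp
        moreover have "l 0 = f 0" using eq sl l by simp
        ultimately have "l i = f i" for i by (cases i) (auto simp: fun_eq_iff)
        then show False using l by auto
      qed
      ultimately have "schurf l \<in> sf.span (h_part ` h_above (fsize l) (l 0))"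
        using l size by (intro less.hyps[OF _ pl]) auto
      moreover have "h_above (fsize l) (l 0) \<subseteq> h_above (fsize f) (f 0)"
        using le l sl size by (auto simp: h_above_def)
      ultimately show ?thesis by (meson image_mono sf.span_mono subsetD)
    qed
    have "schurf f = h_k (f 0) * schurf ?g - (\<Sum>l\<in>?L - {f}. schurf l)"
      using fL unfolding pieri_h_sf[OF g] by (subst sum.remove[of ?L f]) auto
    also have "\<dots> \<in> ?S" by (intro sf.span_diff sf.span_sum prod others)
    finally show ?thesis .
  qed
qed

lemma bij_betw_pf_le: "bij_betw pf {\<gamma>. is_partition \<gamma> \<and> sum_list \<gamma> \<le> n} {f. pfun f \<and> fsize f \<le> n}"
  using bij_betw_pf[of "\<lambda>f. fsize f \<le> n"] by (simp add: sum_list_eq_fsize)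

lemma finite_partitions_le: "finite {\<gamma>. is_partition \<gamma> \<and> sum_list \<gamma> \<le> n}"
  using bij_betw_finite[OF bij_betw_pf_le] finite_pfun_le by blast

lemma finite_partitions_of: "finite (partitions_of n)"
  by (rule finite_subset[OF _ finite_partitions_le[of n]]) (auto simp: partitions_of_def)

text \<open>Schur functions of degree at most \<open>n\<close> are independent, lie in the span of the
  products of complete functions, and there are equally many of both.\<close>

lemma h_indep_le:
  "inj_on h_part {\<gamma>. is_partition \<gamma> \<and> sum_list \<gamma> \<le> n} \<and>
   sf.independent (h_part ` {\<gamma>. is_partition \<gamma> \<and> sum_list \<gamma> \<le> n})"
proof -
  let ?P = "{\<gamma>. is_partition \<gamma> \<and> sum_list \<gamma> \<le> n}"
  let ?F = "{f. pfun f \<and> fsize f \<le> n}"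
  have s: "inj_on schurf ?F" "sf.independent (schurf ` ?F)"
    using schurf_indep inj_on_subset[of schurf "{f. pfun f}" ?F]
      sf.independent_mono[of "schurf ` {f. pfun f}" "schurf ` ?F"]
    unfolding indep_family_iff by auto
  have sub: "schurf ` ?F \<subseteq> sf.span (h_part ` ?P)"
  proof
    fix v assume "v \<in> schurf ` ?F"
    then obtain f where f: "pfun f" "fsize f \<le> n" "v = schurf f" by auto
    have "h_above (fsize f) (f 0) \<subseteq> ?P" using f by (auto simp: h_above_def)
    then show "v \<in> sf.span (h_part ` ?P)"
      using schurf_in_span_h[OF f(1)] f(3) by (meson image_mono sf.span_mono subsetD)
  qed
  have card: "card (schurf ` ?F) = card ?P"
    using card_image[OF s(1)] bij_betw_same_card[OF bij_betw_pf_le] by simp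
  have "card ?P \<le> card (h_part ` ?P)"
    using sf.independent_span_bound[OF _ s(2) sub] finite_partitions_le card by simp
  then have inj: "inj_on h_part ?P"
    using finite_partitions_le by (meson card_image_le eq_card_imp_inj_on le_antisym)
  moreover have "sf.independent (h_part ` ?P)"
  proof
    assume "sf.dependent (h_part ` ?P)"
    then obtain a where a: "a \<in> h_part ` ?P" "a \<in> sf.span (h_part ` ?P - {a})"
      by (auto simp: sf.dependent_def)
    have "sf.span (h_part ` ?P) = sf.span (h_part ` ?P - {a})"
      using sf.span_redundant[OF a(2)] a(1) by (simp add: insert_absorb)
    then have "card ?P \<le> card (h_part ` ?P - {a})"
      using sf.independent_span_bound[OF _ s(2), of "h_part ` ?P - {a}"] sub finite_partitions_le card by simp
    moreover have "card (h_part ` ?P - {a}) < card (h_part ` ?P)"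
      using a(1) finite_partitions_le by (intro card_Diff1_less) auto
    ultimately show False using card_image[OF inj] by simp
  qed
  ultimately show ?thesis by blast
qed

theorem h_part_indep: "indep_family h_part {\<gamma>. is_partition \<gamma>}"
  unfolding indep_family_def
proof (intro allI impI ballI)
  fix I c \<gamma> assume I: "finite I" "I \<subseteq> {\<gamma>. is_partition \<gamma>}" "(\<Sum>\<gamma>\<in>I. sf_scale (c \<gamma>) (h_part \<gamma>)) = 0" "\<gamma> \<in> I"
  let ?n = "Max (sum_list ` I)"
  have "I \<subseteq> {\<gamma>. is_partition \<gamma> \<and> sum_list \<gamma> \<le> ?n}" using I by auto
  moreover have "indep_family h_part {\<gamma>. is_partition \<gamma> \<and> sum_list \<gamma> \<le> ?n}"
    using h_indep_le unfolding indep_family_iff by blast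
  ultimately show "c \<gamma> = 0" using indep_familyD I(1,3,4) by metis
qed

text \<open>Discharges the description operator: existence comes from
  \<open>schurf_in_span_h\<close>, uniqueness from \<open>h_part_indep\<close>. The last conclusion
  holds because the coefficients found are supported on \<open>h_above\<close>.\<close>

lemma kostka_inv:
  assumes \<alpha>: "is_partition \<alpha>"
  shows "\<gamma> \<notin> partitions_of (sum_list \<alpha>) \<Longrightarrow> kostka_inv \<alpha> \<gamma> = 0"
    and "schur \<alpha> = (\<Sum>\<gamma>\<in>partitions_of (sum_list \<alpha>). sf_scale (kostka_inv \<alpha> \<gamma>) (h_part \<gamma>))"
    and "kostka_inv \<alpha> \<gamma> \<noteq> 0 \<Longrightarrow> pf \<alpha> 0 \<le> pf \<gamma> 0"
proof -
  let ?P = "partitions_of (sum_list \<alpha>)"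
  let ?spec = "\<lambda>c. (\<forall>\<gamma>. \<gamma> \<notin> ?P \<longrightarrow> c \<gamma> = 0) \<and> (\<forall>N x. schur \<alpha> N x = (\<Sum>\<gamma>\<in>?P. c \<gamma> * h_part \<gamma> N x))"
  let ?H = "h_above (sum_list \<alpha>) (pf \<alpha> 0)"
  have sub: "?H \<subseteq> ?P" by (auto simp: h_above_def partitions_of_def)
  have fin: "finite ?H" using sub finite_partitions_of finite_subset by blast
  have "indep_family h_part {\<gamma>. is_partition \<gamma>}" by (rule h_part_indep)
  then have inj: "inj_on h_part ?H"
    unfolding indep_family_iff by (auto simp: h_above_def elim: inj_on_subset)
  have "schur \<alpha> \<in> sf.span (h_part ` ?H)"
    using schurf_in_span_h[OF pfun_pf[OF \<alpha>]] by (simp add: schur_eq_schurf[OF \<alpha>] sum_list_eq_fsize)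
  then obtain u where u: "schur \<alpha> = (\<Sum>v\<in>h_part ` ?H. sf_scale (u v) v)"
    using fin by (auto simp: sf.span_finite)
  define c where "c \<gamma> = (if \<gamma> \<in> ?H then u (h_part \<gamma>) else 0)" for \<gamma>
  have "schur \<alpha> N x = (\<Sum>\<gamma>\<in>?P. c \<gamma> * h_part \<gamma> N x)" for N x
  proof -
    have "schur \<alpha> N x = (\<Sum>\<gamma>\<in>?H. c \<gamma> * h_part \<gamma> N x)"
      unfolding u by (simp add: sum.reindex[OF inj] sf_sum_apply c_def)
    also have "\<dots> = (\<Sum>\<gamma>\<in>?P. c \<gamma> * h_part \<gamma> N x)"
      by (rule sum.mono_neutral_left) (use sub finite_partitions_of in \<open>auto simp: c_def\<close>)
    finally show ?thesis .
  qed
  then have c: "?spec c" using sub by (auto simp: c_def)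
  have uniq: "c' = c" if c': "?spec c'" for c'
  proof
    fix \<gamma> show "c' \<gamma> = c \<gamma>"
    proof (cases "\<gamma> \<in> ?P")
      case True
      have "(\<Sum>\<gamma>\<in>?P. sf_scale (c' \<gamma> - c \<gamma>) (h_part \<gamma>)) = 0"
      proof (intro ext)
        fix N x
        have "(\<Sum>\<gamma>\<in>?P. c' \<gamma> * h_part \<gamma> N x) = (\<Sum>\<gamma>\<in>?P. c \<gamma> * h_part \<gamma> N x)" using c c' by metis
        then show "(\<Sum>\<gamma>\<in>?P. sf_scale (c' \<gamma> - c \<gamma>) (h_part \<gamma>)) N x = 0 N x"
          by (simp add: sf_sum_apply left_diff_distrib sum_subtractf)
      qed
      then have "c' \<gamma> - c \<gamma> = 0"
        using h_part_indep finite_partitions_of True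
        by (intro indep_familyD[of h_part "{\<gamma>. is_partition \<gamma>}" ?P "\<lambda>\<gamma>. c' \<gamma> - c \<gamma>"])
          (auto simp: partitions_of_def)
      then show ?thesis by simp
    qed (use c c' in auto)
  qed
  have K: "kostka_inv \<alpha> = c" unfolding kostka_inv_def by (rule the_equality) (fact c, fact uniq)
  show "\<gamma> \<notin> ?P \<Longrightarrow> kostka_inv \<alpha> \<gamma> = 0" using c K by simp
  show "schur \<alpha> = (\<Sum>\<gamma>\<in>?P. sf_scale (kostka_inv \<alpha> \<gamma>) (h_part \<gamma>))"
    using c by (auto simp: fun_eq_iff sf_sum_apply K)
  show "kostka_inv \<alpha> \<gamma> \<noteq> 0 \<Longrightarrow> pf \<alpha> 0 \<le> pf \<gamma> 0"
    by (auto simp: K c_def h_above_def split: if_splits)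
qed

section \<open>The bases htilde and stilde\<close>

definition mult_shape :: "'a multiset \<Rightarrow> nat multiset" where
  "mult_shape M = image_mset (count M) (mset_set (set_mset M))"

lemma mtilde_eq: "mtilde \<pi> = rev (sorted_list_of_multiset (mult_shape \<pi>))"
  by (simp add: mtilde_def mult_shape_def)

lemma mset_mtilde: "mset (mtilde \<pi>) = mult_shape \<pi>"
  by (simp add: mtilde_eq)

lemma is_partition_mtilde: "is_partition (mtilde \<pi>)"
proof -
  have "sorted_wrt (\<ge>) (mtilde \<pi>)" by (simp add: mtilde_eq sorted_wrt_rev)
  moreover have "set (mtilde \<pi>) = count \<pi> ` set_mset \<pi>"
    by (simp add: mtilde_eq mult_shape_def)
  ultimately show ?thesis by (auto simp: is_partition_def)
qed

lemma sum_list_mtilde: "sum_list (mtilde \<pi>) = size \<pi>"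
proof -
  have "sum_list (mtilde \<pi>) = sum_mset (mult_shape \<pi>)" by (metis mset_mtilde sum_mset_sum_list)
  also have "\<dots> = size \<pi>" by (simp add: mult_shape_def size_multiset_overloaded_eq sum_unfold_sum_mset)
  finally show ?thesis .
qed

lemma size_le_size_sum_mset: "{#} \<notin># \<pi> \<Longrightarrow> size \<pi> \<le> size (sum_mset \<pi>)"
proof (induction \<pi>)
  case (add B \<pi>)
  then have "0 < size B" by (auto simp: nonempty_has_size)
  then show ?case using add by simp
qed simp

lemma size_eq_size_sum_mset:
  "{#} \<notin># \<pi> \<Longrightarrow> size \<pi> = size (sum_mset \<pi>) \<Longrightarrow> \<pi> = image_mset (\<lambda>i. {#i#}) (sum_mset \<pi>)"
proof (induction \<pi>)
  case (add B \<pi>)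
  then have B: "0 < size B" and p: "{#} \<notin># \<pi>" by (auto simp: nonempty_has_size)
  have "size B = 1" "size \<pi> = size (sum_mset \<pi>)"
    using add.prems(2) B size_le_size_sum_mset[OF p] by auto
  moreover from this obtain b where "B = {#b#}" using size_1_singleton_mset by auto
  ultimately show ?case using add.IH p by simp
qed simp

lemma finite_subset_msets: "finite {B. B \<subseteq># (S :: 'a multiset)}"
proof (rule finite_subset)
  show "{B. B \<subseteq># S} \<subseteq> (\<Union>n\<le>size S. multisets_of_size (set_mset S) n)"
    by (auto simp: multisets_of_size_def size_mset_mono dest: mset_subset_eqD)
qed auto

lemma finite_mset_partitions: "finite (mset_partitions S)"
proof (rule finite_subset)
  show "mset_partitions S \<subseteq> (\<Union>n\<le>size S. multisets_of_size {B. B \<subseteq># S} n)"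
    using size_le_size_sum_mset
    by (auto simp: mset_partitions_def multisets_of_size_def dest!: multi_member_split)
  show "finite (\<Union>n\<le>size S. multisets_of_size {B. B \<subseteq># S} n)"
    using finite_subset_msets by auto
qed

lemma count_part_content:
  "count (part_content l) j = (if 1 \<le> j \<and> j \<le> length l then l ! (j - 1) else 0)"
proof -
  have "count (part_content l) j = (\<Sum>i<length l. if Suc i = j then l ! i else 0)"
    unfolding part_content_def count_sum by (rule sum.cong) auto
  also have "\<dots> = (\<Sum>i<length l. if i = j - 1 then (if 1 \<le> j then l ! i else 0) else 0)"
    by (rule sum.cong) auto
  finally show ?thesis by auto
qed

lemma set_part_content: "is_partition l \<Longrightarrow> set_mset (part_content l) = Suc ` {..<length l}"
proof -
  assume l: "is_partition l"
  have "j \<in># part_content l \<longleftrightarrow> j \<in> Suc ` {..<length l}" for j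
  proof -
    have "j \<in># part_content l \<longleftrightarrow> 0 < count (part_content l) j" by simp
    also have "\<dots> \<longleftrightarrow> 1 \<le> j \<and> j \<le> length l"
      using l by (auto simp: count_part_content is_partition_def)
    also have "\<dots> \<longleftrightarrow> j \<in> Suc ` {..<length l}" by (cases j) auto
    finally show ?thesis .
  qed
  then show ?thesis by blast
qed

lemma size_part_content: "size (part_content l) = sum_list l"
proof -
  have "size (\<Sum>i\<in>I. f i) = (\<Sum>i\<in>I. size (f i))" if "finite I" for I and f :: "nat \<Rightarrow> nat multiset"
    using that by induction auto
  then show ?thesis by (simp add: part_content_def sum_list_sum_nth atLeast0LessThan)
qed

lemma mult_shape_part_content:
  assumes "is_partition l" shows "mult_shape (part_content l) = mset l"
proof -
  have "mult_shape (part_content l) = image_mset (count (part_content l)) (image_mset Suc (mset_set {..<length l}))"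
    by (simp add: mult_shape_def set_part_content[OF assms] image_mset_mset_set)
  also have "\<dots> = image_mset ((!) l) (mset_set {..<length l})"
    by (simp add: image_mset.compositionality comp_def) (rule image_mset_cong, auto simp: count_part_content)
  also have "\<dots> = mset (map ((!) l) [0..<length l])" by (simp add: mset_upt atLeast0LessThan)
  finally show ?thesis by (simp add: map_nth)
qed

lemma rev_sort_partition: "is_partition l \<Longrightarrow> rev (sort l) = l"
proof -
  assume "is_partition l"
  then have "sorted (rev l)" by (simp add: is_partition_def sorted_wrt_rev)
  then have "sort l = rev l" by (metis mset_rev properties_for_sort)
  then show ?thesis by simp
qed

lemma mult_shape_image:
  assumes "inj_on f (set_mset M)"
  shows "mult_shape (image_mset f M) = mult_shape M"
proof -
  have "mult_shape (image_mset f M) = image_mset (count (image_mset f M)) (image_mset f (mset_set (set_mset M)))"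
    using assms by (simp add: mult_shape_def image_mset_mset_set)
  also have "\<dots> = mult_shape M"
    unfolding mult_shape_def image_mset.compositionality
  proof (rule image_mset_cong)
    fix i assume "i \<in># mset_set (set_mset M)"
    then have i: "i \<in># M" by simp
    have "f -` {f i} \<inter> set_mset M = {i}" using assms i by (auto simp: inj_on_def)
    then show "(count (image_mset f M) \<circ> f) i = count M i" by (simp add: count_image_mset)
  qed
  finally show ?thesis .
qed

lemma mtilde_singletons:
  "is_partition l \<Longrightarrow> mtilde (image_mset (\<lambda>i. {#i#}) (part_content l)) = l"
  by (simp add: mtilde_eq mult_shape_image mult_shape_part_content rev_sort_partition inj_on_def)

text \<open>The partition into singletons is the only one with as many blocks as elements, and its
  multiplicities are \<open>l\<close> itself. So the defining relation of \<open>htilde\<close> is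
  unitriangular with respect to size.\<close>

lemma sum_mset_partitions_split:
  assumes l: "is_partition l"
  shows "(\<Sum>\<pi>\<in>mset_partitions (part_content l). F (mtilde \<pi>)) =
    F l + (\<Sum>\<pi>\<in>{\<pi> \<in> mset_partitions (part_content l). size \<pi> < sum_list l}. F (mtilde \<pi>))"
proof -
  let ?s = "image_mset (\<lambda>i. {#i#}) (part_content l)"
  let ?P = "mset_partitions (part_content l)"
  have s: "?s \<in> ?P" by (auto simp: mset_partitions_def)
  have sz: "size ?s = sum_list l" by (simp add: size_part_content)
  have "\<pi> = ?s \<or> size \<pi> < sum_list l" if "\<pi> \<in> ?P" for \<pi>
  proof -
    have \<pi>: "{#} \<notin># \<pi>" "sum_mset \<pi> = part_content l" using that by (auto simp: mset_partitions_def)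
    show ?thesis
      using size_le_size_sum_mset[OF \<pi>(1)] size_eq_size_sum_mset[OF \<pi>(1)]
      unfolding \<pi>(2) size_part_content by fastforce
  qed
  then have "?P - {?s} = {\<pi> \<in> ?P. size \<pi> < sum_list l}" using sz by auto
  then show ?thesis
    using sum.remove[OF finite_mset_partitions s, of "\<lambda>\<pi>. F (mtilde \<pi>)"] mtilde_singletons[OF l] by simp
qed

text \<open>The unitriangular relation solved for its leading term; this is the witness for the
  description operator in \<open>htilde\<close>.\<close>

function htilde_rec :: "nat list \<Rightarrow> sf" where
  "htilde_rec l = (if is_partition l then
     (\<lambda>N x. h_part l N x - (\<Sum>\<pi>\<in>{\<pi> \<in> mset_partitions (part_content l). size \<pi> < sum_list l}. htilde_rec (mtilde \<pi>) N x))
     else (\<lambda>N x. 0))"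
  by pat_completeness auto
termination by (relation "measure sum_list") (auto simp: sum_list_mtilde)

declare htilde_rec.simps [simp del]

lemma htilde:
  assumes "is_partition l"
  shows "h_part l = (\<Sum>\<pi>\<in>mset_partitions (part_content l). htilde (mtilde \<pi>))"
proof -
  let ?spec = "\<lambda>H. (\<forall>l. \<not> is_partition l \<longrightarrow> H l = (\<lambda>N x. 0)) \<and>
      (\<forall>l. is_partition l \<longrightarrow> (\<forall>N x. h_part l N x = (\<Sum>\<pi>\<in>mset_partitions (part_content l). H (mtilde \<pi>) N x)))"
  have ex: "?spec htilde_rec"
  proof (intro conjI allI impI)
    fix l :: "nat list" and N x assume l: "is_partition l"
    show "h_part l N x = (\<Sum>\<pi>\<in>mset_partitions (part_content l). htilde_rec (mtilde \<pi>) N x)"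
      unfolding sum_mset_partitions_split[OF l, of "\<lambda>m. htilde_rec m N x"] htilde_rec.simps[of l] using l by simp
  qed (simp add: htilde_rec.simps)
  have uniq: "H = htilde_rec" if H: "?spec H" for H
  proof
    fix l show "H l = htilde_rec l"
    proof (induction "sum_list l" arbitrary: l rule: less_induct)
      case less
      show ?case
      proof (cases "is_partition l")
        case True
        show ?thesis
        proof (intro ext)
          fix N x
          have "H l N x + (\<Sum>\<pi>\<in>{\<pi> \<in> mset_partitions (part_content l). size \<pi> < sum_list l}. H (mtilde \<pi>) N x) =
            htilde_rec l N x + (\<Sum>\<pi>\<in>{\<pi> \<in> mset_partitions (part_content l). size \<pi> < sum_list l}. htilde_rec (mtilde \<pi>) N x)"
            using conjunct2[OF H, rule_format, OF True, of N x] conjunct2[OF ex, rule_format, OF True, of N x]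
            unfolding sum_mset_partitions_split[OF True, of "\<lambda>m. H m N x"]
              sum_mset_partitions_split[OF True, of "\<lambda>m. htilde_rec m N x"] by linarith
          moreover have "(\<Sum>\<pi>\<in>{\<pi> \<in> mset_partitions (part_content l). size \<pi> < sum_list l}. H (mtilde \<pi>) N x) =
            (\<Sum>\<pi>\<in>{\<pi> \<in> mset_partitions (part_content l). size \<pi> < sum_list l}. htilde_rec (mtilde \<pi>) N x)"
          proof (rule sum.cong[OF refl])
            fix \<pi> assume "\<pi> \<in> {\<pi> \<in> mset_partitions (part_content l). size \<pi> < sum_list l}"
            then have "H (mtilde \<pi>) = htilde_rec (mtilde \<pi>)" by (intro less) (simp add: sum_list_mtilde)
            then show "H (mtilde \<pi>) N x = htilde_rec (mtilde \<pi>) N x" by simp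
          qed
          ultimately show "H l N x = htilde_rec l N x" by simp
        qed
      next
        case False
        show ?thesis
          by (simp only: conjunct1[OF H, rule_format, OF False] conjunct1[OF ex, rule_format, OF False])
      qed
    qed
  qed
  have "htilde = htilde_rec" unfolding htilde_def by (rule the_equality) (fact ex, fact uniq)
  then show ?thesis using ex assms by (auto simp: fun_eq_iff sf_sum_apply)
qed

section \<open>The linear maps \<open>Theta\<close>, \<open>Psi\<close> and
  \<open>Lambda\<close>\<close>

definition Theta :: "sf \<Rightarrow> sf" where
  "Theta = (SOME L. sf_linear L \<and> (\<forall>\<gamma>. is_partition \<gamma> \<longrightarrow> L (h_part \<gamma>) = htilde \<gamma>))"

text \<open>Deleting the first part undoes the padding: when the Schur function of a padded shape is
  expanded into products of complete functions, this map turns each padded index into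
  \<open>htilde\<close> of its tail, as in the sum defining \<open>stilde\<close>. As for
  \<open>Theta\<close> and \<open>Lambda\<close>, the choice operator is used because only the
  values on a basis of Sym are prescribed.\<close>

definition Psi :: "sf \<Rightarrow> sf" where
  "Psi = (SOME L. sf_linear L \<and> (\<forall>\<gamma>. is_partition \<gamma> \<longrightarrow> L (h_part \<gamma>) = htilde (tl \<gamma>)))"

definition Lambda :: "sf \<Rightarrow> sf" where
  "Lambda = (SOME L. sf_linear L \<and> (\<forall>f. pfun f \<longrightarrow> L (schurf f) = stilde (lof f)))"

lemma Theta: "sf_linear Theta" "is_partition \<gamma> \<Longrightarrow> Theta (h_part \<gamma>) = htilde \<gamma>"
proof -
  let ?P = "\<lambda>L. sf_linear L \<and> (\<forall>\<gamma>. is_partition \<gamma> \<longrightarrow> L (h_part \<gamma>) = htilde \<gamma>)"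
  obtain L where "?P L"
    using indep_family_extend[OF h_part_indep, of htilde] by (metis mem_Collect_eq)
  then have "?P (SOME L. ?P L)" by (rule someI[of ?P])
  then have "?P Theta" unfolding Theta_def .
  then show "sf_linear Theta" "is_partition \<gamma> \<Longrightarrow> Theta (h_part \<gamma>) = htilde \<gamma>" by auto
qed

lemma Psi: "sf_linear Psi" "is_partition \<gamma> \<Longrightarrow> Psi (h_part \<gamma>) = htilde (tl \<gamma>)"
proof -
  let ?P = "\<lambda>L. sf_linear L \<and> (\<forall>\<gamma>. is_partition \<gamma> \<longrightarrow> L (h_part \<gamma>) = htilde (tl \<gamma>))"
  obtain L where "?P L"
    using indep_family_extend[OF h_part_indep, of "\<lambda>\<gamma>. htilde (tl \<gamma>)"] by (metis mem_Collect_eq)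
  then have "?P (SOME L. ?P L)" by (rule someI[of ?P])
  then have "?P Psi" unfolding Psi_def .
  then show "sf_linear Psi" "is_partition \<gamma> \<Longrightarrow> Psi (h_part \<gamma>) = htilde (tl \<gamma>)" by auto
qed

lemma Lambda: "sf_linear Lambda" "pfun f \<Longrightarrow> Lambda (schurf f) = stilde (lof f)"
proof -
  let ?P = "\<lambda>L. sf_linear L \<and> (\<forall>f. pfun f \<longrightarrow> L (schurf f) = stilde (lof f))"
  obtain L where "?P L"
    using indep_family_extend[OF schurf_indep, of "\<lambda>f. stilde (lof f)"] by (metis mem_Collect_eq)
  then have "?P (SOME L. ?P L)" by (rule someI[of ?P])
  then have "?P Lambda" unfolding Lambda_def .
  then show "sf_linear Lambda" "pfun f \<Longrightarrow> Lambda (schurf f) = stilde (lof f)" by auto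
qed

lemma sf_linear_sum: "sf_linear L \<Longrightarrow> L (\<Sum>i\<in>I. F i) = (\<Sum>i\<in>I. L (F i))"
  by (simp add: sfp.linear_sum)

lemma pad_partition:
  assumes "is_partition \<mu>" "sum_list \<mu> \<le> k"
  shows "is_partition (pad k \<mu>)" "sum_list (pad k \<mu>) = k + sum_list \<mu>" "tl (pad k \<mu>) = \<mu>"
    "pf (pad k \<mu>) = case_nat k (pf \<mu>)"
proof -
  have "is_partition (pad k \<mu>) \<and> sum_list (pad k \<mu>) = k + sum_list \<mu> \<and> tl (pad k \<mu>) = \<mu> \<and>
    pf (pad k \<mu>) = case_nat k (pf \<mu>)"
  proof (cases "k = 0")
    \<comment> \<open>\<open>pad\<close> suppresses a zero part; under the size bound this concerns
      only the empty partition.\<close>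
    case True
    then have "\<mu> = []" using assms by (cases \<mu>) (auto simp: is_partition_def)
    then show ?thesis using True by (auto simp: pad_def is_partition_def pf_def fun_eq_iff split: nat.split)
  next
    case False
    have "m \<le> k" if "m \<in> set \<mu>" for m using member_le_sum_list[OF that] assms(2) by simp
    then show ?thesis using False assms by (auto simp: pad_def is_partition_def pf_Cons)
  qed
  then show "is_partition (pad k \<mu>)" "sum_list (pad k \<mu>) = k + sum_list \<mu>" "tl (pad k \<mu>) = \<mu>"
    "pf (pad k \<mu>) = case_nat k (pf \<mu>)" by auto
qed

lemma pad_tl: "is_partition \<gamma> \<Longrightarrow> pad (sum_list \<gamma> - sum_list (tl \<gamma>)) (tl \<gamma>) = \<gamma>"
  by (cases \<gamma>) (auto simp: pad_def is_partition_def)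

text \<open>The expansion runs over all \<gamma> of size 2m, but a nonzero coefficient forces
  \<gamma>_1 >= m, so the tail has size at most m. Removing and restoring the first part is then a
  bijection with the partitions \<mu> in \<open>stilde\<close>.\<close>

lemma stilde_eq_Psi:
  assumes l: "is_partition l" shows "stilde l = Psi (schur (pad (sum_list l) l))"
proof -
  let ?m = "sum_list l" let ?\<alpha> = "pad ?m l"
  let ?M = "{\<mu>. is_partition \<mu> \<and> sum_list \<mu> \<le> ?m}"
  let ?G = "{\<gamma> \<in> partitions_of (2 * ?m). ?m \<le> pf \<gamma> 0}"
  have \<alpha>: "is_partition ?\<alpha>" "sum_list ?\<alpha> = 2 * ?m" "pf ?\<alpha> = case_nat ?m (pf l)"
    using pad_partition[OF l, of ?m] by auto
  have "Psi (schur ?\<alpha>) = (\<Sum>\<gamma>\<in>partitions_of (2 * ?m). Psi (sf_scale (kostka_inv ?\<alpha> \<gamma>) (h_part \<gamma>)))"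
    unfolding kostka_inv(2)[OF \<alpha>(1)] \<alpha>(2) by (rule sf_linear_sum[OF Psi(1)])
  also have "\<dots> = (\<Sum>\<gamma>\<in>partitions_of (2 * ?m). sf_scale (kostka_inv ?\<alpha> \<gamma>) (htilde (tl \<gamma>)))"
    by (rule sum.cong) (auto simp: sfp.linear_scale[OF Psi(1)] Psi(2) partitions_of_def)
  also have "\<dots> = (\<Sum>\<gamma>\<in>?G. sf_scale (kostka_inv ?\<alpha> \<gamma>) (htilde (tl \<gamma>)))"
  proof (rule sum.mono_neutral_right)
    show "\<forall>\<gamma>\<in>partitions_of (2 * ?m) - ?G. sf_scale (kostka_inv ?\<alpha> \<gamma>) (htilde (tl \<gamma>)) = 0"
      using kostka_inv(3)[OF \<alpha>(1)] by (auto simp: \<alpha>(3))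
  qed (auto simp: finite_partitions_of)
  also have "\<dots> = (\<Sum>\<mu>\<in>?M. sf_scale (kostka_inv ?\<alpha> (pad (2 * ?m - sum_list \<mu>) \<mu>)) (htilde \<mu>))"
  proof (rule sum.reindex_bij_witness[where i = "\<lambda>\<mu>. pad (2 * ?m - sum_list \<mu>) \<mu>" and j = tl], goal_cases)
    case (1 \<gamma>) then show ?case using pad_tl[of \<gamma>] by (auto simp: partitions_of_def)
  next
    case (2 \<gamma>)
    then have "is_partition \<gamma>" "sum_list \<gamma> = 2 * ?m" "?m \<le> pf \<gamma> 0" by (auto simp: partitions_of_def)
    moreover from this have "sum_list \<gamma> = pf \<gamma> 0 + sum_list (tl \<gamma>)" by (cases \<gamma>) (auto simp: pf_def)
    ultimately show ?case by (auto simp: is_partition_tl)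
  next
    case (3 \<mu>)
    then have "is_partition \<mu>" "sum_list \<mu> \<le> 2 * ?m - sum_list \<mu>" by auto
    then show ?case using pad_partition(3) by blast
  next
    case (4 \<mu>)
    then have \<mu>: "is_partition \<mu>" "sum_list \<mu> \<le> ?m" by auto
    then have "sum_list \<mu> \<le> 2 * ?m - sum_list \<mu>" by simp
    then show ?case
      using \<mu> pad_partition[OF \<mu>(1), of "2 * ?m - sum_list \<mu>"] by (simp add: partitions_of_def)
  next
    case (5 \<gamma>) then show ?case using pad_tl[of \<gamma>] by (auto simp: partitions_of_def)
  qed
  also have "\<dots> = stilde l"
    by (auto simp: fun_eq_iff stilde_def sf_sum_apply Let_def)
  finally show ?thesis by simp
qed

lemma sf_linear_comp: "sf_linear L \<Longrightarrow> sf_linear M \<Longrightarrow> sf_linear (\<lambda>f. M (L f))"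
  using Vector_Spaces.linear_compose[of sf_scale sf_scale L sf_scale M] by (simp add: comp_def)

text \<open>For \<open>k\<close> at least the degree, \<open>k\<close> is no smaller than any part
  of \<gamma>, so prepending it to \<gamma> gives a partition again, and \<open>Psi\<close> removes
  it.\<close>

lemma Psi_h_mult:
  assumes f: "pfun f" and k: "fsize f \<le> k"
  shows "Psi (h_k k * schurf f) = Theta (schurf f)"
proof (rule sf_linear_eq_on_span[OF sf_linear_comp[OF sf_linear_mult Psi(1)] Theta(1) _ schurf_in_span_h[OF f]])
  fix b assume "b \<in> h_part ` h_above (fsize f) (f 0)"
  then obtain \<gamma> where \<gamma>: "is_partition \<gamma>" "sum_list \<gamma> = fsize f" "b = h_part \<gamma>"
    by (auto simp: h_above_def)
  have "h_k k * b = h_part (pad k \<gamma>)"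
    by (auto simp: \<gamma>(3) pad_def h_part_Cons h_k_zero_fun)
  then show "Psi (h_k k * b) = Theta b"
    using pad_partition[OF \<gamma>(1), of k] \<gamma> k by (simp add: Psi(2) Theta(2))
qed

text \<open>In the Pieri expansion of h_k s_f the rows of \<open>l\<close> after the first form a
  shape \<open>g\<close> with f/g a horizontal strip, and the first row is then fixed by the size.
  The bound on \<open>k\<close> makes that row long enough for every such \<open>g\<close>.\<close>

lemma Theta_schurf_expand:
  assumes f: "pfun f" and k: "fsize f \<le> k"
  shows "Theta (schurf f) = (\<Sum>g | hstrip g f. Psi (schurf (case_nat (k + fsize f - fsize g) g)))"
proof -
  have "Theta (schurf f) = Psi (\<Sum>l | hstrip f l \<and> fsize l = fsize f + k. schurf l)"
    using Psi_h_mult[OF assms] by (simp add: pieri_h_sf[OF f])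
  also have "\<dots> = (\<Sum>l | hstrip f l \<and> fsize l = fsize f + k. Psi (schurf l))"
    by (rule sf_linear_sum[OF Psi(1)])
  also have "\<dots> = (\<Sum>g | hstrip g f. Psi (schurf (case_nat (k + fsize f - fsize g) g)))"
  proof (rule sum.reindex_bij_witness[where i = "\<lambda>g. case_nat (k + fsize f - fsize g) g" and j = "\<lambda>l. l \<circ> Suc"])
    fix l assume "l \<in> {l. hstrip f l \<and> fsize l = fsize f + k}"
    then have l: "hstrip f l" "fsize l = fsize f + k" by auto
    then have pl: "pfun l" by (simp add: hstrip_def)
    show eq: "case_nat (k + fsize f - fsize (l \<circ> Suc)) (l \<circ> Suc) = l"
      using fsize_shift[OF pl] l(2) by (auto simp: fun_eq_iff split: nat.split)
    show "l \<circ> Suc \<in> {g. hstrip g f}"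
      using l(1) f pfun_shift[OF pl] by (auto simp: hstrip_def)
    show "Psi (schurf (case_nat (k + fsize f - fsize (l \<circ> Suc)) (l \<circ> Suc))) = Psi (schurf l)"
      by (simp only: eq)
  next
    fix g assume "g \<in> {g. hstrip g f}"
    then have g: "hstrip g f" by simp
    let ?l = "case_nat (k + fsize f - fsize g) g"
    show eq: "?l \<circ> Suc = g" by (auto simp: fun_eq_iff)
    have K: "f 0 \<le> k + fsize f - fsize g" using fsize_ge[OF f, of 0] hstrip_fsize[OF g] k by simp
    have "g 0 \<le> f 0" "pfun g" using g by (auto simp: hstrip_def)
    then have pl: "pfun ?l" using K by (intro pfun_case_nat) auto
    have "fsize ?l = fsize f + k" using fsize_shift[OF pl] hstrip_fsize[OF g] unfolding eq by simp
    moreover have "hstrip f ?l"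
      unfolding hstrip_def
    proof (intro conjI allI f pl)
      fix i show "f i \<le> ?l i" "?l (Suc i) \<le> f i" using g K by (auto simp: hstrip_def split: nat.split)
    qed
    ultimately show "?l \<in> {l. hstrip f l \<and> fsize l = fsize f + k}" by simp
  qed
  finally show ?thesis .
qed

text \<open>\<open>stilde\<close> is defined by n = 2|f|, that is, by first row k = |f|. In the
  expansion of Theta(s_f) every \<open>g\<close> other than \<open>f\<close> is smaller, so its term
  is independent of \<open>k\<close> by induction; the left side does not involve \<open>k\<close>,
  hence neither does the term of \<open>f\<close>.\<close>

lemma Psi_schurf_stable:
  "pfun f \<Longrightarrow> fsize f \<le> k \<Longrightarrow> Psi (schurf (case_nat k f)) = stilde (lof f)"
proof (induction "fsize f" arbitrary: f k rule: less_induct)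
  case less
  note f = less.prems(1)
  let ?R = "\<Sum>g\<in>{g. hstrip g f} - {f}. stilde (lof g)"
  have ff: "hstrip f f" using f by (auto simp: hstrip_def intro: pfun_antimono)
  have *: "Theta (schurf f) = Psi (schurf (case_nat k f)) + ?R" if k: "fsize f \<le> k" for k
  proof -
    have "Theta (schurf f) = Psi (schurf (case_nat k f)) +
        (\<Sum>g\<in>{g. hstrip g f} - {f}. Psi (schurf (case_nat (k + fsize f - fsize g) g)))"
      unfolding Theta_schurf_expand[OF f k] using ff by (subst sum.remove[of _ f]) auto
    also have "(\<Sum>g\<in>{g. hstrip g f} - {f}. Psi (schurf (case_nat (k + fsize f - fsize g) g))) = ?R"
    proof (rule sum.cong[OF refl])
      fix g assume g: "g \<in> {g. hstrip g f} - {f}"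
      then have "pfun g" "fsize g \<le> fsize f" using hstrip_fsize[of g f] by (auto simp: hstrip_def)
      moreover have "fsize g \<noteq> fsize f" using g fsize_eq_imp_eq[OF f, of g] by (auto simp: hstrip_def)
      ultimately show "Psi (schurf (case_nat (k + fsize f - fsize g) g)) = stilde (lof g)"
        using k by (intro less.hyps) auto
    qed
    finally show ?thesis .
  qed
  have "stilde (lof f) = Psi (schur (pad (fsize f) (lof f)))"
    using stilde_eq_Psi[OF is_partition_lof[OF f]] by (simp add: sum_list_eq_fsize pf_lof[OF f])
  also have "\<dots> = Psi (schurf (case_nat (fsize f) f))"
    using pad_partition[OF is_partition_lof[OF f], of "fsize f"]
    by (simp add: sum_list_eq_fsize pf_lof[OF f] schur_eq_schurf)
  finally show ?case using *[OF less.prems(2)] *[of "fsize f"] by simp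
qed

theorem Theta_schurf:
  assumes f: "pfun f"
  shows "Theta (schurf f) = (\<Sum>g | hstrip g f. stilde (lof g))"
  unfolding Theta_schurf_expand[OF f order_refl]
proof (rule sum.cong[OF refl])
  fix g assume "g \<in> {g. hstrip g f}"
  then have "pfun g" "fsize g \<le> fsize f" using hstrip_fsize[of g f] by (auto simp: hstrip_def)
  then show "Psi (schurf (case_nat (fsize f + fsize f - fsize g) g)) = stilde (lof g)"
    by (intro Psi_schurf_stable) auto
qed

text \<open>In plethystic notation f[X] goes to f[X + 1]. The new variable is put in last position,
  where \<open>schurf_Suc\<close>, \<open>h_k_Suc\<close> and \<open>e_k_Suc\<close> expand; being
  an evaluation, the map is multiplicative on all of \<open>sf\<close>.\<close>

definition add_one :: "sf \<Rightarrow> sf" where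
  "add_one f = (\<lambda>N x. f (Suc N) (x(N := 1)))"

lemma sf_linear_add_one: "sf_linear add_one"
  by (rule sf_linearI) (auto simp: add_one_def fun_eq_iff)

lemma add_one_mult: "add_one (f * g) = add_one f * add_one g"
  by (simp add: add_one_def fun_eq_iff)

lemma add_one_h_k: "add_one (h_k k) = (\<Sum>j\<le>k. h_k (k - j))"
proof (intro ext)
  fix N x
  have "h_k j N (x(N := 1)) = h_k j N x" for j by (rule h_k_cong) auto
  then show "add_one (h_k k) N x = (\<Sum>j\<le>k. h_k (k - j)) N x"
    by (simp add: add_one_def h_k_Suc sf_sum_apply)
qed

text \<open>A variable enters e_k at most once, so only j = 0 and j = 1 survive. The sum is written
  over j so that it merges with the one for h in \<open>add_one_gk\<close>.\<close>

lemma add_one_e_k: "add_one (e_k k) = (\<Sum>j | j \<le> k \<and> j \<le> 1. e_k (k - j))"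
proof (intro ext)
  fix N x
  have e: "e_k j N (x(N := 1)) = e_k j N x" for j by (rule e_k_cong) auto
  show "add_one (e_k k) N x = (\<Sum>j | j \<le> k \<and> j \<le> 1. e_k (k - j)) N x"
  proof (cases k)
    case 0
    then have "{j. j \<le> k \<and> j \<le> 1} = {0}" by auto
    then show ?thesis using 0 by (simp add: add_one_def)
  next
    case (Suc m)
    then have "{j. j \<le> k \<and> j \<le> 1} = {0, 1}" by auto
    then show ?thesis using Suc by (simp add: add_one_def e_k_Suc e)
  qed
qed

lemma add_one_schurf: "pfun f \<Longrightarrow> add_one (schurf f) = (\<Sum>g | hstrip g f. schurf g)"
proof (intro ext)
  fix N x assume f: "pfun f"
  have e: "schurf g N (x(N := 1)) = schurf g N x" if "hstrip g f" for g
    by (rule schurf_cong) (use that in \<open>auto simp: hstrip_def\<close>)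
  show "add_one (schurf f) N x = (\<Sum>g | hstrip g f. schurf g) N x"
    unfolding add_one_def schurf_Suc[OF f] sf_sum_apply by (rule sum.cong) (auto simp: e)
qed

text \<open>Both sides are linear, and on s_f both equal the sum of stilde_g over the horizontal
  strips f/g. The argument is confined to the span of the Schur functions, where
  \<open>Theta\<close> and \<open>Lambda\<close> are prescribed.\<close>

theorem Theta_eq_Lambda_add_one:
  assumes "v \<in> sf.span (schurf ` {f. pfun f})"
  shows "Theta v = Lambda (add_one v)"
proof (rule sf_linear_eq_on_span[OF Theta(1) sf_linear_comp[OF sf_linear_add_one Lambda(1)] _ assms])
  fix b assume "b \<in> schurf ` {f. pfun f}"
  then obtain f where f: "pfun f" "b = schurf f" by auto
  have "Lambda (add_one b) = (\<Sum>g | hstrip g f. Lambda (schurf g))"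
    by (simp add: f add_one_schurf sf_linear_sum[OF Lambda(1)])
  also have "\<dots> = (\<Sum>g | hstrip g f. stilde (lof g))"
    by (rule sum.cong) (auto simp: Lambda(2) hstrip_def)
  finally show "Theta b = Lambda (add_one b)" by (simp add: f Theta_schurf)
qed

section \<open>Expansion of elementary functions\<close>

definition gk :: "bool \<Rightarrow> nat \<Rightarrow> sf" where
  "gk b k = (if b then h_k k else e_k k)"

text \<open>One product in three roles: over the letters of a content, over the blocks of a multiset
  partition, and over the sets in a tableau. Each distinct element contributes h or e, indexed by
  its multiplicity.\<close>

definition fprod :: "('a \<Rightarrow> bool) \<Rightarrow> 'a multiset \<Rightarrow> sf" where
  "fprod ev M = (\<Prod>a\<in>set_mset M. gk (ev a) (count M a))"

lemma gk_0 [simp]: "gk b 0 = 1"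
  by (simp add: gk_def fun_eq_iff)

lemma fprod_add:
  assumes "set_mset M \<inter> set_mset M' = {}"
  shows "fprod ev (M + M') = fprod ev M * fprod ev M'"
proof -
  have "fprod ev (M + M') = (\<Prod>a\<in>set_mset M. gk (ev a) (count (M + M') a)) * (\<Prod>a\<in>set_mset M'. gk (ev a) (count (M + M') a))"
    using assms by (simp add: fprod_def prod.union_disjoint)
  also have "(\<Prod>a\<in>set_mset M. gk (ev a) (count (M + M') a)) = fprod ev M"
    unfolding fprod_def by (rule prod.cong) (use assms in \<open>auto simp: disjoint_iff not_in_iff\<close>)
  also have "(\<Prod>a\<in>set_mset M'. gk (ev a) (count (M + M') a)) = fprod ev M'"
  proof -
    have "count M x = 0" if "x \<in># M'" for x using that assms by (meson count_inI disjoint_iff)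
    then show ?thesis unfolding fprod_def by (intro prod.cong) auto
  qed
  finally show ?thesis .
qed

lemma fprod_replicate [simp]: "fprod ev (replicate_mset n a) = gk (ev a) n"
  by (cases "n = 0") (auto simp: fprod_def)

lemma fprod_cong: "(\<And>a. a \<in># M \<Longrightarrow> ev a = ev' a) \<Longrightarrow> fprod ev M = fprod ev' M"
  by (auto simp: fprod_def intro!: prod.cong)

lemma gk_relation:
  assumes "0 < k"
  shows "(\<Sum>i\<le>k. sf_scale ((- 1) ^ i) (gk p (k - i) * gk (\<not> p) i)) = 0"
proof (intro ext)
  fix N x
  have eh: "(\<Sum>i\<le>k. (- 1) ^ i * (h_k (k - i) N x * e_k i N x)) = 0"
    using e_h_relation[OF assms, of N x] by (simp add: mult_ac)
  show "(\<Sum>i\<le>k. sf_scale ((- 1) ^ i) (gk p (k - i) * gk (\<not> p) i)) N x = 0 N x"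
  proof (cases p)
    case True
    then show ?thesis using eh by (simp add: sf_sum_apply gk_def)
  next
    case False
    \<comment> \<open>The other case is the same relation read backwards, up to the global sign
      (-1)^k.\<close>
    have "(\<Sum>i\<le>k. (- 1) ^ i * (e_k (k - i) N x * h_k i N x)) =
        (\<Sum>i\<le>k. (- 1) ^ k * ((- 1) ^ i * (h_k (k - i) N x * e_k i N x)))"
    proof (rule sum.reindex_bij_witness[where i = "\<lambda>i. k - i" and j = "\<lambda>i. k - i"])
      fix i assume "i \<in> {..k}"
      then have i: "i \<le> k" by simp
      then have "(- 1 :: rat) ^ k = (- 1) ^ i * (- 1) ^ (k - i)" by (simp add: power_add[symmetric])
      then have *: "(- 1 :: rat) ^ k * (- 1) ^ (k - i) = (- 1) ^ i"
        by (simp add: mult.assoc power_mult_distrib[symmetric])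
      show "(- 1) ^ k * ((- 1) ^ (k - i) * (h_k (k - (k - i)) N x * e_k (k - i) N x)) =
          (- 1) ^ i * (e_k (k - i) N x * h_k i N x)"
        unfolding mult.assoc[symmetric, of "(- 1) ^ k"] * diff_diff_cancel[OF i]
        by (simp only: mult.commute[of "h_k i N x"])
    qed auto
    also have "\<dots> = 0" using eh by (simp add: sum_distrib_left[symmetric])
    finally show ?thesis using False by (simp add: sf_sum_apply gk_def)
  qed
qed

section \<open>Multiset partitions with even and odd letters\<close>

lemma count_merge:
  assumes "c \<noteq> c'"
  shows "count (image_mset (\<lambda>B. if B = c' then c else B) M) B =
    (if B = c then count M c + count M c' else if B = c' then 0 else count M B)"
  using assms by (induction M) auto

lemma count_sum_mset_replicate: "count (sum_mset (replicate_mset n B)) i = n * count B i"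
  by (induction n) auto

lemma image_mset_sum_mset: "image_mset f (sum_mset M) = sum_mset (image_mset (image_mset f) M)"
  by (induction M) auto

text \<open>Parity as in a superalgebra: the degree of a block is the number of its odd letters
  modulo 2, and by \<open>okb\<close> an odd letter does not occur twice in a block. Blocks of even
  degree contribute h like even letters, blocks of odd degree contribute e like odd letters.\<close>

definition evb :: "nat set \<Rightarrow> nat multiset \<Rightarrow> bool" where
  "evb Od B \<longleftrightarrow> even (size (filter_mset (\<lambda>i. i \<in> Od) B))"

definition okb :: "nat set \<Rightarrow> nat multiset \<Rightarrow> bool" where
  "okb Od B \<longleftrightarrow> (\<forall>i\<in>Od. count B i \<le> 1)"

definition super_partitions :: "nat set \<Rightarrow> nat multiset \<Rightarrow> nat multiset multiset set" where
  "super_partitions Od M = {\<pi> \<in> mset_partitions M. \<forall>B\<in>#\<pi>. okb Od B}"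

lemma finite_super_partitions: "finite (super_partitions Od M)"
  using finite_mset_partitions by (simp add: super_partitions_def)

text \<open>Turning one odd letter \<open>a\<close> of a block into a fresh even letter \<open>b\<close> changes the parity
  of the block. Within a fibre that distributes the copies of one block between the two
  versions the signed sum is an instance of \<open>gk_relation\<close>.\<close>

lemma toggle_sum:
  fixes a b k :: nat and M0 :: "nat multiset" and Od :: "nat set"
  defines "mrg \<equiv> image_mset (\<lambda>i. if i = a then b else i)"
  defines "X \<equiv> {\<pi>. {#} \<notin># \<pi> \<and> (\<forall>B\<in>#\<pi>. okb Od B) \<and> mrg (sum_mset \<pi>) = M0 + replicate_mset k b}"
  assumes ab: "a \<in> Od" "b \<notin> Od" and k: "0 < k" and fin: "finite X"
  shows "(\<Sum>\<pi>\<in>X. sf_scale ((- 1) ^ count (sum_mset \<pi>) a) (Theta (fprod (evb Od) \<pi>))) = 0"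
proof -
  have ne: "b \<noteq> a" using ab by auto
  note cm = count_merge[OF ne, folded mrg_def]
  define sw where "sw C = C - {#b#} + {#a#}" for C :: "nat multiset"
  define sig where "sig \<pi> = image_mset mrg \<pi>" for \<pi>
  \<comment> \<open>The chosen block depends only on the merged partition \<open>sig \<pi>\<close>,
    which is constant on a fibre of \<kappa>, so all members of a fibre agree on which block is
    switched.\<close>
  define Cf where "Cf \<sigma> = (SOME C. C \<in># \<sigma> \<and> b \<in># C)" for \<sigma> :: "nat multiset multiset"
  \<comment> \<open>A fibre consists of the ways to distribute m copies between the chosen block
    \<open>C\<close> and \<open>sw C\<close>, everything else being fixed.\<close>
  define \<kappa> where "\<kappa> \<pi> = image_mset (\<lambda>B. if B = sw (Cf (sig \<pi>)) then Cf (sig \<pi>) else B) \<pi>" for \<pi>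
  have sig_sum: "mrg (sum_mset \<pi>) = sum_mset (sig \<pi>)" for \<pi>
    by (simp add: mrg_def sig_def image_mset_sum_mset)
  have fiber: "(\<Sum>\<pi>\<in>{\<pi> \<in> X. \<kappa> \<pi> = y}. sf_scale ((- 1) ^ count (sum_mset \<pi>) a) (Theta (fprod (evb Od) \<pi>))) = 0"
    if y: "y \<in> \<kappa> ` X" for y
  proof -
    obtain \<pi>0 where \<pi>0: "\<pi>0 \<in> X" "y = \<kappa> \<pi>0" using y by blast
    define C where "C = Cf (sig \<pi>0)"
    \<comment> \<open>As \<open>k\<close> is positive, some merged block contains \<open>b\<close>,
      so the choice in \<open>Cf\<close> is legitimate.\<close>
    have "b \<in># sum_mset (sig \<pi>0)" using \<pi>0 k by (auto simp: X_def sig_sum)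
    then have "\<exists>C. C \<in># sig \<pi>0 \<and> b \<in># C" by auto
    then have C: "C \<in># sig \<pi>0" "b \<in># C" unfolding C_def Cf_def by (metis (mono_tags, lifting) someI_ex)+
    obtain B0 where B0: "B0 \<in># \<pi>0" "C = mrg B0" using C(1) by (auto simp: sig_def)
    have Ca: "count C a = 0" using ne by (simp add: B0 cm)
    have okB0: "okb Od B0" using \<pi>0 B0 by (auto simp: X_def)
    have okC: "okb Od C" unfolding okb_def
    proof
      fix i assume i: "i \<in> Od"
      then have "i \<noteq> b" using ab by auto
      then show "count C i \<le> 1" using okB0 i by (auto simp: B0 cm okb_def)
    qed
    have okC': "okb Od (sw C)" unfolding okb_def
    proof
      fix i assume i: "i \<in> Od"
      then have "i \<noteq> b" using ab by auto
      then show "count (sw C) i \<le> 1" using okC i Ca ne by (auto simp: sw_def okb_def)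
    qed
    have aC': "count (sw C) a = 1" using Ca ne by (simp add: sw_def)
    have CC': "C \<noteq> sw C" using aC' Ca by auto
    have nemp: "C \<noteq> {#}" "sw C \<noteq> {#}" using C(2) by (auto simp: sw_def)
    have mrgC: "mrg C = C" by (rule multiset_eqI) (use Ca in \<open>auto simp: cm\<close>)
    have mrgC': "mrg (sw C) = C"
      by (rule multiset_eqI) (use Ca C(2) ne in \<open>auto simp: cm sw_def\<close>)
    have parity: "evb Od (sw C) \<longleftrightarrow> \<not> evb Od C"
    proof -
      have "filter_mset (\<lambda>i. i \<in> Od) (sw C) = add_mset a (filter_mset (\<lambda>i. i \<in> Od) C)"
        using ab by (simp add: sw_def)
      then show ?thesis by (simp add: evb_def)
    qed
    have y_def: "y = image_mset (\<lambda>B. if B = sw C then C else B) \<pi>0"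
      unfolding \<pi>0(2) \<kappa>_def C_def by (rule refl)
    note cy = count_merge[OF CC', of \<pi>0, folded y_def]
    have sig_merge: "sig (image_mset (\<lambda>B. if B = sw C then C else B) \<pi>) = sig \<pi>" for \<pi>
      unfolding sig_def image_mset.compositionality
      by (rule image_mset_cong) (auto simp: mrgC mrgC')
    have sigy: "sig y = sig \<pi>0" unfolding y_def by (rule sig_merge)
    define m where "m = count y C"
    \<comment> \<open>A block with merged image \<open>C\<close> contains the odd letter
      \<open>a\<close> at most once: either not at all, or in place of one \<open>b\<close> of
      \<open>C\<close>.\<close>
    have "B0 = C \<or> B0 = sw C"
    proof (cases "a \<in># B0")
      case False
      then have "B0 = C" unfolding B0(2) by (intro multiset_eqI) (auto simp: cm not_in_iff)
      then show ?thesis ..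
    next
      case True
      then have "count B0 a = 1" using okB0 ab by (metis One_nat_def count_greater_zero_iff le_antisym okb_def Suc_leI)
      then have "B0 = sw C" unfolding B0(2) sw_def using ne by (intro multiset_eqI) (auto simp: cm)
      then show ?thesis ..
    qed
    then have m: "0 < m" using B0(1) by (auto simp: m_def cy)
    define rest where "rest = filter_mset (\<lambda>B. B \<noteq> C \<and> B \<noteq> sw C) y"
    define Y where "Y i = rest + replicate_mset (m - i) C + replicate_mset i (sw C)" for i
    have cY: "count (Y i) B = (if B = C then m - i else if B = sw C then i else count y B)" for i B
      using CC' by (auto simp: Y_def rest_def)
    have y_eq: "y = rest + replicate_mset m C"
      by (rule multiset_eqI) (auto simp: rest_def m_def cy)
    have sigY: "sig (Y i) = sig \<pi>0" if "i \<le> m" for i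
    proof -
      have "sig (Y i) = image_mset mrg rest + replicate_mset (m - i) C + replicate_mset i C"
        by (simp add: sig_def Y_def mrgC mrgC')
      also have "\<dots> = image_mset mrg rest + replicate_mset m C"
        using that by (intro multiset_eqI) auto
      also have "\<dots> = sig y" by (subst y_eq) (simp add: sig_def mrgC)
      finally show ?thesis by (simp add: sigy)
    qed
    have YX: "Y i \<in> X \<and> \<kappa> (Y i) = y" if i: "i \<le> m" for i
    proof
      have "B \<in># \<pi>0 \<or> B = C \<or> B = sw C" if "B \<in># Y i" for B
      proof -
        have "0 < count (Y i) B" using that by simp
        then show ?thesis by (auto simp: cY cy split: if_splits)
      qed
      then have *: "B \<noteq> {#} \<and> okb Od B" if "B \<in># Y i" for B
        using that[THEN \<open>\<And>B. B \<in># Y i \<Longrightarrow> B \<in># \<pi>0 \<or> B = C \<or> B = sw C\<close>] \<pi>0(1) okC okC' nemp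
        by (elim disjE) (auto simp: X_def)
      have "mrg (sum_mset (Y i)) = M0 + replicate_mset k b"
        using \<pi>0(1) by (simp add: sig_sum sigY[OF i] X_def)
      then show "Y i \<in> X" using * by (auto simp: X_def)
      have "\<kappa> (Y i) = image_mset (\<lambda>B. if B = sw C then C else B) (Y i)"
        unfolding \<kappa>_def sigY[OF i] C_def by (rule refl)
      also have "\<dots> = y"
        by (rule multiset_eqI) (use i CC' in \<open>auto simp: count_merge[OF CC'] cY m_def cy\<close>)
      finally show "\<kappa> (Y i) = y" .
    qed
    have fib: "{\<pi> \<in> X. \<kappa> \<pi> = y} = Y ` {..m}"
    proof (intro subset_antisym subsetI)
      fix \<pi> assume "\<pi> \<in> {\<pi> \<in> X. \<kappa> \<pi> = y}"
      then have \<pi>: "\<pi> \<in> X" "\<kappa> \<pi> = y" by auto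
      have "sig y = sig \<pi>"
      proof -
        define C1 where "C1 = Cf (sig \<pi>)"
        have "b \<in># sum_mset (sig \<pi>)" using \<pi> k by (auto simp: X_def sig_sum)
        then have "\<exists>C. C \<in># sig \<pi> \<and> b \<in># C" by auto
        then have C1: "C1 \<in># sig \<pi>" "b \<in># C1" unfolding C1_def Cf_def by (metis (mono_tags, lifting) someI_ex)+
        then have C1a: "count C1 a = 0" using ne by (auto simp: sig_def cm)
        have "mrg C1 = C1" by (rule multiset_eqI) (use C1a in \<open>auto simp: cm\<close>)
        moreover have "mrg (sw C1) = C1"
          by (rule multiset_eqI) (use C1a C1(2) ne in \<open>auto simp: cm sw_def\<close>)
        ultimately show ?thesis
          unfolding \<pi>(2)[symmetric] \<kappa>_def sig_def image_mset.compositionality C1_def[unfolded sig_def, symmetric]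
          by (intro image_mset_cong) auto
      qed
      then have "Cf (sig \<pi>) = C" by (simp add: C_def sigy)
      then have y2: "y = image_mset (\<lambda>B. if B = sw C then C else B) \<pi>"
        using \<pi>(2) unfolding \<kappa>_def by (simp only:)
      note c2 = count_merge[OF CC', of \<pi>, folded y2]
      have "\<pi> = Y (count \<pi> (sw C))"
        by (rule multiset_eqI) (simp add: cY c2 m_def)
      moreover have "count \<pi> (sw C) \<le> m" by (simp add: m_def c2)
      ultimately show "\<pi> \<in> Y ` {..m}" by blast
    qed (use YX in auto)
    have injY: "inj_on Y {..m}"
    proof (rule inj_onI)
      fix i j assume "Y i = Y j"
      then have "count (Y i) (sw C) = count (Y j) (sw C)" by simp
      then show "i = j" using CC' by (simp add: cY)
    qed
    let ?z = "count (sum_mset rest) a"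
    \<comment> \<open>\<open>Y i\<close> is the member of the fibre with \<open>i\<close> switched
      copies. Each of them brings one more \<open>a\<close>, which gives the sign (-1)^i up to a
      constant, and the switched block has the opposite parity, so the two factors are of opposite
      type, as \<open>gk_relation\<close> requires.\<close>
    have summand: "sf_scale ((- 1) ^ count (sum_mset (Y i)) a) (Theta (fprod (evb Od) (Y i))) =
        Theta (sf_scale ((- 1) ^ ?z) (fprod (evb Od) rest) *
          sf_scale ((- 1) ^ i) (gk (evb Od C) (m - i) * gk (\<not> evb Od C) i))" for i
    proof -
      have "count (sum_mset (Y i)) a = ?z + i"
        by (simp add: Y_def count_sum_mset_replicate Ca aC')
      moreover have "fprod (evb Od) (Y i) = fprod (evb Od) rest * (gk (evb Od C) (m - i) * gk (\<not> evb Od C) i)"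
        unfolding Y_def using CC'
        by (subst fprod_add) (auto simp: rest_def parity fprod_add mult.assoc split: if_splits)
      ultimately show ?thesis
        by (simp only: sfp.linear_scale[OF Theta(1)] sf_scale_mult sf.scale_scale power_add)
          (simp only: mult.commute)
    qed
    have "(\<Sum>\<pi>\<in>{\<pi> \<in> X. \<kappa> \<pi> = y}. sf_scale ((- 1) ^ count (sum_mset \<pi>) a) (Theta (fprod (evb Od) \<pi>))) =
      (\<Sum>i\<le>m. Theta (sf_scale ((- 1) ^ ?z) (fprod (evb Od) rest) *
          sf_scale ((- 1) ^ i) (gk (evb Od C) (m - i) * gk (\<not> evb Od C) i)))"
      unfolding fib by (simp add: sum.reindex[OF injY] summand)
    also have "\<dots> = Theta (sf_scale ((- 1) ^ ?z) (fprod (evb Od) rest) *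
        (\<Sum>i\<le>m. sf_scale ((- 1) ^ i) (gk (evb Od C) (m - i) * gk (\<not> evb Od C) i)))"
      by (simp only: sf_linear_sum[OF Theta(1), symmetric] sum_distrib_left)
    also have "\<dots> = 0" by (simp only: gk_relation[OF m] mult_zero_right sfp.linear_0[OF Theta(1)])
    finally show ?thesis .
  qed
  have "(\<Sum>\<pi>\<in>X. sf_scale ((- 1) ^ count (sum_mset \<pi>) a) (Theta (fprod (evb Od) \<pi>))) =
    (\<Sum>y\<in>\<kappa> ` X. \<Sum>\<pi>\<in>{\<pi> \<in> X. \<kappa> \<pi> = y}. sf_scale ((- 1) ^ count (sum_mset \<pi>) a) (Theta (fprod (evb Od) \<pi>)))"
    by (rule sum.group[symmetric]) (use fin in auto)
  also have "\<dots> = 0" by (rule sum.neutral) (use fiber in auto)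
  finally show ?thesis .
qed

lemma fprod_True: "mset l = mult_shape M \<Longrightarrow> fprod (\<lambda>_. True) M = h_part l"
  by (simp add: fun_eq_iff fprod_def gk_def sf_prod_apply h_part_mset mult_shape_def
      image_mset.compositionality comp_def) (simp add: prod_unfold_prod_mset)

lemma mset_partitions_block: "\<pi> \<in> mset_partitions M \<Longrightarrow> B \<in># \<pi> \<Longrightarrow> set_mset B \<subseteq> set_mset M"
  by (auto simp: mset_partitions_def)

lemma mset_partitions_image:
  "\<pi> \<in> mset_partitions M \<Longrightarrow> image_mset (image_mset g) \<pi> \<in> mset_partitions (image_mset g M)"
  by (auto simp: mset_partitions_def image_mset_sum_mset)

lemma image_blocks_inverse:
  assumes "\<pi> \<in> mset_partitions M" "\<And>i. i \<in># M \<Longrightarrow> g' (g i) = i"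
  shows "image_mset (image_mset g') (image_mset (image_mset g) \<pi>) = \<pi>"
proof -
  have "image_mset (image_mset g') (image_mset (image_mset g) \<pi>) = image_mset (\<lambda>B. B) \<pi>"
    unfolding image_mset.compositionality
  proof (rule image_mset_cong)
    fix B assume "B \<in># \<pi>"
    then have "i \<in># M" if "i \<in># B" for i using that mset_partitions_block[OF assms(1)] by blast
    then have "image_mset (g' \<circ> g) B = image_mset (\<lambda>i. i) B"
      by (intro image_mset_cong) (simp add: assms(2))
    then show "(image_mset g' \<circ> image_mset g) B = B" by (simp add: image_mset.compositionality)
  qed
  then show ?thesis by simp
qed

text \<open>The relation defining \<open>htilde\<close> speaks only of the letters 1, 2, ... with
  weakly decreasing multiplicities. Listing the letters of \<open>M\<close> by decreasing
  multiplicity transfers it to arbitrary multisets, which are needed because fresh letters will be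
  introduced.\<close>

lemma exists_relabelling:
  fixes M :: "nat multiset"
  obtains l g where "is_partition l" "mset l = mult_shape M" "inj_on g (set_mset (part_content l))"
    "image_mset g (part_content l) = M"
proof -
  define ys where "ys = rev (sort_key (count M) (sorted_list_of_set (set_mset M)))"
  define l where "l = map (count M) ys"
  have ys: "set ys = set_mset M" "distinct ys" by (auto simp: ys_def)
  have "mset ys = mset_set (set_mset M)" using ys by (metis mset_set_set)
  then have m: "mset l = mult_shape M" by (simp add: l_def mult_shape_def)
  have "sorted_wrt (\<ge>) l" by (simp add: l_def ys_def rev_map[symmetric] sorted_wrt_rev)
  then have l: "is_partition l" using ys by (auto simp: is_partition_def l_def)
  define g where "g j = ys ! (j - 1)" for j
  have sp: "set_mset (part_content l) = Suc ` {..<length ys}"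
    using set_part_content[OF l] by (simp add: l_def)
  have inj: "inj_on g (set_mset (part_content l))"
    unfolding sp using ys(2) by (auto simp: inj_on_def g_def nth_eq_iff_index_eq)
  have img: "g ` set_mset (part_content l) = set_mset M"
    unfolding sp ys(1)[symmetric] by (auto simp: g_def in_set_conv_nth image_image)
  have "image_mset g (part_content l) = M"
  proof (rule multiset_eqI)
    fix y
    show "count (image_mset g (part_content l)) y = count M y"
    proof (cases "y \<in># M")
      case True
      then obtain i where i: "i < length ys" "y = ys ! i" using ys(1) by (metis in_set_conv_nth)
      have Si: "Suc i \<in># part_content l" using i by (simp add: sp)
      have "g -` {y} \<inter> set_mset (part_content l) = {Suc i}"
      proof -
        have gy: "g (Suc i) = y" using i by (simp add: g_def)
        then have "x = Suc i" if "x \<in># part_content l" "g x = y" for x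
          using inj_onD[OF inj, of x "Suc i"] that Si by simp
        then show ?thesis using gy Si by blast
      qed
      then have "count (image_mset g (part_content l)) y = count (part_content l) (Suc i)"
        by (simp add: count_image_mset)
      also have "\<dots> = count M y" using i by (simp add: count_part_content l_def)
      finally show ?thesis .
    next
      case False
      then show ?thesis using img by (metis count_inI set_image_mset)
    qed
  qed
  then show ?thesis using that l m inj by blast
qed

text \<open>The relation defining \<open>htilde\<close>, transported along a relabelling: both sides
  depend only on multiplicities, which an injective relabelling preserves for letters and for
  blocks.\<close>

lemma h_expansion: "fprod (\<lambda>_. True) M = (\<Sum>\<pi>\<in>mset_partitions M. Theta (fprod (\<lambda>_. True) \<pi>))"
proof -
  obtain l g where l: "is_partition l" "mset l = mult_shape M" and
    g: "inj_on g (set_mset (part_content l))" "image_mset g (part_content l) = M"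
    by (rule exists_relabelling[of M])
  let ?C = "part_content l"
  define g' where "g' = inv_into (set_mset ?C) g"
  have g'g: "g' (g i) = i" if "i \<in># ?C" for i using g(1) that by (simp add: g'_def)
  have gg': "g (g' i) = i" if "i \<in># M" for i
    using that g(2) by (metis f_inv_into_f g'_def set_image_mset)
  have M': "image_mset g' M = ?C"
  proof -
    have "image_mset g' M = image_mset (\<lambda>i. i) ?C"
      unfolding g(2)[symmetric] image_mset.compositionality by (rule image_mset_cong) (simp add: g'g)
    then show ?thesis by simp
  qed
  have "fprod (\<lambda>_. True) M = h_part l" using l(2) by (rule fprod_True)
  also have "\<dots> = (\<Sum>\<pi>\<in>mset_partitions ?C. htilde (mtilde \<pi>))" using l(1) by (rule htilde)
  also have "\<dots> = (\<Sum>\<pi>\<in>mset_partitions M. htilde (mtilde \<pi>))"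
  proof (rule sum.reindex_bij_witness[where i = "image_mset (image_mset g')" and j = "image_mset (image_mset g)"])
    fix \<pi> assume \<pi>: "\<pi> \<in> mset_partitions ?C"
    show inv: "image_mset (image_mset g') (image_mset (image_mset g) \<pi>) = \<pi>"
      using \<pi> g'g by (rule image_blocks_inverse)
    show "image_mset (image_mset g) \<pi> \<in> mset_partitions M"
      using mset_partitions_image[OF \<pi>, of g] g(2) by simp
    have "inj_on (image_mset g) (set_mset \<pi>)"
    proof (rule inj_on_inverseI[where g = "image_mset g'"])
      fix B assume "B \<in># \<pi>"
      then have "i \<in># ?C" if "i \<in># B" for i using that mset_partitions_block[OF \<pi>] by blast
      then have "image_mset (g' \<circ> g) B = image_mset (\<lambda>i. i) B" by (intro image_mset_cong) (simp add: g'g)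
      then show "image_mset g' (image_mset g B) = B" by (simp add: image_mset.compositionality)
    qed
    then show "htilde (mtilde (image_mset (image_mset g) \<pi>)) = htilde (mtilde \<pi>)"
      by (simp add: mtilde_eq mult_shape_image)
  next
    fix \<pi> assume \<pi>: "\<pi> \<in> mset_partitions M"
    show "image_mset (image_mset g) (image_mset (image_mset g') \<pi>) = \<pi>"
      using \<pi> gg' by (rule image_blocks_inverse)
    show "image_mset (image_mset g') \<pi> \<in> mset_partitions ?C"
      using mset_partitions_image[OF \<pi>, of g'] M' by simp
  qed
  also have "\<dots> = (\<Sum>\<pi>\<in>mset_partitions M. Theta (fprod (\<lambda>_. True) \<pi>))"
    by (simp add: fprod_True[OF mset_mtilde] Theta(2) is_partition_mtilde)
  finally show ?thesis .
qed

lemma filter_mset_replicate: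
  "filter_mset P (replicate_mset n x) = (if P x then replicate_mset n x else {#})"
  by (induction n) auto

text \<open>Induction on the number of odd letters in \<open>M\<close>, counted with multiplicity.
  As functions of the content both sides satisfy the same alternating relation over the contents
  \<open>Mi i\<close> with \<open>i\<close> copies of an odd \<open>a\<close> and
  \<open>k - i\<close> copies of a fresh even \<open>b\<close>. The terms with \<open>i < k\<close>
  have fewer odd letters, and \<open>Mi k = M\<close>.\<close>

theorem super_expansion:
  assumes "finite Od"
  shows "fprod (\<lambda>i. i \<notin> Od) M = (\<Sum>\<pi>\<in>super_partitions Od M. Theta (fprod (evb Od) \<pi>))"
proof (induction "size (filter_mset (\<lambda>i. i \<in> Od) M)" arbitrary: M rule: less_induct)
  case less
  show ?case
  proof (cases "\<exists>a\<in>Od. a \<in># M")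
    case False
    have block: "okb Od B \<and> evb Od B" if "\<pi> \<in> mset_partitions M" "B \<in># \<pi>" for \<pi> B
    proof -
      have "i \<notin># B" if "i \<in> Od" for i
        using mset_partitions_block[OF \<open>\<pi> \<in> mset_partitions M\<close> \<open>B \<in># \<pi>\<close>] False that by blast
      then have 1: "filter_mset (\<lambda>i. i \<in> Od) B = {#}" and 2: "\<forall>i\<in>Od. count B i = 0"
        by (auto intro: count_inI)
      show ?thesis using 2 unfolding okb_def evb_def 1 by simp
    qed
    have "fprod (\<lambda>i. i \<notin> Od) M = fprod (\<lambda>_. True) M" by (rule fprod_cong) (use False in auto)
    also have "\<dots> = (\<Sum>\<pi>\<in>mset_partitions M. Theta (fprod (\<lambda>_. True) \<pi>))" by (rule h_expansion)
    also have "\<dots> = (\<Sum>\<pi>\<in>super_partitions Od M. Theta (fprod (evb Od) \<pi>))"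
    proof (rule sum.cong)
      show "mset_partitions M = super_partitions Od M" using block by (auto simp: super_partitions_def)
      fix \<pi> assume "\<pi> \<in> super_partitions Od M"
      then have "fprod (\<lambda>_. True) \<pi> = fprod (evb Od) \<pi>"
        using block by (intro fprod_cong) (auto simp: super_partitions_def)
      then show "Theta (fprod (\<lambda>_. True) \<pi>) = Theta (fprod (evb Od) \<pi>)" by simp
    qed
    finally show ?thesis .
  next
    case True
    then obtain a where a: "a \<in> Od" "a \<in># M" by blast
    define k where "k = count M a"
    have k: "0 < k" using a by (simp add: k_def)
    obtain b where "b \<notin> Od \<union> set_mset M" using ex_new_if_finite[of "Od \<union> set_mset M"] assms by auto
    then have b: "b \<notin> Od" "b \<notin># M" "b \<noteq> a" using a by auto
    define M0 where "M0 = filter_mset (\<lambda>i. i \<noteq> a) M"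
    define Mi where "Mi i = M0 + replicate_mset i a + replicate_mset (k - i) b" for i
    have M0: "a \<notin># M0" "b \<notin># M0" using b by (auto simp: M0_def)
    have Mk: "Mi k = M" by (rule multiset_eqI) (auto simp: Mi_def M0_def k_def)
    define G where "G M = (\<Sum>\<pi>\<in>super_partitions Od M. Theta (fprod (evb Od) \<pi>))" for M
    have IH: "fprod (\<lambda>i. i \<notin> Od) (Mi i) = G (Mi i)" if "i < k" for i
      unfolding G_def
    proof (rule less)
      have "size (filter_mset (\<lambda>i. i \<in> Od) (Mi j)) = size (filter_mset (\<lambda>i. i \<in> Od) M0) + j" for j
        using a b by (simp add: Mi_def filter_mset_replicate)
      then show "size (filter_mset (\<lambda>i. i \<in> Od) (Mi i)) < size (filter_mset (\<lambda>i. i \<in> Od) M)"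
        using that by (simp add: Mk[symmetric])
    qed
    \<comment> \<open>The odd letter \<open>a\<close> contributes e_i and the even letter
      \<open>b\<close> contributes h_(k-i).\<close>
    have L: "(\<Sum>i\<le>k. sf_scale ((- 1) ^ i) (fprod (\<lambda>i. i \<notin> Od) (Mi i))) = 0"
    proof -
      have "fprod (\<lambda>i. i \<notin> Od) (Mi i) = fprod (\<lambda>i. i \<notin> Od) M0 * (gk True (k - i) * gk (\<not> True) i)" for i
        unfolding Mi_def using M0 b a
        by (subst fprod_add) (auto simp: fprod_add mult_ac split: if_splits)
      then have "(\<Sum>i\<le>k. sf_scale ((- 1) ^ i) (fprod (\<lambda>i. i \<notin> Od) (Mi i))) =
          fprod (\<lambda>i. i \<notin> Od) M0 * (\<Sum>i\<le>k. sf_scale ((- 1) ^ i) (gk True (k - i) * gk (\<not> True) i))"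
        by (simp only: sum_distrib_left sf_scale_mult)
      then show ?thesis by (simp only: gk_relation[OF k] mult_zero_right)
    qed
    have R: "(\<Sum>i\<le>k. sf_scale ((- 1) ^ i) (G (Mi i))) = 0"
    proof -
      let ?mrg = "image_mset (\<lambda>i. if i = a then b else i)"
      let ?X = "{\<pi>. {#} \<notin># \<pi> \<and> (\<forall>B\<in>#\<pi>. okb Od B) \<and> ?mrg (sum_mset \<pi>) = M0 + replicate_mset k b}"
      let ?S = "SIGMA i:{..k}. super_partitions Od (Mi i)"
      have cMi: "count (Mi i) a = i" for i using M0 b(3) by (simp add: Mi_def not_in_iff)
      \<comment> \<open>Merging \<open>a\<close> with \<open>b\<close> forgets only the number of
        copies of \<open>a\<close>, so a single set of partitions collects all contents
        \<open>Mi i\<close>, and the sign exponent can be read off each partition.\<close>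
      have iff: "?mrg Q = M0 + replicate_mset k b \<longleftrightarrow> count Q a \<le> k \<and> Q = Mi (count Q a)" for Q
      proof
        assume Q: "?mrg Q = M0 + replicate_mset k b"
        have c: "count (?mrg Q) i = count (M0 + replicate_mset k b) i" for i using Q by simp
        have "count Q a + count Q b = k" using c[of b] M0 b(3) by (simp add: count_merge not_in_iff)
        moreover have "count Q i = count M0 i" if "i \<noteq> a" "i \<noteq> b" for i
          using c[of i] that b(3) by (simp add: count_merge split: if_splits)
        ultimately show "count Q a \<le> k \<and> Q = Mi (count Q a)"
          using M0 b(3) by (auto simp: Mi_def multiset_eq_iff not_in_iff)
      next
        assume "count Q a \<le> k \<and> Q = Mi (count Q a)"
        then have q: "count Q a \<le> k" and Q: "Q = Mi (count Q a)" by auto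
        have m: "?mrg (Mi i) = M0 + replicate_mset k b" if "i \<le> k" for i
          using that M0 b(3) by (intro multiset_eqI) (auto simp: count_merge Mi_def not_in_iff)
        show "?mrg Q = M0 + replicate_mset k b" using m[OF q] Q by simp
      qed
      have "finite (snd ` ?S)" by (intro finite_imageI finite_SigmaI) (auto simp: finite_super_partitions)
      moreover have XS: "?X = snd ` ?S"
        unfolding iff by (force simp: super_partitions_def mset_partitions_def cMi)
      ultimately have fin: "finite ?X" by simp
      have "(\<Sum>i\<le>k. sf_scale ((- 1) ^ i) (G (Mi i))) =
          (\<Sum>i\<le>k. \<Sum>\<pi>\<in>super_partitions Od (Mi i). sf_scale ((- 1) ^ i) (Theta (fprod (evb Od) \<pi>)))"
        by (simp add: G_def sf.scale_sum_right)
      also have "\<dots> = (\<Sum>(i, \<pi>)\<in>?S. sf_scale ((- 1) ^ i) (Theta (fprod (evb Od) \<pi>)))"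
        by (rule sum.Sigma) (auto simp: finite_super_partitions)
      also have "\<dots> = (\<Sum>\<pi>\<in>?X. sf_scale ((- 1) ^ count (sum_mset \<pi>) a) (Theta (fprod (evb Od) \<pi>)))"
        unfolding iff
        by (rule sum.reindex_bij_witness[where i = "\<lambda>\<pi>. (count (sum_mset \<pi>) a, \<pi>)" and j = snd])
          (auto simp: super_partitions_def mset_partitions_def cMi)
      also have "\<dots> = 0" by (rule toggle_sum[OF a(1) b(1) k fin])
      finally show ?thesis .
    qed
    have "(\<Sum>i\<le>k. sf_scale ((- 1) ^ i) (fprod (\<lambda>i. i \<notin> Od) (Mi i))) = (\<Sum>i\<le>k. sf_scale ((- 1) ^ i) (G (Mi i)))"
      using L R by simp
    moreover have "(\<Sum>i<k. sf_scale ((- 1) ^ i) (fprod (\<lambda>i. i \<notin> Od) (Mi i))) = (\<Sum>i<k. sf_scale ((- 1) ^ i) (G (Mi i)))"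
      by (rule sum.cong) (auto simp: IH)
    ultimately have "sf_scale ((- 1) ^ k) (fprod (\<lambda>i. i \<notin> Od) (Mi k)) = sf_scale ((- 1) ^ k) (G (Mi k))"
      by (simp add: lessThan_Suc_atMost[symmetric])
    then show ?thesis by (simp add: Mk G_def)
  qed
qed

section \<open>Counting tableaux\<close>

lemma linear_order_finite_max:
  assumes R: "linear_order_on Om R" and "finite A" "A \<noteq> {}" "A \<subseteq> Om"
  obtains a where "a \<in> A" "\<And>b. b \<in> A \<Longrightarrow> (b, a) \<in> R" "\<And>b. b \<in> A - {a} \<Longrightarrow> (a, b) \<notin> R"
proof -
  have "refl_on Om R" "trans R" "antisym R" "total_on Om R"
    using R by (auto simp: linear_order_on_def partial_order_on_def preorder_on_def)
  note r = this
  have "\<exists>a\<in>A. \<forall>b\<in>A. (b, a) \<in> R"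
    using assms(2-4)
  proof (induction A rule: finite_ne_induct)
    case (singleton x)
    then show ?case using r(1) by (auto simp: refl_on_def)
  next
    case (insert x F)
    then obtain a where a: "a \<in> F" "\<forall>b\<in>F. (b, a) \<in> R" by auto
    have xx: "(x, x) \<in> R" using insert.prems r(1) by (auto simp: refl_on_def)
    have "x \<noteq> a" using a insert.hyps by auto
    then have "(x, a) \<in> R \<or> (a, x) \<in> R" using r(4) a insert.prems by (auto simp: total_on_def)
    then show ?case
    proof
      assume "(a, x) \<in> R"
      then have "\<forall>b\<in>insert x F. (b, x) \<in> R" using a xx r(2) by (auto dest: transD)
      then show ?thesis by blast
    qed (use a in auto)
  qed
  then obtain a where a: "a \<in> A" "\<forall>b\<in>A. (b, a) \<in> R" by blast
  moreover have "(a, b) \<notin> R" if "b \<in> A - {a}" for b using that a r(3) by (auto dest: antisymD)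
  ultimately show ?thesis using that by blast
qed

lemma tab_mono: "tab d R ev A f T \<Longrightarrow> pfun f \<Longrightarrow> set_mset (tmult f T) \<subseteq> A' \<Longrightarrow> tab d R ev A' f T"
  by (auto simp: tab_def tmult_def)

lemma tmult_letters: "tab d R ev A f T \<Longrightarrow> pfun f \<Longrightarrow> set_mset (tmult f T) \<subseteq> A"
  by (auto simp: tab_def tmult_def)

lemma size_tmult: "size (tmult f T) = fsize f"
  by (simp add: tmult_def fsize_def)

text \<open>As \<open>bij_betw_tjoin\<close>, but with a variable outer shape and the inner tableau
  listed first: the form in which a Pieri rule adds a strip to a given tableau.\<close>

lemma bij_betw_tab_remove:
  assumes "a \<notin> B" "(a, a) \<in> R" "\<And>b. b \<in> B \<Longrightarrow> (b, a) \<in> R" "\<And>b. b \<in> B \<Longrightarrow> (a, b) \<notin> R"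
  shows "bij_betw (\<lambda>((g, T), f). (f, tjoin a f g T))
    {((g, T), f). strip (ev a) g f \<and> tab d R ev B g T} {(f, T). pfun f \<and> tab d R ev (insert a B) f T}"
  unfolding bij_betw_def
proof
  show "inj_on (\<lambda>((g, T), f). (f, tjoin a f g T)) {((g, T), f). strip (ev a) g f \<and> tab d R ev B g T}"
    unfolding inj_on_def using tjoin_inject[OF _ _ _ _ assms(1)] by clarsimp
  show "(\<lambda>((g, T), f). (f, tjoin a f g T)) ` {((g, T), f). strip (ev a) g f \<and> tab d R ev B g T} =
      {(f, T). pfun f \<and> tab d R ev (insert a B) f T}"
  proof (intro subset_antisym subsetI)
    fix z assume "z \<in> (\<lambda>((g, T), f). (f, tjoin a f g T)) ` {((g, T), f). strip (ev a) g f \<and> tab d R ev B g T}"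
    then show "z \<in> {(f, T). pfun f \<and> tab d R ev (insert a B) f T}"
      using tab_join[OF _ _ assms(1-3)] strip_pfun(2) by auto
  next
    fix z assume "z \<in> {(f, T). pfun f \<and> tab d R ev (insert a B) f T}"
    then obtain f T where z: "z = (f, T)" "pfun f" "tab d R ev (insert a B) f T" by blast
    obtain g T' where g: "strip (ev a) g f" "tab d R ev B g T'" "T = tjoin a f g T'"
      using tab_split[OF z(2,3) assms(1,4)] by blast
    then show "z \<in> (\<lambda>((g, T), f). (f, tjoin a f g T)) ` {((g, T), f). strip (ev a) g f \<and> tab d R ev B g T}"
      by (intro image_eqI[of _ _ "((g, T'), f)"]) (auto simp: z)
  qed
qed

definition tableaux :: "'a \<Rightarrow> ('a \<times> 'a) set \<Rightarrow> ('a \<Rightarrow> bool) \<Rightarrow> 'a multiset \<Rightarrow> ((nat \<Rightarrow> nat) \<times> (nat \<times> nat \<Rightarrow> 'a)) set" where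
  "tableaux d R ev \<pi> = {(f, T). (pfun f \<and> tab d R ev (set_mset \<pi>) f T) \<and> tmult f T = \<pi>}"

definition one_row :: "(nat \<Rightarrow> nat) \<Rightarrow> bool" where
  "one_row f \<longleftrightarrow> (\<forall>i. f (Suc i) = 0)"

text \<open>The row need not use up \<pi>: its letters are those that the extra variable with value
  1 splits off.\<close>

definition row_tableaux :: "'a \<Rightarrow> ('a \<times> 'a) set \<Rightarrow> ('a \<Rightarrow> bool) \<Rightarrow> 'a multiset \<Rightarrow> ((nat \<Rightarrow> nat) \<times> (nat \<times> nat \<Rightarrow> 'a)) set" where
  "row_tableaux d R ev \<pi> = {(f, T). (pfun f \<and> tab d R ev (set_mset \<pi>) f T) \<and> one_row f \<and> tmult f T \<subseteq># \<pi>}"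

lemma finite_tableaux_le:
  "finite {(f, T). (pfun f \<and> tab d R ev (set_mset \<pi>) f T) \<and> fsize f \<le> n}"
proof (rule finite_subset)
  show "{(f, T). (pfun f \<and> tab d R ev (set_mset \<pi>) f T) \<and> fsize f \<le> n} \<subseteq>
     (SIGMA f:{f. pfun f \<and> fsize f \<le> n}. {T. tab d R ev (set_mset \<pi>) f T})" by auto
  show "finite (SIGMA f:{f. pfun f \<and> fsize f \<le> n}. {T. tab d R ev (set_mset \<pi>) f T})"
    by (intro finite_SigmaI finite_pfun_le finite_tab) auto
qed

lemma finite_tableaux: "finite (tableaux d R ev \<pi>)"
  by (rule finite_subset[OF _ finite_tableaux_le[of d R ev \<pi> "size \<pi>"]])
    (auto simp: tableaux_def size_tmult)

lemma finite_row_tableaux: "finite (row_tableaux d R ev \<pi>)"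
  by (rule finite_subset[OF _ finite_tableaux_le[of d R ev \<pi> "size \<pi>"]])
    (auto simp: row_tableaux_def size_tmult dest!: size_mset_mono)

lemma tmult_empty: "pfun f \<Longrightarrow> tmult f T = {#} \<longleftrightarrow> f = (\<lambda>_. 0)"
  using fsize_eq_0_iff[of f] by (metis size_eq_0_iff_empty size_tmult)

lemma tab_zero: "tab d R ev A (\<lambda>_. 0) T \<longleftrightarrow> T = (\<lambda>_. d)"
  by (auto simp: tab_def fcells_def)

text \<open>All copies of the greatest letter are removed in one step because they fill a single
  strip; the order facts handed to the step are those required by
  \<open>bij_betw_tab_remove\<close>.\<close>

lemma multiset_max_induct [consumes 2, case_names empty remove]:
  assumes R: "linear_order_on Om R" and "set_mset \<pi> \<subseteq> Om"
    and "P {#}"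
    and step: "\<And>\<pi> a m. a \<notin># \<pi> \<Longrightarrow> 0 < m \<Longrightarrow> set_mset (\<pi> + replicate_mset m a) \<subseteq> Om \<Longrightarrow> (a, a) \<in> R \<Longrightarrow>
        (\<And>b. b \<in># \<pi> \<Longrightarrow> (b, a) \<in> R) \<Longrightarrow> (\<And>b. b \<in># \<pi> \<Longrightarrow> (a, b) \<notin> R) \<Longrightarrow> P \<pi> \<Longrightarrow> P (\<pi> + replicate_mset m a)"
  shows "P \<pi>"
  using assms(2)
proof (induction "size \<pi>" arbitrary: \<pi> rule: less_induct)
  case less
  show ?case
  proof (cases "\<pi> = {#}")
    case False
    then obtain a where a: "a \<in># \<pi>" "\<And>b. b \<in># \<pi> \<Longrightarrow> (b, a) \<in> R" "\<And>b. b \<in> set_mset \<pi> - {a} \<Longrightarrow> (a, b) \<notin> R"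
      using linear_order_finite_max[OF R, of "set_mset \<pi>"] less.prems by auto
    define \<pi>' where "\<pi>' = filter_mset (\<lambda>b. b \<noteq> a) \<pi>"
    have eq: "\<pi> = \<pi>' + replicate_mset (count \<pi> a) a"
      by (rule multiset_eqI) (auto simp: \<pi>'_def)
    have m: "0 < count \<pi> a" using a(1) by simp
    have "size \<pi> = size \<pi>' + count \<pi> a" using arg_cong[OF eq, of size] by simp
    then have "P \<pi>'" using m less.prems by (intro less.hyps) (auto simp: \<pi>'_def)
    then have "P (\<pi>' + replicate_mset (count \<pi> a) a)"
      using a m less.prems by (intro step) (auto simp: \<pi>'_def)
    then show ?thesis using eq by simp
  qed (use assms(3) in simp)
qed

lemma pieri_sf:
  "pfun g \<Longrightarrow> gk b m * schurf g = (\<Sum>f | strip b g f \<and> fsize f = fsize g + m. schurf f)"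
  by (cases b) (auto simp: gk_def strip_def fun_eq_iff sf_sum_apply pieri_h pieri_e)

lemma sum_Sigma_pairs:
  assumes "finite A" "\<And>g T. (g, T) \<in> A \<Longrightarrow> finite (B g T)"
  shows "(\<Sum>((g, T), f)\<in>(SIGMA (g, T):A. B g T). F g T f) = (\<Sum>(g, T)\<in>A. \<Sum>f\<in>B g T. F g T f)"
  using sum.Sigma[of A "\<lambda>(g, T). B g T" "\<lambda>(g, T) f. F g T f"] assms by (simp add: case_prod_unfold)

text \<open>Iterated Pieri rules in increasing order of the letters: multiplication by the factor of
  a letter adds the strip that this letter fills.\<close>

theorem fprod_eq_sum_tableaux:
  assumes "linear_order_on Om R" "set_mset \<pi> \<subseteq> Om"
  shows "fprod ev \<pi> = (\<Sum>(f, T)\<in>tableaux d R ev \<pi>. schurf f)"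
  using assms
proof (induction rule: multiset_max_induct)
  case empty
  have "tableaux d R ev {#} = {(\<lambda>_. 0, \<lambda>_. d)}"
    by (auto simp: tableaux_def tmult_empty tab_zero)
  then show ?case by (simp add: fprod_def fun_eq_iff)
next
  case (remove \<pi> a m)
  let ?\<pi> = "\<pi> + replicate_mset m a" and ?B = "set_mset \<pi>"
  have set: "set_mset ?\<pi> = insert a ?B" using remove by auto
  have bij: "bij_betw (\<lambda>((g, T), f). (f, tjoin a f g T))
      {x \<in> {((g, T), f). strip (ev a) g f \<and> tab d R ev ?B g T}. case x of ((g, T), f) \<Rightarrow> tmult g T = \<pi> \<and> fsize f = fsize g + m}
      {y \<in> {(f, T). pfun f \<and> tab d R ev (insert a ?B) f T}. case y of (f, T) \<Rightarrow> tmult f T = ?\<pi>}"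
  proof (rule bij_betw_Collect[OF bij_betw_tab_remove[of a ?B R ev d]])
    fix x assume "x \<in> {((g, T), f). strip (ev a) g f \<and> tab d R ev ?B g T}"
    then obtain g T f where x: "x = ((g, T), f)" "strip (ev a) g f" "tab d R ev ?B g T" by blast
    have pg: "pfun g" using x(2) by (rule strip_pfun)
    have an: "a \<notin># tmult g T" using tmult_letters[OF x(3) pg] remove(1) by auto
    \<comment> \<open>Since \<open>a\<close> occurs neither in \<open>T\<close> nor in \<pi>, its
      multiplicity and the remaining letters can be compared separately.\<close>
    have "tmult g T + replicate_mset (fsize f - fsize g) a = \<pi> + replicate_mset m a \<longleftrightarrow>
        tmult g T = \<pi> \<and> fsize f - fsize g = m" (is "?l \<longleftrightarrow> ?r")
    proof
      assume ?l
      then have c: "count (tmult g T + replicate_mset (fsize f - fsize g) a) b = count (\<pi> + replicate_mset m a) b" for b by simp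
      have "fsize f - fsize g = m" using c[of a] an remove(1) by (simp add: not_in_iff)
      with \<open>?l\<close> show ?r by simp
    qed simp
    moreover have "fsize g \<le> fsize f" using x(2) by (rule strip_fsize)
    ultimately show "(case (\<lambda>((g, T), f). (f, tjoin a f g T)) x of (f, T) \<Rightarrow> tmult f T = ?\<pi>) \<longleftrightarrow>
        (case x of ((g, T), f) \<Rightarrow> tmult g T = \<pi> \<and> fsize f = fsize g + m)"
      using x by (auto simp: tmult_tjoin[OF x(2)])
  qed (use remove in auto)
  have dom: "{x \<in> {((g, T), f). strip (ev a) g f \<and> tab d R ev ?B g T}. case x of ((g, T), f) \<Rightarrow> tmult g T = \<pi> \<and> fsize f = fsize g + m}
     = (SIGMA (g, T):tableaux d R ev \<pi>. {f. strip (ev a) g f \<and> fsize f = fsize g + m})"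
    by (auto simp: tableaux_def dest: strip_pfun)
  have cod: "{y \<in> {(f, T). pfun f \<and> tab d R ev (insert a ?B) f T}. case y of (f, T) \<Rightarrow> tmult f T = ?\<pi>} = tableaux d R ev ?\<pi>"
    unfolding tableaux_def set by auto
  have "(\<Sum>(f, T)\<in>tableaux d R ev ?\<pi>. schurf f) =
      (\<Sum>((g, T), f)\<in>(SIGMA (g, T):tableaux d R ev \<pi>. {f. strip (ev a) g f \<and> fsize f = fsize g + m}). schurf f)"
    by (subst sum.reindex_bij_betw[OF bij[unfolded dom cod], symmetric]) (simp add: case_prod_unfold)
  also have "\<dots> = (\<Sum>(g, T)\<in>tableaux d R ev \<pi>. \<Sum>f | strip (ev a) g f \<and> fsize f = fsize g + m. schurf f)"
    by (rule sum_Sigma_pairs) (auto simp: finite_tableaux finite_strip_above)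
  also have "\<dots> = (\<Sum>(g, T)\<in>tableaux d R ev \<pi>. gk (ev a) m * schurf g)"
    by (rule sum.cong) (auto simp: pieri_sf tableaux_def)
  also have "\<dots> = gk (ev a) m * fprod ev \<pi>"
    unfolding remove.IH by (simp add: sum_distrib_left case_prod_unfold)
  also have "\<dots> = fprod ev ?\<pi>"
    using remove(1) by (subst fprod_add) (auto simp: mult.commute)
  finally show ?case by simp
qed

lemma add_one_gk: "add_one (gk b m) = (\<Sum>j | j \<le> m \<and> (b \<or> j \<le> 1). gk b (m - j))"
  by (cases b) (auto simp: gk_def add_one_h_k add_one_e_k atMost_def)

lemma one_row_eq: "one_row f \<Longrightarrow> f = (\<lambda>i. if i = 0 then f 0 else 0)"
proof
  fix i assume "one_row f"
  then show "f i = (if i = 0 then f 0 else 0)" by (cases i) (auto simp: one_row_def)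
qed

lemma pfun_row: "pfun (\<lambda>i. if i = 0 then k else 0)"
  by (rule pfunI[of _ 1]) auto

lemma fsize_one_row: "one_row f \<Longrightarrow> pfun f \<Longrightarrow> fsize f = f 0"
proof -
  assume "one_row f" "pfun f"
  then show ?thesis using fsize_shift[of f] by (simp add: one_row_def comp_def)
qed

text \<open>Lengthening a single row by j cells is a horizontal strip for every j, but a vertical
  strip only for j at most 1. This is the index set in \<open>add_one_gk\<close>.\<close>

lemma sum_strip_one_row:
  assumes g: "pfun g" "one_row g"
  shows "(\<Sum>f | strip b g f \<and> one_row f \<and> fsize f - fsize g \<le> m. F (fsize f - fsize g)) =
    (\<Sum>j | j \<le> m \<and> (b \<or> j \<le> 1). F j)"
proof (rule sum.reindex_bij_witness[where i = "\<lambda>j i. if i = 0 then g 0 + j else 0" and j = "\<lambda>f. f 0 - g 0"])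
  fix f assume "f \<in> {f. strip b g f \<and> one_row f \<and> fsize f - fsize g \<le> m}"
  then have f: "strip b g f" "one_row f" "fsize f - fsize g \<le> m" by auto
  have pf: "pfun f" using f(1) by (rule strip_pfun)
  have sz: "fsize f = f 0" "fsize g = g 0" using fsize_one_row f(2) pf g by auto
  have "g 0 \<le> f 0" using f(1) by (rule strip_le)
  then show "(\<lambda>i. if i = 0 then g 0 + (f 0 - g 0) else 0) = f"
  proof (intro ext)
    fix i assume "g 0 \<le> f 0"
    then show "(if i = 0 then g 0 + (f 0 - g 0) else 0) = f i"
      using fun_cong[OF one_row_eq[OF f(2)], of i] by simp
  qed
  show "f 0 - g 0 \<in> {j. j \<le> m \<and> (b \<or> j \<le> 1)}"
  proof (cases b)
    case False
    then have "f 0 \<le> Suc (g 0)" using f(1) by (simp add: strip_def vstrip_def)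
    then show ?thesis using f(3) sz by auto
  qed (use f(3) sz in simp)
  show "F (f 0 - g 0) = F (fsize f - fsize g)" by (simp add: sz)
next
  fix j assume j: "j \<in> {j. j \<le> m \<and> (b \<or> j \<le> 1)}"
  let ?f = "\<lambda>i. if i = 0 then g 0 + j else 0 :: nat"
  show "?f 0 - g 0 = j" by simp
  have gi: "g (Suc i) = 0" for i using g(2) by (simp add: one_row_def)
  then have gi': "g i = 0" if "i \<noteq> 0" for i using that by (metis not0_implies_Suc)
  have o: "one_row ?f" by (simp add: one_row_def)
  have "strip b g ?f"
    using j g(1) pfun_row[of "g 0 + j"] gi' by (auto simp: strip_def hstrip_def vstrip_def)
  moreover have "fsize ?f = g 0 + j" "fsize g = g 0"
    using fsize_one_row[OF o pfun_row] fsize_one_row[OF g(2,1)] by auto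
  ultimately show "?f \<in> {f. strip b g f \<and> one_row f \<and> fsize f - fsize g \<le> m}"
    using o j by simp
qed

lemma strip_one_row: "strip b g f \<Longrightarrow> one_row f \<Longrightarrow> one_row g"
  unfolding one_row_def by (metis le_zero_eq strip_le)

text \<open>By multiplicativity each factor can be treated alone: from h_m any number of the m
  copies may be taken, from e_m at most one. These are exactly the repetition rules of a one-row
  tableau, and the copies not taken stay in the product.\<close>

theorem add_one_fprod:
  assumes "linear_order_on Om R" "set_mset \<pi> \<subseteq> Om"
  shows "add_one (fprod ev \<pi>) = (\<Sum>(f, T)\<in>row_tableaux d R ev \<pi>. fprod ev (\<pi> - tmult f T))"
  using assms
proof (induction rule: multiset_max_induct)
  case empty
  have "row_tableaux d R ev {#} = {(\<lambda>_. 0, \<lambda>_. d)}"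
    by (auto simp: row_tableaux_def tmult_empty tab_zero one_row_def)
  then show ?case by (simp add: fprod_def add_one_def fun_eq_iff)
next
  case (remove \<pi> a m)
  let ?\<pi> = "\<pi> + replicate_mset m a" and ?B = "set_mset \<pi>"
  have set: "set_mset ?\<pi> = insert a ?B" using remove by auto
  let ?D = "{((g, T), f). strip (ev a) g f \<and> tab d R ev ?B g T}"
  let ?P = "\<lambda>((g, T), f). (one_row g \<and> tmult g T \<subseteq># \<pi>) \<and> one_row f \<and> fsize f - fsize g \<le> m"
  have sub: "tmult g T + replicate_mset j a \<subseteq># ?\<pi> \<longleftrightarrow> tmult g T \<subseteq># \<pi> \<and> j \<le> m"
    if "tab d R ev ?B g T" "pfun g" for g T j
  proof -
    have an: "count (tmult g T) a = 0" "count \<pi> a = 0"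
      using tmult_letters[OF that] remove(1) by (auto simp: not_in_iff[symmetric])
    show ?thesis
    proof
      assume l: "tmult g T + replicate_mset j a \<subseteq># ?\<pi>"
      have c: "count (tmult g T + replicate_mset j a) b \<le> count ?\<pi> b" for b
        using l by (rule mset_subset_eq_count)
      have "j \<le> m" using c[of a] an by simp
      moreover have "count (tmult g T) b \<le> count \<pi> b" for b using c[of b] an by (cases "b = a") auto
      ultimately show "tmult g T \<subseteq># \<pi> \<and> j \<le> m" by (simp add: subseteq_mset_def)
    qed (auto simp: subseteq_mset_def intro!: add_mono)
  qed
  have bij: "bij_betw (\<lambda>((g, T), f). (f, tjoin a f g T)) {x \<in> ?D. ?P x}
      {y \<in> {(f, T). pfun f \<and> tab d R ev (insert a ?B) f T}. case y of (f, T) \<Rightarrow> one_row f \<and> tmult f T \<subseteq># ?\<pi>}"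
  proof (rule bij_betw_Collect[OF bij_betw_tab_remove[of a ?B R ev d]])
    fix x assume "x \<in> ?D"
    then obtain g T f where x: "x = ((g, T), f)" "strip (ev a) g f" "tab d R ev ?B g T" by blast
    have pg: "pfun g" using x(2) by (rule strip_pfun)
    show "(case (\<lambda>((g, T), f). (f, tjoin a f g T)) x of (f, T) \<Rightarrow> one_row f \<and> tmult f T \<subseteq># ?\<pi>) \<longleftrightarrow> ?P x"
      using strip_one_row[OF x(2)] by (auto simp: x(1) tmult_tjoin[OF x(2)] sub[OF x(3) pg])
  qed (use remove in auto)
  have dom: "{x \<in> ?D. ?P x} = (SIGMA (g, T):row_tableaux d R ev \<pi>. {f. strip (ev a) g f \<and> one_row f \<and> fsize f - fsize g \<le> m})"
    by (auto simp: row_tableaux_def dest: strip_pfun)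
  have cod: "{y \<in> {(f, T). pfun f \<and> tab d R ev (insert a ?B) f T}. case y of (f, T) \<Rightarrow> one_row f \<and> tmult f T \<subseteq># ?\<pi>} =
      row_tableaux d R ev ?\<pi>"
    unfolding row_tableaux_def set by auto
  have finf: "finite {f. strip b g f \<and> one_row f \<and> fsize f - fsize g \<le> m}" for b and g :: "nat \<Rightarrow> nat"
    by (rule finite_subset[OF _ finite_pfun_le[of "fsize g + m"]]) (auto dest: strip_pfun)
  have val: "fprod ev (?\<pi> - tmult f (tjoin a f g T)) = gk (ev a) (m - (fsize f - fsize g)) * fprod ev (\<pi> - tmult g T)"
    if "(g, T) \<in> row_tableaux d R ev \<pi>" "strip (ev a) g f" "fsize f - fsize g \<le> m" for f g T
  proof -
    have t: "tab d R ev ?B g T" "pfun g" "tmult g T \<subseteq># \<pi>" using that by (auto simp: row_tableaux_def)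
    have an: "count (tmult g T) a = 0"
      using tmult_letters[OF t(1,2)] remove(1) by (auto simp: not_in_iff[symmetric])
    have "?\<pi> - tmult f (tjoin a f g T) = (\<pi> - tmult g T) + replicate_mset (m - (fsize f - fsize g)) a"
      unfolding tmult_tjoin[OF that(2)]
      by (rule multiset_eqI) (use an remove(1) in \<open>auto simp: not_in_iff\<close>)
    moreover have "a \<notin># \<pi> - tmult g T" using remove(1) by (meson in_diffD)
    ultimately show ?thesis by (simp add: fprod_add mult.commute)
  qed
  have "(\<Sum>(f, T)\<in>row_tableaux d R ev ?\<pi>. fprod ev (?\<pi> - tmult f T)) =
      (\<Sum>((g, T), f)\<in>(SIGMA (g, T):row_tableaux d R ev \<pi>. {f. strip (ev a) g f \<and> one_row f \<and> fsize f - fsize g \<le> m}).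
         fprod ev (?\<pi> - tmult f (tjoin a f g T)))"
    by (subst sum.reindex_bij_betw[OF bij[unfolded dom cod], symmetric]) (simp add: case_prod_unfold)
  also have "\<dots> = (\<Sum>((g, T), f)\<in>(SIGMA (g, T):row_tableaux d R ev \<pi>. {f. strip (ev a) g f \<and> one_row f \<and> fsize f - fsize g \<le> m}).
         gk (ev a) (m - (fsize f - fsize g)) * fprod ev (\<pi> - tmult g T))"
    by (rule sum.cong) (auto simp: val)
  also have "\<dots> = (\<Sum>(g, T)\<in>row_tableaux d R ev \<pi>. \<Sum>f | strip (ev a) g f \<and> one_row f \<and> fsize f - fsize g \<le> m.
         gk (ev a) (m - (fsize f - fsize g)) * fprod ev (\<pi> - tmult g T))"
    by (rule sum_Sigma_pairs) (auto simp: finite_row_tableaux finf)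
  also have "\<dots> = (\<Sum>(g, T)\<in>row_tableaux d R ev \<pi>. add_one (gk (ev a) m) * fprod ev (\<pi> - tmult g T))"
  proof (rule sum.cong[OF refl], clarify)
    fix g T assume "(g, T) \<in> row_tableaux d R ev \<pi>"
    then have g: "pfun g" "one_row g" by (auto simp: row_tableaux_def)
    show "(\<Sum>f | strip (ev a) g f \<and> one_row f \<and> fsize f - fsize g \<le> m. gk (ev a) (m - (fsize f - fsize g)) * fprod ev (\<pi> - tmult g T)) =
        add_one (gk (ev a) m) * fprod ev (\<pi> - tmult g T)"
      unfolding add_one_gk sum_distrib_right[symmetric]
      by (simp only: sum_strip_one_row[OF g, where b = "ev a" and m = m and F = "\<lambda>j. gk (ev a) (m - j)"])
  qed
  also have "\<dots> = add_one (gk (ev a) m) * add_one (fprod ev \<pi>)"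
    unfolding remove.IH by (simp add: sum_distrib_left case_prod_unfold)
  also have "\<dots> = add_one (fprod ev ?\<pi>)"
    unfolding add_one_mult[symmetric] using remove(1) by (subst fprod_add) (auto simp: mult.commute)
  finally show ?case by simp
qed

theorem Theta_fprod:
  assumes R: "linear_order_on Om R" "set_mset \<pi> \<subseteq> Om"
  shows "Theta (fprod ev \<pi>) =
    (\<Sum>(f, T)\<in>row_tableaux d R ev \<pi>. \<Sum>(g, U)\<in>tableaux d R ev (\<pi> - tmult f T). stilde (lof g))"
proof -
  have "fprod ev \<pi> \<in> sf.span (schurf ` {f. pfun f})"
    unfolding fprod_eq_sum_tableaux[OF R, of ev d]
    by (rule sf.span_sum) (auto simp: tableaux_def intro!: sf.span_base)
  then have "Theta (fprod ev \<pi>) = Lambda (add_one (fprod ev \<pi>))" by (rule Theta_eq_Lambda_add_one)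
  also have "\<dots> = (\<Sum>(f, T)\<in>row_tableaux d R ev \<pi>. Lambda (fprod ev (\<pi> - tmult f T)))"
    unfolding add_one_fprod[OF R, of ev d] by (simp add: sf_linear_sum[OF Lambda(1)] case_prod_unfold)
  also have "\<dots> = (\<Sum>(f, T)\<in>row_tableaux d R ev \<pi>. \<Sum>(g, U)\<in>tableaux d R ev (\<pi> - tmult f T). stilde (lof g))"
  proof (rule sum.cong[OF refl], clarify)
    fix f T
    have s: "set_mset (\<pi> - tmult f T) \<subseteq> Om" using R(2) by (meson in_diffD subset_iff)
    have "Lambda (fprod ev (\<pi> - tmult f T)) = (\<Sum>(g, U)\<in>tableaux d R ev (\<pi> - tmult f T). Lambda (schurf g))"
      unfolding fprod_eq_sum_tableaux[OF R(1) s, of ev d] by (simp add: sf_linear_sum[OF Lambda(1)] case_prod_unfold)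
    also have "\<dots> = (\<Sum>(g, U)\<in>tableaux d R ev (\<pi> - tmult f T). stilde (lof g))"
      by (rule sum.cong) (auto simp: Lambda(2) tableaux_def)
    finally show "Lambda (fprod ev (\<pi> - tmult f T)) = (\<Sum>(g, U)\<in>tableaux d R ev (\<pi> - tmult f T). stilde (lof g))" .
  qed
  finally show ?thesis .
qed

section \<open>Odd letters only: multisets of finite sets\<close>

lemma fprod_image:
  assumes "inj_on g (set_mset M)"
  shows "fprod ev (image_mset g M) = fprod (ev \<circ> g) M"
proof -
  have "count (image_mset g M) (g i) = count M i" if "i \<in># M" for i
  proof -
    have "g -` {g i} \<inter> set_mset M = {i}" using assms that by (auto simp: inj_on_def)
    then show ?thesis by (simp add: count_image_mset)
  qed
  then show ?thesis using assms by (simp add: fprod_def prod.reindex)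
qed

lemma e_part_eq_fprod:
  assumes "is_partition \<mu>"
  shows "e_part \<mu> = fprod (\<lambda>i. i \<notin> set_mset (part_content \<mu>)) (part_content \<mu>)"
proof -
  have "e_part \<mu> = (\<Prod>i<length \<mu>. e_k (\<mu> ! i))"
    by (auto simp: fun_eq_iff e_part_def sf_prod_apply prod.list_conv_set_nth atLeast0LessThan)
  also have "\<dots> = (\<Prod>j\<in>set_mset (part_content \<mu>). e_k (count (part_content \<mu>) j))"
    unfolding set_part_content[OF assms]
    by (subst prod.reindex) (auto simp: count_part_content intro!: prod.cong)
  also have "\<dots> = fprod (\<lambda>i. i \<notin> set_mset (part_content \<mu>)) (part_content \<mu>)"
    unfolding fprod_def by (rule prod.cong) (auto simp: gk_def)
  finally show ?thesis .
qed

abbreviation (input) letters :: "nat set set" where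
  "letters \<equiv> {S. finite S \<and> S \<noteq> {} \<and> 0 \<notin> S}"

abbreviation (input) even_card :: "nat set \<Rightarrow> bool" where
  "even_card S \<equiv> even (card S)"

definition content :: "nat set multiset \<Rightarrow> nat multiset" where
  "content \<pi> = sum_mset (image_mset mset_set \<pi>)"

definition set_partitions :: "nat multiset \<Rightarrow> nat set multiset set" where
  "set_partitions M = {\<pi>. set_mset \<pi> \<subseteq> letters \<and> content \<pi> = M}"

lemma okb_mset_set: "set_mset B \<subseteq> Od \<Longrightarrow> okb Od B \<Longrightarrow> mset_set (set_mset B) = B"
proof (rule multiset_eqI)
  fix i assume B: "set_mset B \<subseteq> Od" "okb Od B"
  show "count (mset_set (set_mset B)) i = count B i"
  proof (cases "i \<in># B")
    case True
    then have "count B i \<le> 1" "0 < count B i" using B by (auto simp: okb_def)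
    then have "count B i = 1" by linarith
    then show ?thesis using True by simp
  qed (simp add: not_in_iff)
qed

text \<open>If every letter of the content is odd, a block has no repeated element and is the same
  thing as a finite set. Absence of 0 from \<open>M\<close> puts these sets among
  \<open>letters\<close>.\<close>

lemma bij_betw_set_partitions:
  assumes "0 \<notin># M"
  shows "bij_betw (image_mset mset_set) (set_partitions M) (super_partitions (set_mset M) M)"
proof (rule bij_betw_byWitness[where f' = "image_mset set_mset"])
  show "\<forall>\<pi>\<in>set_partitions M. image_mset set_mset (image_mset mset_set \<pi>) = \<pi>"
  proof
    fix \<pi> assume "\<pi> \<in> set_partitions M"
    then have "image_mset (set_mset \<circ> mset_set) \<pi> = image_mset (\<lambda>S. S) \<pi>"
      by (intro image_mset_cong) (auto simp: set_partitions_def)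
    then show "image_mset set_mset (image_mset mset_set \<pi>) = \<pi>" by (simp add: image_mset.compositionality)
  qed
  have inv: "image_mset mset_set (image_mset set_mset \<pi>) = \<pi>" if \<pi>: "\<pi> \<in> super_partitions (set_mset M) M" for \<pi>
  proof -
    have "image_mset (mset_set \<circ> set_mset) \<pi> = image_mset (\<lambda>B. B) \<pi>"
    proof (rule image_mset_cong)
      fix B assume "B \<in># \<pi>"
      then have "set_mset B \<subseteq> set_mset M" "okb (set_mset M) B"
        using \<pi> mset_partitions_block by (auto simp: super_partitions_def)
      then show "(mset_set \<circ> set_mset) B = B" by (simp add: okb_mset_set)
    qed
    then show ?thesis by (simp add: image_mset.compositionality)
  qed
  then show "\<forall>\<pi>\<in>super_partitions (set_mset M) M. image_mset mset_set (image_mset set_mset \<pi>) = \<pi>" by blast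
  show "image_mset mset_set ` set_partitions M \<subseteq> super_partitions (set_mset M) M"
  proof
    fix \<sigma> assume "\<sigma> \<in> image_mset mset_set ` set_partitions M"
    then obtain \<pi> where \<pi>: "\<pi> \<in> set_partitions M" "\<sigma> = image_mset mset_set \<pi>" by blast
    have S: "finite S" "S \<noteq> {}" if "S \<in># \<pi>" for S using \<pi>(1) that by (auto simp: set_partitions_def)
    have "{#} \<notin># \<sigma>" using S by (auto simp: \<pi>(2) mset_set_empty_iff)
    moreover have "\<forall>B\<in>#\<sigma>. okb (set_mset M) B" by (auto simp: \<pi>(2) okb_def count_mset_set')
    moreover have "sum_mset \<sigma> = M" using \<pi> by (simp add: set_partitions_def content_def)
    ultimately show "\<sigma> \<in> super_partitions (set_mset M) M"
      by (simp add: super_partitions_def mset_partitions_def)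
  qed
  show "image_mset set_mset ` super_partitions (set_mset M) M \<subseteq> set_partitions M"
  proof
    fix \<sigma> assume "\<sigma> \<in> image_mset set_mset ` super_partitions (set_mset M) M"
    then obtain \<pi> where \<pi>: "\<pi> \<in> super_partitions (set_mset M) M" "\<sigma> = image_mset set_mset \<pi>" by blast
    then have p: "\<pi> \<in> mset_partitions M" by (simp add: super_partitions_def)
    have "content \<sigma> = M" using inv[OF \<pi>(1)] p by (simp add: content_def \<pi>(2) mset_partitions_def)
    moreover have "set_mset B \<in> letters" if "B \<in># \<pi>" for B
      using p that mset_partitions_block[OF p that] assms by (auto simp: mset_partitions_def)
    ultimately show "\<sigma> \<in> set_partitions M" by (auto simp: set_partitions_def \<pi>(2))
  qed
qed

lemma set_partitions_support:
  assumes "\<pi> \<in> set_partitions M" "S \<in># \<pi>" shows "S \<subseteq> set_mset M"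
proof -
  have "finite S" using assms by (auto simp: set_partitions_def)
  moreover have "mset_set S \<subseteq># M"
    using assms by (auto simp: set_partitions_def content_def dest!: multi_member_split)
  ultimately show ?thesis by (metis finite_set_mset_mset_set set_mset_mono)
qed

lemma e_part_expansion:
  assumes "is_partition \<mu>"
  shows "e_part \<mu> = (\<Sum>\<pi>\<in>set_partitions (part_content \<mu>). Theta (fprod even_card \<pi>))"
proof -
  let ?M = "part_content \<mu>"
  have 0: "0 \<notin># ?M" by (simp add: set_part_content[OF assms])
  have "e_part \<mu> = (\<Sum>\<pi>\<in>super_partitions (set_mset ?M) ?M. Theta (fprod (evb (set_mset ?M)) \<pi>))"
    using super_expansion[of "set_mset ?M" ?M] by (simp add: e_part_eq_fprod[OF assms])
  also have "\<dots> = (\<Sum>\<pi>\<in>set_partitions ?M. Theta (fprod (evb (set_mset ?M)) (image_mset mset_set \<pi>)))"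
    by (rule sum.reindex_bij_betw[OF bij_betw_set_partitions[OF 0], symmetric])
  also have "\<dots> = (\<Sum>\<pi>\<in>set_partitions ?M. Theta (fprod even_card \<pi>))"
  proof (rule sum.cong[OF refl])
    fix \<pi> assume \<pi>: "\<pi> \<in> set_partitions ?M"
    have fin: "finite S" if "S \<in># \<pi>" for S using \<pi> that by (auto simp: set_partitions_def)
    have inj: "inj_on mset_set (set_mset \<pi>)"
      by (rule inj_on_inverseI[where g = set_mset]) (use fin in auto)
    \<comment> \<open>All elements of a block are odd letters, so its degree is the parity of its
      cardinality.\<close>
    have "(evb (set_mset ?M) \<circ> mset_set) S = even_card S" if "S \<in># \<pi>" for S
    proof -
      have "filter_mset (\<lambda>i. i \<in># ?M) (mset_set S) = mset_set S"
        unfolding filter_mset_eq_conv using set_partitions_support[OF \<pi> that] fin[OF that] by auto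
      then show ?thesis by (simp add: evb_def)
    qed
    then have "fprod (evb (set_mset ?M)) (image_mset mset_set \<pi>) = fprod even_card \<pi>"
      unfolding fprod_image[OF inj] by (rule fprod_cong)
    then show "Theta (fprod (evb (set_mset ?M)) (image_mset mset_set \<pi>)) = Theta (fprod even_card \<pi>)" by simp
  qed
  finally show ?thesis .
qed

text \<open>The two components of a skew filling before they are placed in one shape; only their
  joint content is prescribed.\<close>

definition tableau_pairs where
  "tableau_pairs ord M = {((f, T), (g, U)). (pfun f \<and> one_row f \<and> tab {} ord even_card letters f T) \<and>
     (pfun g \<and> tab {} ord even_card letters g U) \<and> content (tmult f T + tmult g U) = M}"

lemma finite_set_partitions: "0 \<notin># M \<Longrightarrow> finite (set_partitions M)"
  using bij_betw_finite[OF bij_betw_set_partitions] finite_super_partitions by blast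

lemma e_part_eq_sum_pairs:
  assumes ord: "linear_order_on letters ord" and \<mu>: "is_partition \<mu>"
  shows "e_part \<mu> = (\<Sum>((f, T), (g, U))\<in>tableau_pairs ord (part_content \<mu>). stilde (lof g))"
proof -
  let ?M = "part_content \<mu>"
  let ?RT = "row_tableaux {} ord even_card" and ?TB = "tableaux {} ord even_card"
  let ?P = "\<lambda>\<pi>. SIGMA (f, T):?RT \<pi>. ?TB (\<pi> - tmult f T)"
  have 0: "0 \<notin># ?M" by (simp add: set_part_content[OF \<mu>])
  have fin: "finite (?P \<pi>)" for \<pi>
    by (rule finite_SigmaI) (auto simp: finite_row_tableaux finite_tableaux)
  have "e_part \<mu> = (\<Sum>\<pi>\<in>set_partitions ?M. \<Sum>(f, T)\<in>?RT \<pi>. \<Sum>(g, U)\<in>?TB (\<pi> - tmult f T). stilde (lof g))"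
    unfolding e_part_expansion[OF \<mu>]
    by (rule sum.cong[OF refl]) (rule Theta_fprod[OF ord], auto simp: set_partitions_def)
  also have "\<dots> = (\<Sum>\<pi>\<in>set_partitions ?M. \<Sum>((f, T), (g, U))\<in>?P \<pi>. stilde (lof g))"
  proof (rule sum.cong[OF refl])
    fix \<pi>
    have "(\<Sum>((f, T), z)\<in>?P \<pi>. stilde (lof (fst z))) = (\<Sum>(f, T)\<in>?RT \<pi>. \<Sum>z\<in>?TB (\<pi> - tmult f T). stilde (lof (fst z)))"
      by (rule sum_Sigma_pairs) (auto simp: finite_row_tableaux finite_tableaux)
    then show "(\<Sum>(f, T)\<in>?RT \<pi>. \<Sum>(g, U)\<in>?TB (\<pi> - tmult f T). stilde (lof g)) = (\<Sum>((f, T), (g, U))\<in>?P \<pi>. stilde (lof g))"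
      by (simp add: case_prod_unfold)
  qed
  also have "\<dots> = (\<Sum>(\<pi>, ((f, T), (g, U)))\<in>(SIGMA \<pi>:set_partitions ?M. ?P \<pi>). stilde (lof g))"
    using sum.Sigma[of "set_partitions ?M" ?P "\<lambda>\<pi> ((f, T), (g, U)). stilde (lof g)"] fin finite_set_partitions[OF 0]
    by (simp add: case_prod_unfold)
  also have "\<dots> = (\<Sum>((f, T), (g, U))\<in>tableau_pairs ord ?M. stilde (lof g))"
  proof (rule sum.reindex_bij_witness[where
        i = "\<lambda>((f, T), (g, U)). (tmult f T + tmult g U, ((f, T), (g, U)))" and j = snd], goal_cases)
    case (1 z)
    then show ?case by (auto simp: row_tableaux_def tableaux_def)
  next
    case (2 z)
    then obtain \<pi> f T g U where z: "z = (\<pi>, ((f, T), (g, U)))" "\<pi> \<in> set_partitions ?M" "pfun f" "one_row f"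
      "tab {} ord even_card (set_mset \<pi>) f T" "tmult f T \<subseteq># \<pi>" "pfun g"
      "tab {} ord even_card (set_mset (\<pi> - tmult f T)) g U" "tmult g U = \<pi> - tmult f T"
      by (auto simp: row_tableaux_def tableaux_def)
    have l: "set_mset \<pi> \<subseteq> letters" "content \<pi> = ?M" using z(2) by (auto simp: set_partitions_def)
    have s: "tmult f T + tmult g U = \<pi>" using z(6,9) by simp
    have "set_mset (tmult f T) \<subseteq> letters" "set_mset (tmult g U) \<subseteq> letters"
      using l(1) unfolding s[symmetric] by auto
    then have "tab {} ord even_card letters f T" "tab {} ord even_card letters g U"
      using tab_mono[OF z(5,3)] tab_mono[OF z(8,7)] by simp_all
    then show ?case unfolding z(1) tableau_pairs_def using z(3,4,7) s l(2) by simp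
  next
    case (3 z)
    then show ?case by (auto simp: tableau_pairs_def)
  next
    case (4 z)
    then obtain f T g U where z: "z = ((f, T), (g, U))" "pfun f" "one_row f" "tab {} ord even_card letters f T"
      "pfun g" "tab {} ord even_card letters g U" "content (tmult f T + tmult g U) = ?M"
      by (auto simp: tableau_pairs_def)
    have "tab {} ord even_card (set_mset (tmult f T + tmult g U)) f T" "tab {} ord even_card (set_mset (tmult g U)) g U"
      using tab_mono[OF z(4,2)] tab_mono[OF z(6,5)] by auto
    moreover have "set_mset (tmult f T + tmult g U) \<subseteq> letters"
      using tmult_letters[OF z(4,2)] tmult_letters[OF z(6,5)] by auto
    ultimately show ?case
      using z by (auto simp: set_partitions_def row_tableaux_def tableaux_def)
  qed (auto simp: case_prod_unfold)
  finally show ?thesis .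
qed

section \<open>The skew shape as a row and a straight shape\<close>

lemma chain_trans:
  assumes "trans R" "i < j" "\<And>m. i \<le> m \<Longrightarrow> m < j \<Longrightarrow> (F m, F (Suc m)) \<in> R"
  shows "(F i, F j) \<in> R"
  using assms(2,3)
proof (induction j)
  case (Suc j)
  show ?case
  proof (cases "i = j")
    case False
    then have "(F i, F j) \<in> R" using Suc by simp
    then show ?thesis using Suc.prems(2)[of j] Suc.prems(1) assms(1) by (auto dest: transD)
  qed (use Suc.prems(2)[of j] in simp)
qed simp

lemma skew_cells_iff: "(r, c) \<in> skew_cells l \<longleftrightarrow> c < pf l r \<and> (r = 0 \<longrightarrow> pf l 1 \<le> c)"
  by (auto simp: skew_cells_def cells_eq pf_def)

lemma content_tmult: "pfun f \<Longrightarrow> content (tmult f T) = (\<Sum>p\<in>fcells f. mset_set (T p))"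
  by (simp add: content_def tmult_def image_mset.compositionality comp_def sum_unfold_sum_mset)

lemma content_add: "content (\<pi> + \<sigma>) = content \<pi> + content \<sigma>"
  by (simp add: content_def)

text \<open>The first row is moved left past its \<lambda>_2 blank cells and becomes a one-row shape
  of length \<lambda>_1 - \<lambda>_2.\<close>

definition row_part :: "nat list \<Rightarrow> (nat \<times> nat \<Rightarrow> nat set) \<Rightarrow> (nat \<Rightarrow> nat) \<times> (nat \<times> nat \<Rightarrow> nat set)" where
  "row_part l T = ((\<lambda>i. if i = 0 then pf l 0 - pf l 1 else 0), (\<lambda>(r, c). if r = 0 then T (0, c + pf l 1) else {}))"

definition upper_part :: "nat list \<Rightarrow> (nat \<times> nat \<Rightarrow> nat set) \<Rightarrow> (nat \<Rightarrow> nat) \<times> (nat \<times> nat \<Rightarrow> nat set)" where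
  "upper_part l T = (pf l \<circ> Suc, (\<lambda>(r, c). T (Suc r, c)))"

text \<open>\<open>g 0\<close> is \<lambda>_2: the first row of the outer shape consists of
  \<open>g 0\<close> blanks followed by \<open>f 0\<close> filled cells.\<close>

definition glue_shape :: "(nat \<Rightarrow> nat) \<Rightarrow> (nat \<Rightarrow> nat) \<Rightarrow> nat list" where
  "glue_shape f g = lof (case_nat (f 0 + g 0) g)"

definition glue_filling :: "(nat \<times> nat \<Rightarrow> nat set) \<Rightarrow> (nat \<Rightarrow> nat) \<Rightarrow> (nat \<times> nat \<Rightarrow> nat set) \<Rightarrow> nat \<times> nat \<Rightarrow> nat set" where
  "glue_filling T g U = (\<lambda>(r, c). case r of 0 \<Rightarrow> if g 0 \<le> c then T (0, c - g 0) else {} | Suc r' \<Rightarrow> U (r', c))"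

lemma sum_skew_cells:
  fixes F :: "nat \<times> nat \<Rightarrow> 'b::comm_monoid_add"
  assumes l: "is_partition l"
  shows "(\<Sum>p\<in>skew_cells l. F p) =
    (\<Sum>p\<in>fcells (\<lambda>i. if i = 0 then pf l 0 - pf l 1 else 0). F (0, snd p + pf l 1)) +
    (\<Sum>p\<in>fcells (pf l \<circ> Suc). F (Suc (fst p), snd p))"
proof -
  let ?f = "\<lambda>i::nat. if i = 0 then pf l 0 - pf l 1 else 0 :: nat" and ?g = "pf l \<circ> Suc"
  have fin: "finite (fcells ?f)" "finite (fcells ?g)"
    using pfun_row pfun_shift[OF pfun_pf[OF l]] by auto
  have eq: "skew_cells l = (\<lambda>p. (0, snd p + pf l 1)) ` fcells ?f \<union> (\<lambda>p. (Suc (fst p), snd p)) ` fcells ?g"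
  proof (intro subset_antisym subsetI)
    fix z assume z: "z \<in> skew_cells l"
    obtain r c where rc: "z = (r, c)" by (cases z)
    show "z \<in> (\<lambda>p. (0, snd p + pf l 1)) ` fcells ?f \<union> (\<lambda>p. (Suc (fst p), snd p)) ` fcells ?g"
    proof (cases r)
      case 0
      then show ?thesis using z rc by (intro UnI1 image_eqI[of _ _ "(0, c - pf l 1)"]) (auto simp: skew_cells_iff)
    next
      case (Suc r')
      then show ?thesis using z rc by (intro UnI2 image_eqI[of _ _ "(r', c)"]) (auto simp: skew_cells_iff)
    qed
  next
    fix z assume "z \<in> (\<lambda>p. (0, snd p + pf l 1)) ` fcells ?f \<union> (\<lambda>p. (Suc (fst p), snd p)) ` fcells ?g"
    then show "z \<in> skew_cells l" by (auto simp: skew_cells_iff split: if_splits)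
  qed
  have inj: "inj_on (\<lambda>p. (0 :: nat, snd p + pf l 1)) (fcells ?f)" "inj_on (\<lambda>p. (Suc (fst p), snd p)) (fcells ?g)"
    by (auto simp: inj_on_def split: if_splits)
  have "sum F (skew_cells l) = sum F ((\<lambda>p. (0, snd p + pf l 1)) ` fcells ?f) + sum F ((\<lambda>p. (Suc (fst p), snd p)) ` fcells ?g)"
    unfolding eq by (rule sum.union_disjoint) (use fin in auto)
  then show ?thesis
    by (simp only: sum.reindex[OF inj(1)] sum.reindex[OF inj(2)]) (simp add: comp_def)
qed

text \<open>\<open>set_tableau\<close> compares neighbours only; transitivity of \<open>ord\<close>
  extends this to all pairs in a line, as \<open>tab\<close> demands.\<close>

lemma split_tableau:
  assumes ord: "trans ord" and T: "set_tableau ord M l T"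
  shows "(row_part l T, upper_part l T) \<in> tableau_pairs ord M"
proof -
  have l: "is_partition l" using T by (simp add: set_tableau_def)
  have pl: "pfun (pf l)" using l by (rule pfun_pf)
  let ?f = "\<lambda>i::nat. if i = 0 then pf l 0 - pf l 1 else 0 :: nat" and ?g = "pf l \<circ> Suc"
  let ?T = "\<lambda>(r, c). if r = 0 then T (0, c + pf l 1) else {}" and ?U = "\<lambda>(r, c). T (Suc r, c)"
  note Td = T[unfolded set_tableau_def]
  note out = Td[THEN conjunct2, THEN conjunct1, rule_format]
  note row = Td[THEN conjunct2, THEN conjunct2, THEN conjunct2, THEN conjunct1, rule_format, OF conjI]
  note col = Td[THEN conjunct2, THEN conjunct2, THEN conjunct2, THEN conjunct2, THEN conjunct1, rule_format, OF conjI]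
  note cont = Td[THEN conjunct2, THEN conjunct2, THEN conjunct2, THEN conjunct2, THEN conjunct2, THEN conjunct1]
  note ev = Td[THEN conjunct2, THEN conjunct2, THEN conjunct2, THEN conjunct2, THEN conjunct2, THEN conjunct2, THEN conjunct1, rule_format, OF conjI, OF _ conjI, OF _ _ conjI]
  note od = Td[THEN conjunct2, THEN conjunct2, THEN conjunct2, THEN conjunct2, THEN conjunct2, THEN conjunct2, THEN conjunct2, rule_format, OF conjI, OF _ conjI, OF _ _ conjI]
  have let1: "T p \<in> letters" if "p \<in> skew_cells l" for p
    using bspec[OF Td[THEN conjunct2, THEN conjunct2, THEN conjunct1] that] by simp
  have pf: "pfun ?f" by (rule pfun_row)
  have pg: "pfun ?g" using pl by (rule pfun_shift)
  have "tab {} ord even_card letters ?f ?T"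
    unfolding tab_def
  proof (intro conjI allI impI ballI)
    fix p assume "p \<notin> fcells ?f"
    then show "?T p = {}" by (cases p) (auto intro!: out simp: skew_cells_iff)
  next
    fix p assume "p \<in> fcells ?f"
    then show "?T p \<in> letters"
      using let1[of "(0, snd p + pf l 1)"] by (cases p) (auto simp: skew_cells_iff split: if_splits)
  next
    fix r c c' assume c: "c < c'" "c' < ?f r"
    then have r: "r = 0" "c' < pf l 0 - pf l 1" by (auto split: if_splits)
    have "(T (0, c + pf l 1), T (0, c' + pf l 1)) \<in> ord"
    proof (rule chain_trans[OF ord c(1), of "\<lambda>c. T (0, c + pf l 1)"])
      fix m assume "c \<le> m" "m < c'"
      then show "(T (0, m + pf l 1), T (0, Suc m + pf l 1)) \<in> ord"
        using row[of 0 "m + pf l 1"] r by (simp add: skew_cells_iff)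
    qed
    then show "(?T (r, c), ?T (r, c')) \<in> ord" using r by simp
    show "even_card (?T (r, c))" if "?T (r, c) = ?T (r, c')"
      using ev[of 0 "c + pf l 1" "c' + pf l 1"] that r c by (simp add: skew_cells_iff)
  next
    fix r r' c assume "r < r'" "c < ?f r'"
    then have False by (simp split: if_splits)
    then show "(?T (r, c), ?T (r', c)) \<in> ord" "?T (r, c) = ?T (r', c) \<Longrightarrow> \<not> even_card (?T (r, c))" by auto
  qed
  moreover have "tab {} ord even_card letters ?g ?U"
    unfolding tab_def
  proof (intro conjI allI impI ballI)
    fix p assume "p \<notin> fcells ?g"
    then show "?U p = {}" by (cases p) (auto intro!: out simp: skew_cells_iff)
  next
    fix p assume "p \<in> fcells ?g"
    then show "?U p \<in> letters"
      using let1[of "(Suc (fst p), snd p)"] by (cases p) (auto simp: skew_cells_iff)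
  next
    fix r c c' assume c: "c < c'" "c' < ?g r"
    have "(T (Suc r, c), T (Suc r, c')) \<in> ord"
    proof (rule chain_trans[OF ord c(1), of "\<lambda>c. T (Suc r, c)"])
      fix m assume "c \<le> m" "m < c'"
      then show "(T (Suc r, m), T (Suc r, Suc m)) \<in> ord"
        using row[of "Suc r" m] c by (simp add: skew_cells_iff)
    qed
    then show "(?U (r, c), ?U (r, c')) \<in> ord" by simp
    show "even_card (?U (r, c))" if "?U (r, c) = ?U (r, c')"
      using ev[of "Suc r" c c'] that c by (simp add: skew_cells_iff)
  next
    fix r r' c assume c: "r < r'" "c < ?g r'"
    \<comment> \<open>The cells between two cells of a column lie in the diagram, so the chain of
      neighbours is unbroken.\<close>
    have cells: "c < pf l (Suc m)" if "m \<le> r'" for m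
      using pfun_antimono[OF pg that] c(2) by simp
    have "(T (Suc r, c), T (Suc r', c)) \<in> ord"
    proof (rule chain_trans[OF ord c(1), of "\<lambda>r. T (Suc r, c)"])
      fix m assume "r \<le> m" "m < r'"
      then show "(T (Suc m, c), T (Suc (Suc m), c)) \<in> ord"
        using col[of "Suc m" c] cells[of m] cells[of "Suc m"] by (simp add: skew_cells_iff)
    qed
    then show "(?U (r, c), ?U (r', c)) \<in> ord" by simp
    show "\<not> even_card (?U (r, c))" if "?U (r, c) = ?U (r', c)"
      using od[of "Suc r" c "Suc r'"] that c cells[of r] cells[of r'] by (simp add: skew_cells_iff)
  qed
  moreover have "content (tmult ?f ?T + tmult ?g ?U) = M"
  proof -
    have "(\<Sum>p\<in>fcells ?f. mset_set (?T p)) = (\<Sum>p\<in>fcells ?f. mset_set (T (0, snd p + pf l 1)))"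
      by (rule sum.cong) (auto split: if_splits)
    moreover have "(\<Sum>p\<in>fcells ?g. mset_set (?U p)) = (\<Sum>p\<in>fcells ?g. mset_set (T (Suc (fst p), snd p)))"
      by (rule sum.cong) auto
    ultimately show ?thesis
      using cont sum_skew_cells[OF l, of "\<lambda>p. mset_set (T p)"]
      by (simp only: content_add content_tmult[OF pf] content_tmult[OF pg])
  qed
  moreover have "one_row ?f" by (simp add: one_row_def)
  ultimately show ?thesis using pf pg by (simp add: tableau_pairs_def row_part_def upper_part_def)
qed

lemma pf_glue_shape:
  assumes "pfun g" shows "pf (glue_shape f g) = case_nat (f 0 + g 0) g" "is_partition (glue_shape f g)"
  using pfun_case_nat[OF assms, of "f 0 + g 0"] by (auto simp: glue_shape_def pf_lof is_partition_lof)

lemma glue_inverse: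
  assumes f: "pfun f" "one_row f" and T: "tab {} ord ev A f T" and g: "pfun g"
  shows "row_part (glue_shape f g) (glue_filling T g U) = (f, T)"
    "upper_part (glue_shape f g) (glue_filling T g U) = (g, U)"
proof -
  have F: "(\<lambda>i. if i = 0 then f 0 else 0) = f" using one_row_eq[OF f(2)] by (rule sym)
  have T': "(\<lambda>(r, c). if r = 0 then T (0, c) else {}) = T"
  proof (intro ext, clarify)
    fix r c show "(if r = 0 then T (0, c) else {}) = T (r, c)"
      using tab_outside[OF T, of "(r, c)"] f(2) by (cases r) (auto simp: one_row_def)
  qed
  show "row_part (glue_shape f g) (glue_filling T g U) = (f, T)"
    unfolding row_part_def pf_glue_shape[OF g] glue_filling_def by (simp add: F T' cong: if_cong)
  show "upper_part (glue_shape f g) (glue_filling T g U) = (g, U)"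
    by (auto simp: upper_part_def pf_glue_shape[OF g] glue_filling_def fun_eq_iff)
qed

lemma split_inverse:
  assumes T: "set_tableau ord M l T"
  shows "glue_shape (fst (row_part l T)) (fst (upper_part l T)) = l"
    "glue_filling (snd (row_part l T)) (fst (upper_part l T)) (snd (upper_part l T)) = T"
proof -
  have l: "is_partition l" using T by (simp add: set_tableau_def)
  have le: "pf l (Suc 0) \<le> pf l 0" using pfun_antimono[OF pfun_pf[OF l], of 0 1] by simp
  have "case_nat (pf l 0 - pf l 1 + pf l 1) (pf l \<circ> Suc) = pf l"
    using le by (auto simp: fun_eq_iff split: nat.split)
  then show "glue_shape (fst (row_part l T)) (fst (upper_part l T)) = l"
    by (simp add: glue_shape_def row_part_def upper_part_def lof_pf[OF l])
  have "T (0, c) = {}" if "\<not> pf l 1 \<le> c" for c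
    using T that by (simp add: set_tableau_def skew_cells_iff)
  then show "glue_filling (snd (row_part l T)) (fst (upper_part l T)) (snd (upper_part l T)) = T"
    by (auto simp: glue_filling_def row_part_def upper_part_def fun_eq_iff split: nat.split)
qed

lemma glue_tableau:
  assumes "((f, T), (g, U)) \<in> tableau_pairs ord M"
  shows "set_tableau ord M (glue_shape f g) (glue_filling T g U)"
proof -
  have f: "pfun f" "one_row f" and T: "tab {} ord even_card letters f T"
    and g: "pfun g" and U: "tab {} ord even_card letters g U"
    and M: "content (tmult f T + tmult g U) = M"
    using assms by (auto simp: tableau_pairs_def)
  let ?l = "glue_shape f g" and ?S = "glue_filling T g U"
  note pl = pf_glue_shape[OF g, of f]
  have cells: "(r, c) \<in> skew_cells ?l \<longleftrightarrow> (case r of 0 \<Rightarrow> g 0 \<le> c \<and> c - g 0 < f 0 | Suc r' \<Rightarrow> c < g r')" for r c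
    by (auto simp: skew_cells_iff pl split: nat.split)
  have fS: "f (Suc i) = 0" for i using f(2) by (simp add: one_row_def)
  have row: "(?S (r, c), ?S (r, c')) \<in> ord \<and> (?S (r, c) = ?S (r, c') \<longrightarrow> even_card (?S (r, c)))"
    if "(r, c) \<in> skew_cells ?l" "(r, c') \<in> skew_cells ?l" "c < c'" for r c c'
  proof (cases r)
    case 0
    then have "g 0 \<le> c" using that by (simp add: cells)
    then have "c - g 0 < c' - g 0" using that(3) by simp
    then show ?thesis
      using 0 that tab_row[OF T, of "c - g 0" "c' - g 0" 0] by (simp add: cells glue_filling_def)
  next
    case (Suc r')
    then show ?thesis using that tab_row[OF U, of c c' r'] by (simp add: cells glue_filling_def)
  qed
  have col: "(?S (r, c), ?S (r', c)) \<in> ord \<and> (?S (r, c) = ?S (r', c) \<longrightarrow> \<not> even_card (?S (r, c)))"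
    if "(r, c) \<in> skew_cells ?l" "(r', c) \<in> skew_cells ?l" "r < r'" for r r' c
  proof (cases r)
    \<comment> \<open>A filled cell of row 0 lies in a column \<open>c\<close> with
      \<open>g 0 \<le> c\<close>, where every other row has already ended; no column condition links
      the two parts.\<close>
    case 0
    have "0 < r'" using that by simp
    then obtain r'' where "r' = Suc r''" by (cases r') auto
    then show ?thesis using that 0 pfun_antimono[OF g, of 0 r''] by (simp add: cells)
  next
    case (Suc q)
    have "0 < r'" using that by simp
    then obtain r'' where "r' = Suc r''" by (cases r') auto
    then show ?thesis using that Suc tab_col[OF U, of q r'' c] by (simp add: cells glue_filling_def)
  qed
  show ?thesis
    unfolding set_tableau_def
  proof (intro conjI allI impI ballI)
    show "is_partition ?l" by (rule pl)
  next
    fix p assume p: "p \<notin> skew_cells ?l"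
    obtain r c where rc: "p = (r, c)" by (cases p)
    show "?S p = {}"
      using p rc tab_outside[OF T, of "(0, c - g 0)"] tab_outside[OF U, of "(r - 1, c)"]
      by (cases r) (auto simp: cells glue_filling_def)
  next
    fix p assume p: "p \<in> skew_cells ?l"
    obtain r c where rc: "p = (r, c)" by (cases p)
    have "?S p \<in> letters"
      using p rc tab_letter[OF T, of "(0, c - g 0)"] tab_letter[OF U, of "(r - 1, c)"]
      by (cases r) (auto simp: cells glue_filling_def)
    then show "finite (?S p)" "?S p \<noteq> {}" "0 \<notin> ?S p" by auto
  next
    fix r c assume "(r, c) \<in> skew_cells ?l \<and> (r, Suc c) \<in> skew_cells ?l"
    then show "(?S (r, c), ?S (r, Suc c)) \<in> ord" using row[of r c "Suc c"] by simp
  next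
    fix r c assume "(r, c) \<in> skew_cells ?l \<and> (Suc r, c) \<in> skew_cells ?l"
    then show "(?S (r, c), ?S (Suc r, c)) \<in> ord" using col[of r c "Suc r"] by simp
  next
    have "(\<Sum>p\<in>skew_cells ?l. mset_set (?S p)) =
        (\<Sum>p\<in>fcells (\<lambda>i. if i = 0 then f 0 else 0). mset_set (?S (0, snd p + g 0))) +
        (\<Sum>p\<in>fcells (case_nat (f 0 + g 0) g \<circ> Suc). mset_set (?S (Suc (fst p), snd p)))"
      using sum_skew_cells[OF pl(2), of "\<lambda>p. mset_set (?S p)"] unfolding pl(1) by (simp cong: if_cong)
    also have "(\<lambda>i. if i = 0 then f 0 else 0) = f" using one_row_eq[OF f(2)] by (rule sym)
    also have "case_nat (f 0 + g 0) g \<circ> Suc = g" by (simp add: fun_eq_iff)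
    also have "(\<Sum>p\<in>fcells f. mset_set (?S (0, snd p + g 0))) = (\<Sum>p\<in>fcells f. mset_set (T p))"
    proof (rule sum.cong[OF refl])
      fix p assume p: "p \<in> fcells f"
      obtain r c where rc: "p = (r, c)" by (cases p)
      then have "r = 0" using p fS by (cases r) auto
      then show "mset_set (?S (0, snd p + g 0)) = mset_set (T p)" by (simp add: rc glue_filling_def)
    qed
    also have "(\<Sum>p\<in>fcells g. mset_set (?S (Suc (fst p), snd p))) = (\<Sum>p\<in>fcells g. mset_set (U p))"
      by (rule sum.cong) (auto simp: glue_filling_def)
    finally show "(\<Sum>p\<in>skew_cells ?l. mset_set (?S p)) = M"
      using M by (simp add: content_add content_tmult f g)
  next
    fix r c c' assume a: "(r, c) \<in> skew_cells ?l \<and> (r, c') \<in> skew_cells ?l \<and> c \<noteq> c' \<and> ?S (r, c) = ?S (r, c')"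
    show "even_card (?S (r, c))"
    proof (cases "c < c'")
      case True
      then show ?thesis using a row[of r c c'] by simp
    next
      case False
      then show ?thesis using a row[of r c' c] by simp
    qed
  next
    fix r r' c assume a: "(r, c) \<in> skew_cells ?l \<and> (r', c) \<in> skew_cells ?l \<and> r \<noteq> r' \<and> ?S (r, c) = ?S (r', c)"
    show "odd (card (?S (r, c)))"
    proof (cases "r < r'")
      case True
      then show ?thesis using a col[of r c r'] by simp
    next
      case False
      then show ?thesis using a col[of r' c r] by simp
    qed
  qed
qed

theorem theorem8:
  fixes ord :: "(nat set \<times> nat set) set" and \<mu> :: "nat list"
  assumes "linear_order_on {S. finite S \<and> S \<noteq> {} \<and> 0 \<notin> S} ord"
    and "is_partition \<mu>"
  shows "e_part \<mu> = (\<lambda>N x. \<Sum>(l, T)\<in>{(l, T). set_tableau ord (part_content \<mu>) l T}. stilde (tl l) N x)"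
proof (intro ext)
  fix N x
  have tr: "trans ord"
    using assms(1) by (auto simp: linear_order_on_def partial_order_on_def preorder_on_def)
  have "e_part \<mu> N x = (\<Sum>((f, T), (g, U))\<in>tableau_pairs ord (part_content \<mu>). stilde (lof g) N x)"
    unfolding e_part_eq_sum_pairs[OF assms] by (simp add: sf_sum_apply case_prod_unfold)
  also have "\<dots> = (\<Sum>(l, T)\<in>{(l, T). set_tableau ord (part_content \<mu>) l T}. stilde (tl l) N x)"
  proof (rule sum.reindex_bij_witness[where
        j = "\<lambda>((f, T), (g, U)). (glue_shape f g, glue_filling T g U)" and
        i = "\<lambda>(l, T). (row_part l T, upper_part l T)"], goal_cases)
    case (1 z)
    then obtain f T g U where "z = ((f, T), (g, U))" "pfun f" "one_row f" "tab {} ord even_card letters f T" "pfun g"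
      by (auto simp: tableau_pairs_def)
    then show ?case by (simp add: glue_inverse)
  next
    case (2 z)
    then obtain f T g U where z: "z = ((f, T), (g, U))" "((f, T), (g, U)) \<in> tableau_pairs ord (part_content \<mu>)"
      by (metis surj_pair)
    then show ?case using glue_tableau[OF z(2)] by simp
  next
    case (3 y)
    then show ?case using split_inverse by (auto simp: case_prod_unfold)
  next
    case (4 y)
    then show ?case using split_tableau[OF tr] by auto
  next
    case (5 z)
    then obtain f T g U where z: "z = ((f, T), (g, U))" "pfun g" by (auto simp: tableau_pairs_def)
    \<comment> \<open>Without its first row the outer shape is \<open>g\<close>, the shape that
      indexes the summand of the pair.\<close>
    have "is_partition (tl (glue_shape f g))" by (rule is_partition_tl[OF pf_glue_shape(2)[OF z(2)]])
    moreover have "pf (tl (glue_shape f g)) = g"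
      unfolding pf_tl pf_glue_shape[OF z(2)] by (simp add: fun_eq_iff)
    ultimately have "tl (glue_shape f g) = lof g" by (metis lof_pf)
    then show ?case by (simp add: z)
  qed
  finally show "e_part \<mu> N x = (\<Sum>(l, T)\<in>{(l, T). set_tableau ord (part_content \<mu>) l T}. stilde (tl l) N x)" .
qed

end
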